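(* Let $n\geq 2$ and $\alpha\in(0,1)$. Let $\Omega\subset\mathbb{R}^n$ be a bounded connected domain with $\partial\Omega$ of class $C^{4,\alpha}$ (the boundary $\partial\Omega$ is not assumed to be connected). Let $a,C\in\mathbb{R}$ and $\Gamma\geq 0$ be constants, and suppose that $u\in C^{4,\alpha}(\overline\Omega)$ solves $$ -\operatorname{div}\left(\frac{Du}{\sqrt{1+|Du|^2}}\right)=\frac{1}{\sqrt{1+|Du|^2}}\quad\text{in }\Omega, \qquad u=a\quad\text{on }\partial\Omega, \qquad \partial_\nu u=\Gamma H+C\quad\text{on }\partial\Omega . $$ Then there exist $x_0\in\mathbb{R}^n$ and $R>0$ such that $\Omega=B_R(x_0)$. Moreover, $u$ is radial about $x_0$.
   Context: $\nu$ denotes the outer unit normal of $\Omega$ along $\partial\Omega$, and $\partial_\nu u$ the corresponding normal derivative. $H$ is the normalized mean curvature of $\partial\Omega$ with the sign convention $$H=-\frac{1}{n-1}\operatorname{div}_{\partial\Omega}\nu,$$ so that $H=-1/R$ on $\partial B_R$ when the domain is the ball $B_R$. $B_R(x_0)$ is the open ball of radius $R$ centered at $x_0$. "Radial about $x_0$" means that $u(x)$ depends only on $|x-x_0|$. *)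

theory Defs
  imports "HOL-Analysis.Analysis"
begin

subsection \<open>Hoelder spaces and regularity of the boundary\<close>

primrec iter_partial ::
    "'a::euclidean_space list \<Rightarrow> ('a \<Rightarrow> real) \<Rightarrow> 'a \<Rightarrow> real" where
  "iter_partial [] f = f"
| "iter_partial (b # bs) f = (\<lambda>x. frechet_derivative (iter_partial bs f) (at x) b)"

text \<open>
  For open \<open>S\<close>, the space \<open>C\<^sup>k\<^sup>,\<^sup>\<alpha>(closure S)\<close>: the partial derivatives of order at most
  \<open>k\<close> exist in \<open>S\<close> and extend continuously to \<open>closure S\<close>, and those of order \<open>k\<close> are
  uniformly \<open>\<alpha>\<close>-Hoelder continuous in \<open>S\<close>. The extension of \<open>f\<close> itself has to be \<open>f\<close>;
  the values of \<open>f\<close> outside \<open>closure S\<close> are irrelevant.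
\<close>

definition holder_space_closure ::
    "nat \<Rightarrow> real \<Rightarrow> 'a::euclidean_space set \<Rightarrow> ('a \<Rightarrow> real) set" where
  "holder_space_closure k \<alpha> S = {f.
     continuous_on (closure S) f \<and>
     (\<forall>bs\<in>lists Basis. length bs < k \<longrightarrow>
        (\<forall>x\<in>S. iter_partial bs f differentiable (at x))) \<and>
     (\<forall>bs\<in>lists Basis. length bs \<le> k \<longrightarrow>
        (\<exists>g. continuous_on (closure S) g \<and> (\<forall>x\<in>S. g x = iter_partial bs f x))) \<and>
     (\<forall>bs\<in>lists Basis. length bs = k \<longrightarrow>
        (\<exists>L. \<forall>x\<in>S. \<forall>y\<in>S.
           \<bar>iter_partial bs f x - iter_partial bs f y\<bar> \<le> L * dist x y powr \<alpha>))}"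

text \<open>
  Near each boundary point the set is the region above a \<open>C\<^sup>k\<^sup>,\<^sup>\<alpha>\<close> graph over a hyperplane
  with unit normal \<open>e\<close>. The graph function \<open>g\<close> is evaluated only at the orthogonal
  projection of \<open>x\<close> to that hyperplane; a function of \<open>n - 1\<close> variables is regarded as a
  function on the whole space by extending it constantly in direction \<open>e\<close>.
\<close>

definition holder_boundary :: "nat \<Rightarrow> real \<Rightarrow> 'a::euclidean_space set \<Rightarrow> bool" where
  "holder_boundary k \<alpha> \<Omega> \<longleftrightarrow>
     (\<forall>p\<in>frontier \<Omega>. \<exists>r>0. \<exists>e. \<exists>g\<in>holder_space_closure k \<alpha> UNIV.
        norm e = 1 \<and>
        \<Omega> \<inter> ball p r = {x \<in> ball p r. g (x - (x \<bullet> e) *\<^sub>R e) < x \<bullet> e})"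

subsection \<open>Gradient and divergence\<close>

definition gradient :: "('a::euclidean_space \<Rightarrow> real) \<Rightarrow> 'a \<Rightarrow> 'a" where
  "gradient f x = (\<Sum>b\<in>Basis. frechet_derivative f (at x) b *\<^sub>R b)"

definition divergence :: "('a::euclidean_space \<Rightarrow> 'a) \<Rightarrow> 'a \<Rightarrow> real" where
  "divergence X x = (\<Sum>b\<in>Basis. frechet_derivative X (at x) b \<bullet> b)"

subsection \<open>Geometry of the boundary\<close>

definition tangent_space :: "'a::euclidean_space set \<Rightarrow> 'a \<Rightarrow> 'a set" where
  "tangent_space M x = {v. \<exists>c \<epsilon>. \<epsilon> > 0 \<and> c 0 = x \<and> (\<forall>t\<in>{-\<epsilon><..<\<epsilon>}. c t \<in> M) \<and>
     (c has_vector_derivative v) (at 0)}"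

definition is_orthonormal_basis :: "'a::euclidean_space set \<Rightarrow> 'a set \<Rightarrow> bool" where
  "is_orthonormal_basis B V \<longleftrightarrow>
     pairwise orthogonal B \<and> (\<forall>b\<in>B. norm b = 1) \<and> span B = V"

definition is_outer_unit_normal :: "'a::euclidean_space set \<Rightarrow> 'a \<Rightarrow> 'a \<Rightarrow> bool" where
  "is_outer_unit_normal \<Omega> x w \<longleftrightarrow>
     norm w = 1 \<and> (\<forall>v\<in>tangent_space (frontier \<Omega>) x. w \<bullet> v = 0) \<and>
     (\<exists>\<epsilon>>0. \<forall>t\<in>{0<..<\<epsilon>}. x - t *\<^sub>R w \<in> \<Omega> \<and> x + t *\<^sub>R w \<notin> closure \<Omega>)"

definition outer_normal :: "'a::euclidean_space set \<Rightarrow> 'a \<Rightarrow> 'a" where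
  "outer_normal \<Omega> x = (THE w. is_outer_unit_normal \<Omega> x w)"

text \<open>
  A derivative of \<open>X\<close> at \<open>x\<close> within a hypersurface \<open>M\<close> is unique only on the tangent space
  (see \<open>has_derivative_within_tangent_unique\<close> below), and only its values there enter the
  surface divergence. Being a trace, the sum does not depend on the orthonormal basis.
\<close>

definition surface_divergence ::
    "'a::euclidean_space set \<Rightarrow> ('a \<Rightarrow> 'a) \<Rightarrow> 'a \<Rightarrow> real" where
  "surface_divergence M X x =
     (let B = (SOME B. is_orthonormal_basis B (tangent_space M x))
      in \<Sum>\<tau>\<in>B. frechet_derivative X (at x within M) \<tau> \<bullet> \<tau>)"

definition mean_curvature :: "'a::euclidean_space set \<Rightarrow> 'a \<Rightarrow> real" where
  "mean_curvature \<Omega> x =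
     - (1 / (real DIM('a) - 1)) * surface_divergence (frontier \<Omega>) (outer_normal \<Omega>) x"

text \<open>
  The normal derivative is one-sided, since \<open>x + t *\<^sub>R outer_normal \<Omega> x\<close> belongs to
  \<open>\<Omega>\<close> for small negative \<open>t\<close> only.
\<close>

definition has_normal_derivative ::
    "'a::euclidean_space set \<Rightarrow> ('a \<Rightarrow> real) \<Rightarrow> real \<Rightarrow> 'a \<Rightarrow> bool" where
  "has_normal_derivative \<Omega> u d x \<longleftrightarrow>
     ((\<lambda>t. u (x + t *\<^sub>R outer_normal \<Omega> x)) has_real_derivative d) (at_left 0)"

subsection \<open>The example of the ball\<close>

lemma has_derivative_within_tangent_unique:
  fixes M :: "'a::euclidean_space set" and X :: "'a \<Rightarrow> 'a"
  assumes D: "(X has_derivative D) (at x within M)"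
    and E: "(X has_derivative E) (at x within M)"
    and v: "v \<in> tangent_space M x"
  shows "D v = E v"
proof -
  obtain c \<epsilon> where c: "\<epsilon> > 0" "c 0 = x" "\<And>t. t \<in> {-\<epsilon><..<\<epsilon>} \<Longrightarrow> c t \<in> M"
      "(c has_vector_derivative v) (at 0)"
    using v unfolding tangent_space_def by blast
  let ?I = "{-\<epsilon><..<\<epsilon>}"
  have at0: "at 0 within ?I = at (0::real)"
    using c(1) by (intro at_within_open) auto
  have cI: "(c has_derivative (\<lambda>t. t *\<^sub>R v)) (at 0 within ?I)"
    using c(4) has_derivative_at_withinI unfolding has_vector_derivative_def by blast
  have *: "(X \<circ> c has_vector_derivative F v) (at 0)"
    if F: "(X has_derivative F) (at x within M)" for F
  proof -
    have "(X has_derivative F) (at (c 0) within c ` ?I)"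
      using F c by (auto intro: has_derivative_subset)
    from diff_chain_within[OF cI this]
    have "(X \<circ> c has_derivative F \<circ> (\<lambda>t. t *\<^sub>R v)) (at 0)"
      unfolding at0 .
    moreover have "F \<circ> (\<lambda>t. t *\<^sub>R v) = (\<lambda>t. t *\<^sub>R F v)"
      using has_derivative_linear[OF F] by (auto simp: linear_cmul)
    ultimately show ?thesis
      unfolding has_vector_derivative_def by simp
  qed
  show ?thesis
    using *[OF D] *[OF E] vector_derivative_unique_at by blast
qed

lemma tangent_space_sphere:
  fixes p :: "'a::euclidean_space"
  assumes "R > 0" and x: "x \<in> sphere p R"
  shows "tangent_space (sphere p R) x = {v. (x - p) \<bullet> v = 0}"
proof (intro equalityI subsetI)
  fix v assume "v \<in> tangent_space (sphere p R) x"
  then obtain c \<epsilon> where c: "\<epsilon> > 0" "c 0 = x" "\<And>t. t \<in> {-\<epsilon><..<\<epsilon>} \<Longrightarrow> c t \<in> sphere p R"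
      "(c has_vector_derivative v) (at 0)"
    unfolding tangent_space_def by blast
  have "((\<lambda>t. (c t - p) \<bullet> (c t - p)) has_derivative
      (\<lambda>t. (c 0 - p) \<bullet> (t *\<^sub>R v) + (t *\<^sub>R v) \<bullet> (c 0 - p))) (at 0)"
    using c(4) unfolding has_vector_derivative_def
    by (auto intro!: derivative_eq_intros)
  moreover have "((\<lambda>t. (c t - p) \<bullet> (c t - p)) has_derivative (\<lambda>_. 0)) (at 0)"
  proof (rule has_derivative_transform_within_open)
    show "((\<lambda>t. R\<^sup>2) has_derivative (\<lambda>_. 0)) (at (0::real))" by simp
    show "open {-\<epsilon><..<\<epsilon>}" "0 \<in> {-\<epsilon><..<\<epsilon>}" using c(1) by auto
    show "R\<^sup>2 = (c t - p) \<bullet> (c t - p)" if "t \<in> {-\<epsilon><..<\<epsilon>}" for t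
      using c(3)[OF that] by (simp add: dist_norm norm_minus_commute flip: power2_norm_eq_inner)
  qed
  ultimately have "(\<lambda>t. (c 0 - p) \<bullet> (t *\<^sub>R v) + (t *\<^sub>R v) \<bullet> (c 0 - p)) = (\<lambda>_. 0)"
    by (rule has_derivative_unique)
  from fun_cong[OF this, of 1] show "v \<in> {v. (x - p) \<bullet> v = 0}"
    using c(2) by (simp add: inner_commute)
next
  fix v assume "v \<in> {v. (x - p) \<bullet> v = 0}"
  then have v: "(x - p) \<bullet> v = 0" by simp
  show "v \<in> tangent_space (sphere p R) x"
  proof (cases "v = 0")
    case True
    then show ?thesis
      unfolding tangent_space_def using x
      by (auto intro!: exI[of _ "\<lambda>_. x"] exI[of _ 1])
  next
    case False
    define \<omega> where "\<omega> = norm v / R"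
    have \<omega>: "\<omega> > 0" using False assms by (simp add: \<omega>_def)
    define c where "c t = p + cos (\<omega> * t) *\<^sub>R (x - p) + (sin (\<omega> * t) / \<omega>) *\<^sub>R v" for t
    have nx: "(x - p) \<bullet> (x - p) = R\<^sup>2"
      using x by (simp add: dist_norm norm_minus_commute flip: power2_norm_eq_inner)
    have nv: "v \<bullet> v = (\<omega> * R)\<^sup>2"
      using assms by (simp add: \<omega>_def flip: power2_norm_eq_inner)
    have "c t \<in> sphere p R" for t
    proof -
      have "(norm (c t - p))\<^sup>2 = (cos (\<omega> * t))\<^sup>2 * R\<^sup>2 + (sin (\<omega> * t) / \<omega>)\<^sup>2 * (\<omega> * R)\<^sup>2"
        unfolding power2_norm_eq_inner c_def
        using v nx nv by (simp add: inner_add_left inner_add_right inner_commute power2_eq_square)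
      also have "\<dots> = ((cos (\<omega> * t))\<^sup>2 + (sin (\<omega> * t))\<^sup>2) * R\<^sup>2"
        using \<omega> by (simp add: field_simps del: sin_cos_squared_add sin_cos_squared_add2)
      also have "\<dots> = R\<^sup>2" by simp
      finally show ?thesis
        using assms by (simp add: dist_norm norm_minus_commute)
    qed
    moreover have "(c has_vector_derivative v) (at 0)"
      unfolding c_def has_vector_derivative_def using \<omega>
      by (auto intro!: derivative_eq_intros)
    moreover have "c 0 = x" by (simp add: c_def)
    ultimately show ?thesis
      unfolding tangent_space_def by (auto intro!: exI[of _ c] exI[of _ 1])
  qed
qed

lemma outer_normal_ball:
  fixes p :: "'a::euclidean_space"
  assumes R: "R > 0" and x: "x \<in> sphere p R"
  shows "outer_normal (ball p R) x = (x - p) /\<^sub>R R"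
proof -
  have nx: "norm (x - p) = R" using x by (simp add: dist_norm norm_minus_commute)
  have fr: "frontier (ball p R) = sphere p R" "closure (ball p R) = cball p R" using R by auto
  have "is_outer_unit_normal (ball p R) x ((x - p) /\<^sub>R R)"
    unfolding is_outer_unit_normal_def fr tangent_space_sphere[OF assms]
  proof (intro conjI ballI exI[of _ R])
    fix t assume t: "t \<in> {0<..<R}"
    have "x - t *\<^sub>R ((x - p) /\<^sub>R R) - p = (1 - t / R) *\<^sub>R (x - p)"
         "x + t *\<^sub>R ((x - p) /\<^sub>R R) - p = (1 + t / R) *\<^sub>R (x - p)"
      by (auto simp: algebra_simps divide_inverse)
    then have "norm (x - t *\<^sub>R ((x - p) /\<^sub>R R) - p) = \<bar>1 - t / R\<bar> * R"
        "norm (x + t *\<^sub>R ((x - p) /\<^sub>R R) - p) = \<bar>1 + t / R\<bar> * R"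
      by (auto simp: nx)
    moreover have "\<bar>1 - t / R\<bar> * R < R" "\<bar>1 + t / R\<bar> * R > R"
      using t R by (auto simp: abs_if field_simps)
    ultimately show "x - t *\<^sub>R ((x - p) /\<^sub>R R) \<in> ball p R" "x + t *\<^sub>R ((x - p) /\<^sub>R R) \<notin> cball p R"
      by (simp_all add: dist_norm norm_minus_commute)
  qed (use R nx in auto)
  moreover have "w = (x - p) /\<^sub>R R" if w: "is_outer_unit_normal (ball p R) x w" for w
  proof -
    define l where "l = (x - p) \<bullet> w / R\<^sup>2"
    define v where "v = w - l *\<^sub>R (x - p)"
    have xx: "(x - p) \<bullet> (x - p) = R\<^sup>2" using nx by (simp flip: power2_norm_eq_inner)
    have "(x - p) \<bullet> v = (x - p) \<bullet> w - l * R\<^sup>2"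
      by (simp only: v_def inner_diff_right[of _ w] inner_scaleR_right xx)
    then have v: "(x - p) \<bullet> v = 0"
      using R by (simp add: l_def)
    then have wv: "w \<bullet> v = 0"
      using w unfolding is_outer_unit_normal_def fr tangent_space_sphere[OF assms] by blast
    have "v \<bullet> v = w \<bullet> v - l * ((x - p) \<bullet> v)"
      by (subst (1) v_def) (simp only: inner_diff_left[of w] inner_scaleR_left)
    then have "v \<bullet> v = 0"
      using v wv by simp
    then have wl: "w = l *\<^sub>R (x - p)" by (simp add: v_def)
    have "\<bar>l\<bar> * R = norm w" by (simp add: wl nx)
    also have "\<dots> = 1" using w by (simp add: is_outer_unit_normal_def)
    finally have l: "\<bar>l\<bar> = 1 / R" using R by (simp add: field_simps)
    obtain \<epsilon> where \<epsilon>: "\<epsilon> > 0" "\<And>t. t \<in> {0<..<\<epsilon>} \<Longrightarrow> x - t *\<^sub>R w \<in> ball p R"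
      using w unfolding is_outer_unit_normal_def by blast
    have "l > 0"
    proof (rule ccontr)
      assume "\<not> l > 0"
      then have "\<bar>1 - \<epsilon> / 2 * l\<bar> \<ge> 1"
        using \<epsilon>(1) mult_nonneg_nonpos[of "\<epsilon> / 2" l] by linarith
      then have "\<bar>1 - \<epsilon> / 2 * l\<bar> * R \<ge> R" using R by simp
      moreover have "x - (\<epsilon> / 2) *\<^sub>R w - p = (1 - \<epsilon> / 2 * l) *\<^sub>R (x - p)"
        unfolding wl scaleR_left_diff_distrib by simp
      then have "norm (x - (\<epsilon> / 2) *\<^sub>R w - p) = \<bar>1 - \<epsilon> / 2 * l\<bar> * R"
        by (simp only: norm_scaleR nx)
      moreover have "norm (x - (\<epsilon> / 2) *\<^sub>R w - p) < R"
        using \<epsilon>(2)[of "\<epsilon> / 2"] \<epsilon>(1) by (simp add: dist_norm norm_minus_commute)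
      ultimately show False by linarith
    qed
    then have "l = inverse R" using l by (simp add: divide_inverse)
    then show ?thesis using wl by simp
  qed
  ultimately show ?thesis
    unfolding outer_normal_def by (rule the_equality)
qed

lemma mean_curvature_ball:
  fixes p :: "'a::euclidean_space"
  assumes n: "DIM('a) \<ge> 2" and R: "R > 0" and x: "x \<in> frontier (ball p R)"
  shows "mean_curvature (ball p R) x = - 1 / R"
proof -
  have fr: "frontier (ball p R) = sphere p R" using R by auto
  have xS: "x \<in> sphere p R" using x fr by simp
  let ?N = "outer_normal (ball p R)" and ?T = "tangent_space (sphere p R) x"
  have T: "?T = {v. (x - p) \<bullet> v = 0}" by (rule tangent_space_sphere[OF R xS])
  have "((\<lambda>z. (z - p) /\<^sub>R R) has_derivative (\<lambda>h. h /\<^sub>R R)) (at x within sphere p R)"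
    by (auto intro!: derivative_eq_intros)
  then have D: "(?N has_derivative (\<lambda>h. h /\<^sub>R R)) (at x within sphere p R)"
    by (rule has_derivative_transform[OF xS, rotated]) (use outer_normal_ball[OF R] in simp)
  then have "(?N has_derivative frechet_derivative ?N (at x within sphere p R)) (at x within sphere p R)"
    using frechet_derivative_works differentiable_def by blast
  then have E: "frechet_derivative ?N (at x within sphere p R) v = v /\<^sub>R R" if "v \<in> ?T" for v
    using has_derivative_within_tangent_unique D that by blast
  define B where "B = (SOME B. is_orthonormal_basis B ?T)"
  have "subspace ?T" unfolding T by (rule subspace_hyperplane)
  then have "\<exists>B. is_orthonormal_basis B ?T"
    by (rule orthonormal_basis_subspace) (auto simp: is_orthonormal_basis_def)
  then have B: "is_orthonormal_basis B ?T" unfolding B_def by (rule someI_ex)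
  then have "independent B"
    by (intro pairwise_orthogonal_independent) (auto simp: is_orthonormal_basis_def)
  then have "card B = dim ?T"
    using B dim_span_eq_card_independent unfolding is_orthonormal_basis_def by metis
  also have "\<dots> = DIM('a) - 1"
    unfolding T using xS R by (intro dim_hyperplane) auto
  finally have card: "real (card B) = real DIM('a) - 1" using n by simp
  have "(\<Sum>\<tau>\<in>B. frechet_derivative ?N (at x within sphere p R) \<tau> \<bullet> \<tau>) = (\<Sum>\<tau>\<in>B. 1 / R)"
  proof (rule sum.cong)
    fix \<tau> assume "\<tau> \<in> B"
    then have "\<tau> \<in> ?T" "norm \<tau> = 1"
      using B span_base unfolding is_orthonormal_basis_def by blast+
    then show "frechet_derivative ?N (at x within sphere p R) \<tau> \<bullet> \<tau> = 1 / R"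
      by (simp add: E divide_inverse flip: power2_norm_eq_inner)
  qed simp
  then show ?thesis
    using n by (simp add: mean_curvature_def fr surface_divergence_def B_def[symmetric] card)
qed

end

theory Submission
  imports Defs
begin

text \<open>
  The proof is the method of moving planes, in the form in which the plane stops only once.

  Written as \<open>ell (Du) (D\<^sup>2u) = - (1 + |Du|\<^sup>2)\<close>, the equation is quasilinear elliptic, does not
  contain \<open>u\<close> itself and is invariant under reflections. Hence, for two solutions with gradients \<open>p\<close>
  and \<open>q\<close>, the difference \<open>w\<close> satisfies \<open>ell p (D\<^sup>2w) + ell q (D\<^sup>2w) \<le> K |Dw|\<close>
  (\<open>ell_difference_bound\<close>), an inequality without a term of order zero. Comparison therefore holds
  on every domain, however large: as soon as the part of \<open>\<Omega>\<close> on one side of a plane is reflected into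
  \<open>\<Omega>\<close>, the difference \<open>w = u - u \<circ> refl\<close> is nonnegative on the reflected cap, since \<open>u > a\<close> inside
  \<open>\<Omega>\<close>. What has to be moved is only the plane, and its extreme position can be described directly: it
  is the supremum of the heights of the planes orthogonal to a direction \<open>e\<close> that reflect some point
  of \<open>\<Omega>\<close> out of \<open>\<Omega>\<close> (\<open>symmetric_in_direction\<close>). A maximising sequence produces either a boundary
  point whose mirror image is another boundary point, or a boundary point on the plane whose normal is
  parallel to the plane. In both cases \<open>w\<close> has to vanish somewhere in the reflected cap.

  In the first case (\<open>zero_of_tangency\<close>) the reflected domain touches \<open>\<partial>\<Omega>\<close> from inside, so that the mean
  curvatures are ordered (\<open>tangency_comparison\<close>). As \<open>\<Gamma> \<ge> 0\<close>, the overdetermined condition then orders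
  the normal derivatives, and the ordering contradicts the Hopf lemma if \<open>w > 0\<close>.

  In the second case (\<open>zero_of_corner\<close>) Serrin's corner lemma shows that \<open>w > 0\<close> would grow
  quadratically into the corner (\<open>corner_lemma\<close>). Its first derivatives vanish there, and the
  relevant second derivative is the mixed one, in the normal of the boundary and in the normal of the
  plane. By the overdetermined condition it is, up to the sign, \<open>\<Gamma>\<close> times a derivative of the mean curvature along
  \<open>\<partial>\<Omega>\<close>, and the sign of this third-order quantity follows from the inclusion of the reflected
  cap in \<open>\<Omega>\<close> (\<open>corner_curvature_derivative\<close>): \<open>w\<close> cannot grow as required.

  Once \<open>w\<close> has a zero, the strong maximum principle spreads it, and connectedness of \<open>\<Omega>\<close> gives the
  symmetry of \<open>\<Omega>\<close> and \<open>u\<close> (\<open>symmetric_of_zero\<close>). Since \<open>\<Omega>\<close> is bounded, all planes of symmetry pass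
  through one point; so \<open>\<Omega>\<close> and \<open>u\<close> are radial, and the inclusions for the planes beyond the
  extreme position exclude annuli (\<open>star_shaped\<close>).

  The maximum principles are proved without linearised coefficients: at an interior minimum of
  \<open>w - \<epsilon>h\<close> the gradients agree and the Hessians are ordered, so that a barrier \<open>h\<close> only has to satisfy
  the strict reverse inequality (\<open>comparison_principle\<close>).
\<close>

section \<open>Second derivatives and traces\<close>

text \<open>
  Derivatives are taken within \<open>S\<close>. For the closure of a domain this says that \<open>f\<close> is twice
  differentiable up to the boundary; for open \<open>S\<close> it is ordinary differentiability.
\<close>

definition grad_hess :: "'a::euclidean_space set \<Rightarrow> ('a \<Rightarrow> real) \<Rightarrow> ('a \<Rightarrow> 'a) \<Rightarrow> ('a \<Rightarrow> 'a \<Rightarrow> 'a) \<Rightarrow> bool" where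
  "grad_hess S f D L \<longleftrightarrow> (\<forall>x\<in>S. (f has_derivative (\<lambda>v. D x \<bullet> v)) (at x within S) \<and>
     (D has_derivative L x) (at x within S))"

lemma grad_hessD:
  assumes "grad_hess S f D L" "x \<in> S"
  shows "(f has_derivative (\<lambda>v. D x \<bullet> v)) (at x within S)" "(D has_derivative L x) (at x within S)"
    "linear (L x)"
  using assms has_derivative_linear unfolding grad_hess_def by blast+

lemma grad_hess_openD:
  assumes "grad_hess S f D L" "x \<in> S" "open S"
  shows "(f has_derivative (\<lambda>v. D x \<bullet> v)) (at x)" "(D has_derivative L x) (at x)"
  using grad_hessD(1,2)[OF assms(1,2)] at_within_open[OF assms(2,3)] by metis+

lemma grad_hess_subset:
  assumes "grad_hess S f D L" "T \<subseteq> S"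
  shows "grad_hess T f D L"
  using assms unfolding grad_hess_def by (meson has_derivative_subset subsetD)

lemma grad_hess_continuous_on:
  assumes "grad_hess S f D L"
  shows "continuous_on S f" "continuous_on S D"
  using has_derivative_continuous[OF grad_hessD(1)[OF assms]]
    has_derivative_continuous[OF grad_hessD(2)[OF assms]]
  by (simp_all add: continuous_on_eq_continuous_within)

lemma has_derivative_along_line:
  fixes f :: "'a::euclidean_space \<Rightarrow> 'b::real_normed_vector"
  assumes "(f has_derivative f') (at (x + t *\<^sub>R v))"
  shows "((\<lambda>t. f (x + t *\<^sub>R v)) has_derivative (\<lambda>h. h *\<^sub>R f' v)) (at t)"
proof -
  have "((\<lambda>t. x + t *\<^sub>R v) has_derivative (\<lambda>h. h *\<^sub>R v)) (at t)"
    by (auto intro!: derivative_eq_intros)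
  from diff_chain_at[OF this assms]
  have "(f \<circ> (\<lambda>t. x + t *\<^sub>R v) has_derivative f' \<circ> (\<lambda>h. h *\<^sub>R v)) (at t)" .
  moreover have "f' \<circ> (\<lambda>h. h *\<^sub>R v) = (\<lambda>h. h *\<^sub>R f' v)"
    using has_derivative_linear[OF assms] by (auto simp: linear_cmul)
  ultimately show ?thesis by (simp add: o_def)
qed

lemma has_real_derivative_along_line:
  fixes f :: "'a::euclidean_space \<Rightarrow> real"
  assumes "(f has_derivative f') (at (x + t *\<^sub>R v))"
  shows "((\<lambda>t. f (x + t *\<^sub>R v)) has_real_derivative f' v) (at t)"
proof -
  have "(\<lambda>h. h *\<^sub>R f' v) = (*) (f' v)" by (auto simp: mult.commute)
  then show ?thesis
    using has_derivative_along_line[OF assms] by (simp add: has_field_derivative_def)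
qed

lemma real_function_at_right_less:
  fixes \<psi> :: "real \<Rightarrow> real"
  assumes "(\<psi> has_real_derivative d) (at 0 within {0..})" and "\<psi> 0 = 0" and "d < \<kappa>"
  shows "\<exists>\<delta>>0. \<forall>t. 0 < t \<and> t < \<delta> \<longrightarrow> \<psi> t < \<kappa> * t"
proof -
  have "((\<lambda>y. (\<psi> y - \<psi> 0) / (y - 0)) \<longlongrightarrow> d) (at 0 within {0..})"
    using assms(1) by (simp add: has_field_derivative_iff)
  then have "\<forall>\<^sub>F y in at 0 within {0..}. (\<psi> y - \<psi> 0) / (y - 0) < \<kappa>"
    using assms(3) by (rule order_tendstoD)
  then obtain \<delta> where "\<delta> > 0" "\<And>y. y \<in> {0..} \<Longrightarrow> y \<noteq> 0 \<Longrightarrow> dist y 0 < \<delta> \<Longrightarrow> (\<psi> y - \<psi> 0) / (y - 0) < \<kappa>"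
    unfolding eventually_at by blast
  then show ?thesis
    using assms(2) by (intro exI[of _ \<delta>]) (auto simp: field_simps)
qed

text \<open>
  The counterpart of the quadratic growth in the corner lemma: a function whose one-sided first
  derivative vanishes and whose one-sided second derivative is nonpositive stays below \<open>\<kappa> t\<^sup>2\<close> near \<open>0\<close>
  for every \<open>\<kappa> > 0\<close>.
\<close>

lemma quadratic_upper_bound_at_right:
  fixes \<phi> \<psi> :: "real \<Rightarrow> real"
  assumes cont: "continuous_on {0..T} \<phi>" and "T > 0"
    and der: "\<And>t. 0 < t \<Longrightarrow> t < T \<Longrightarrow> (\<phi> has_real_derivative \<psi> t) (at t)"
    and "\<psi> 0 = 0" and "(\<psi> has_real_derivative d) (at 0 within {0..})" and "d < \<kappa>" "\<kappa> > 0"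
  shows "\<exists>\<delta>>0. \<forall>t. 0 < t \<and> t < \<delta> \<longrightarrow> \<phi> t < \<phi> 0 + \<kappa> * t\<^sup>2"
proof -
  obtain \<delta> where \<delta>: "\<delta> > 0" "\<And>t. 0 < t \<Longrightarrow> t < \<delta> \<Longrightarrow> \<psi> t < \<kappa> * t"
    using real_function_at_right_less[OF assms(5,4,6)] by blast
  have "\<phi> t < \<phi> 0 + \<kappa> * t\<^sup>2" if t: "0 < t" "t < min \<delta> T" for t
  proof -
    have cont_t: "continuous_on {0..t} \<phi>"
      using cont by (rule continuous_on_subset) (use t in auto)
    have "\<phi> differentiable (at x)" if "0 < x" "x < t" for x
      using der[of x] that t real_differentiable_def by auto
    then obtain l z where lz: "0 < z" "z < t" "(\<phi> has_real_derivative l) (at z)" "\<phi> t - \<phi> 0 = (t - 0) * l"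
      using MVT[OF t(1) cont_t] by blast
    then have z: "z > 0" "z < t" "\<phi> t - \<phi> 0 = (t - 0) * \<psi> z"
      using der[of z] t DERIV_unique by fastforce+
    have "\<psi> z < \<kappa> * z" using \<delta>(2)[of z] z t by simp
    also have "\<dots> \<le> \<kappa> * t" using z assms(7) by simp
    finally have "\<psi> z < \<kappa> * t" .
    then have "t * \<psi> z < t * (\<kappa> * t)" using t by simp
    then show ?thesis using z by (simp add: power2_eq_square algebra_simps)
  qed
  then show ?thesis using \<delta>(1) assms(2) by (intro exI[of _ "min \<delta> T"]) auto
qed

lemma second_derivative_test:
  fixes f :: "'a::euclidean_space \<Rightarrow> real"
  assumes "open S" "x \<in> S" and gh: "grad_hess S f D L"
    and min: "\<And>y. y \<in> S \<Longrightarrow> f x \<le> f y"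
  shows "D x = 0" and "L x v \<bullet> v \<ge> 0"
proof -
  have fx: "(f has_derivative (\<lambda>v. D x \<bullet> v)) (at x)"
    using grad_hess_openD[OF gh] assms by auto
  have "(\<lambda>v. D x \<bullet> v) = (\<lambda>v. 0)"
    by (rule differential_zero_maxmin[OF assms(2,1) fx]) (use min in auto)
  then show D0: "D x = 0" by (metis inner_eq_zero_iff)
  show "L x v \<bullet> v \<ge> 0"
  proof (rule ccontr)
    assume neg: "\<not> L x v \<bullet> v \<ge> 0"
    obtain e where e: "e > 0" "ball x e \<subseteq> S" using assms(1,2) openE by blast
    define T where "T = e / (norm v + 1)"
    have nv: "norm v + 1 > 0" by (simp add: add_nonneg_pos)
    have T: "T > 0" using e nv by (simp add: T_def)
    have inS: "x + t *\<^sub>R v \<in> S" if "\<bar>t\<bar> < T" for t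
    proof -
      have "\<bar>t\<bar> * norm v \<le> \<bar>t\<bar> * (norm v + 1)" by (simp add: mult_left_mono)
      also have "\<dots> < e" using that nv by (simp add: T_def field_simps)
      finally show ?thesis using e by (auto simp: dist_norm)
    qed
    define \<phi> where "\<phi> t = f (x + t *\<^sub>R v)" for t
    define \<psi> where "\<psi> t = D (x + t *\<^sub>R v) \<bullet> v" for t
    have d1: "(\<phi> has_real_derivative \<psi> t) (at t)" if "\<bar>t\<bar> < T" for t
      using has_real_derivative_along_line[OF grad_hess_openD(1)[OF gh inS[OF that] assms(1)]]
      unfolding \<phi>_def \<psi>_def .
    have "((\<lambda>t. D (x + t *\<^sub>R v)) has_derivative (\<lambda>h. h *\<^sub>R L x v)) (at 0)"
      using has_derivative_along_line[of D "L x" x 0 v] grad_hess_openD(2)[OF gh assms(2,1)] by simp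
    from has_derivative_inner_left[OF this, of v]
    have d2: "(\<psi> has_real_derivative L x v \<bullet> v) (at 0)"
      by (simp add: \<psi>_def[abs_def] has_field_derivative_def mult_commute_abs)
    have cont: "continuous_on {0..T/2} \<phi>"
      by (rule continuous_at_imp_continuous_on) (use d1 T DERIV_isCont in force)
    obtain \<delta> where \<delta>: "\<delta> > 0" "\<And>t. 0 < t \<Longrightarrow> t < \<delta> \<Longrightarrow> \<psi> t < 0 * t"
      using real_function_at_right_less[OF has_field_derivative_at_within[OF d2], of 0] neg D0
      by (auto simp: \<psi>_def)
    define t where "t = min \<delta> T / 2"
    have t: "0 < t" "t < \<delta>" "t < T" using \<delta> T by (auto simp: t_def)
    obtain z where z: "0 < z" "z < t" "\<phi> t - \<phi> 0 = (t - 0) * \<psi> z"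
      using MVT2[of 0 t \<phi> \<psi>] t d1 by force
    have "\<psi> z < 0" using \<delta>(2)[of z] t z by simp
    then have "t * \<psi> z < 0" using t by (simp add: mult_pos_neg)
    then have "\<phi> t < \<phi> 0" using z by simp
    moreover have "\<phi> 0 \<le> \<phi> t" unfolding \<phi>_def using min inS[of t] t by auto
    ultimately show False by simp
  qed
qed

text \<open>
  Formulated with the derivative of the gradient at one point, so that it also applies to the
  components of a gradient and gives the symmetry of third derivatives.
\<close>

lemma second_derivative_symmetric:
  fixes f :: "'a::euclidean_space \<Rightarrow> real"
  assumes "open S" "x \<in> S"
    and df: "\<And>y. y \<in> S \<Longrightarrow> (f has_derivative (\<lambda>v. D y \<bullet> v)) (at y)"
    and dD: "(D has_derivative L) (at x)"
  shows "L h \<bullet> k = L k \<bullet> h"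
proof -
  have lin: "linear L" using dD by (rule has_derivative_linear)
  \<comment> \<open>The second difference \<open>f (x + th + tk) - f (x + th) - f (x + tk) + f x\<close> is symmetric in
      \<open>h\<close> and \<open>k\<close>, and it equals \<open>t\<^sup>2 (L h \<bullet> k)\<close> up to \<open>o(t\<^sup>2)\<close>.\<close>
  define \<Delta> where "\<Delta> h k t = f (x + t *\<^sub>R h + t *\<^sub>R k) - f (x + t *\<^sub>R h) - f (x + t *\<^sub>R k) + f x" for h k t
  have key: "\<exists>\<delta>>0. \<forall>t. 0 < t \<and> t < \<delta> \<longrightarrow> \<bar>\<Delta> h k t - t\<^sup>2 * (L h \<bullet> k)\<bar> \<le> \<epsilon> * t\<^sup>2"
    if "\<epsilon> > 0" for h k \<epsilon>
  proof -
    define m where "m = norm h + norm k + 1"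
    have m: "m > 0" by (simp add: m_def add_nonneg_pos)
    define \<eta> where "\<eta> = \<epsilon> / (2 * m * m)"
    have \<eta>: "\<eta> > 0" using that m by (simp add: \<eta>_def)
    obtain d where d: "d > 0" "\<And>y. norm (y - x) < d \<Longrightarrow> norm (D y - D x - L (y - x)) \<le> \<eta> * norm (y - x)"
      using dD \<eta> unfolding has_derivative_at_alt by blast
    obtain r where r: "r > 0" "ball x r \<subseteq> S" using assms(1,2) openE by blast
    show ?thesis
    proof (intro exI[of _ "min d r / m"] conjI allI impI)
      show "min d r / m > 0" using d r m by simp
      fix t assume t: "0 < t \<and> t < min d r / m"
      then have tm: "t * m < d" "t * m < r" using m by (auto simp: field_simps)
      have near: "norm (t *\<^sub>R a + s *\<^sub>R k) \<le> t * m" if "a = h \<or> a = 0" "0 \<le> s" "s \<le> t" for a s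
      proof -
        have "norm (t *\<^sub>R a + s *\<^sub>R k) \<le> t * norm a + s * norm k"
          using norm_triangle_ineq[of "t *\<^sub>R a" "s *\<^sub>R k"] t that by simp
        also have "\<dots> \<le> t * norm h + t * norm k"
          using that t by (intro add_mono mult_mono) auto
        also have "\<dots> \<le> t * m" using t by (simp add: m_def algebra_simps)
        finally show ?thesis .
      qed
      define \<phi> where "\<phi> s = f (x + t *\<^sub>R h + s *\<^sub>R k) - f (x + s *\<^sub>R k)" for s
      have "(\<phi> has_real_derivative (D (x + t *\<^sub>R h + s *\<^sub>R k) \<bullet> k - D (x + s *\<^sub>R k) \<bullet> k)) (at s)"
        if s: "0 \<le> s" "s \<le> t" for s
      proof -
        have 1: "x + t *\<^sub>R h + s *\<^sub>R k \<in> S" "x + s *\<^sub>R k \<in> S"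
          using near[of h s] near[of 0 s] s tm r(2) by (auto simp: dist_norm add.assoc subset_iff norm_minus_commute algebra_simps)
        show ?thesis unfolding \<phi>_def
          by (intro DERIV_diff has_real_derivative_along_line df 1)
      qed
      then obtain z where z: "0 < z" "z < t" "\<phi> t - \<phi> 0 = (t - 0) * (D (x + t *\<^sub>R h + z *\<^sub>R k) \<bullet> k - D (x + z *\<^sub>R k) \<bullet> k)"
        using MVT2[of 0 t \<phi> "\<lambda>s. D (x + t *\<^sub>R h + s *\<^sub>R k) \<bullet> k - D (x + s *\<^sub>R k) \<bullet> k"] t by blast
      define E where "E y = D y - D x - L (y - x)" for y
      have E: "norm (E (x + (t *\<^sub>R a + z *\<^sub>R k))) \<le> \<eta> * (t * m)" if "a = h \<or> a = 0" for a
      proof -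
        have "norm (E (x + (t *\<^sub>R a + z *\<^sub>R k))) \<le> \<eta> * norm (t *\<^sub>R a + z *\<^sub>R k)"
          using d(2)[of "x + (t *\<^sub>R a + z *\<^sub>R k)"] near[of a z] that z tm by (auto simp: E_def)
        also have "\<dots> \<le> \<eta> * (t * m)" using near[of a z] that z \<eta> by (intro mult_left_mono) auto
        finally show ?thesis .
      qed
      have eq1: "D (x + t *\<^sub>R h + z *\<^sub>R k) \<bullet> k - D (x + z *\<^sub>R k) \<bullet> k
          = t * (L h \<bullet> k) + (E (x + (t *\<^sub>R h + z *\<^sub>R k)) - E (x + (t *\<^sub>R 0 + z *\<^sub>R k))) \<bullet> k"
        by (simp add: E_def linear_add[OF lin] linear_cmul[OF lin] inner_diff_left inner_add_left add.assoc)
      have eq2: "\<Delta> h k t = t * (D (x + t *\<^sub>R h + z *\<^sub>R k) \<bullet> k - D (x + z *\<^sub>R k) \<bullet> k)"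
        using z(3) by (simp add: \<Delta>_def \<phi>_def)
      have "\<Delta> h k t - t\<^sup>2 * (L h \<bullet> k)
          = t * ((E (x + (t *\<^sub>R h + z *\<^sub>R k)) - E (x + (t *\<^sub>R 0 + z *\<^sub>R k))) \<bullet> k)"
        unfolding eq2 eq1 by (simp add: power2_eq_square algebra_simps)
      also have "\<bar>\<dots>\<bar> \<le> t * ((\<eta> * (t * m) + \<eta> * (t * m)) * m)"
      proof -
        have "\<bar>(E (x + (t *\<^sub>R h + z *\<^sub>R k)) - E (x + (t *\<^sub>R 0 + z *\<^sub>R k))) \<bullet> k\<bar>
            \<le> norm (E (x + (t *\<^sub>R h + z *\<^sub>R k)) - E (x + (t *\<^sub>R 0 + z *\<^sub>R k))) * norm k"
          by (rule Cauchy_Schwarz_ineq2)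
        also have "\<dots> \<le> (\<eta> * (t * m) + \<eta> * (t * m)) * m"
        proof (rule mult_mono)
          show "norm (E (x + (t *\<^sub>R h + z *\<^sub>R k)) - E (x + (t *\<^sub>R 0 + z *\<^sub>R k))) \<le> \<eta> * (t * m) + \<eta> * (t * m)"
            using norm_triangle_ineq4[of "E (x + (t *\<^sub>R h + z *\<^sub>R k))" "E (x + (t *\<^sub>R 0 + z *\<^sub>R k))"] 
              E[of h, OF disjI1[OF refl]] E[of 0, OF disjI2[OF refl]] by linarith
        qed (use \<eta> t m in \<open>auto simp: m_def\<close>)
        finally show ?thesis using t by (simp add: abs_mult)
      qed
      also have "\<dots> = \<epsilon> * t\<^sup>2"
        using m by (simp add: \<eta>_def field_simps power2_eq_square)
      finally show "\<bar>\<Delta> h k t - t\<^sup>2 * (L h \<bullet> k)\<bar> \<le> \<epsilon> * t\<^sup>2" .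
    qed
  qed
  have "\<bar>L h \<bullet> k - L k \<bullet> h\<bar> \<le> \<epsilon>" if "\<epsilon> > 0" for \<epsilon>
  proof -
    have e2: "\<epsilon> / 2 > 0" using that by simp
    obtain d1 where d1: "d1 > 0" "\<And>t. 0 < t \<and> t < d1 \<Longrightarrow> \<bar>\<Delta> h k t - t\<^sup>2 * (L h \<bullet> k)\<bar> \<le> \<epsilon>/2 * t\<^sup>2"
      using key[OF e2, of h k] by blast
    obtain d2 where d2: "d2 > 0" "\<And>t. 0 < t \<and> t < d2 \<Longrightarrow> \<bar>\<Delta> k h t - t\<^sup>2 * (L k \<bullet> h)\<bar> \<le> \<epsilon>/2 * t\<^sup>2"
      using key[OF e2, of k h] by blast
    define t where "t = min d1 d2 / 2"
    have t: "0 < t" "t < d1" "t < d2" using d1 d2 by (auto simp: t_def)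
    have "\<Delta> h k t = \<Delta> k h t" by (simp add: \<Delta>_def algebra_simps)
    then have "\<bar>t\<^sup>2 * (L h \<bullet> k) - t\<^sup>2 * (L k \<bullet> h)\<bar> \<le> \<epsilon> * t\<^sup>2"
      using d1(2)[of t] d2(2)[of t] t by linarith
    moreover have "t\<^sup>2 * \<bar>L h \<bullet> k - L k \<bullet> h\<bar> = \<bar>t\<^sup>2 * (L h \<bullet> k) - t\<^sup>2 * (L k \<bullet> h)\<bar>"
      by (simp add: abs_mult flip: right_diff_distrib)
    ultimately have "t\<^sup>2 * \<bar>L h \<bullet> k - L k \<bullet> h\<bar> \<le> t\<^sup>2 * \<epsilon>" by (simp add: mult.commute)
    then show ?thesis using t by simp
  qed
  then have "\<bar>L h \<bullet> k - L k \<bullet> h\<bar> \<le> 0" by (rule field_le_epsilon) auto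
  then show ?thesis by simp
qed

definition trace_form :: "('a::euclidean_space \<Rightarrow> 'a) \<Rightarrow> real" where
  "trace_form L = (\<Sum>b\<in>Basis. L b \<bullet> b)"

lemma trace_form_orthonormal:
  fixes L :: "'a::euclidean_space \<Rightarrow> 'a"
  assumes "linear L" and B: "is_orthonormal_basis B UNIV"
  shows "(\<Sum>b\<in>B. L b \<bullet> b) = trace_form L"
proof -
  have po: "pairwise orthogonal B" and n1: "\<And>i. i \<in> B \<Longrightarrow> norm i = 1" and sp: "span B = UNIV"
    using B by (auto simp: is_orthonormal_basis_def)
  have "independent B" by (rule pairwise_orthogonal_independent[OF po]) (use n1 in force)
  then have fin: "finite B" by (rule independent_imp_finite)
  have ex: "(\<Sum>b\<in>B. (x \<bullet> b) *\<^sub>R b) = x" for x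
    by (rule orthonormal_basis_expand[OF po]) (use n1 sp fin in auto)
  have "(\<Sum>b\<in>B. L b \<bullet> b) = (\<Sum>b\<in>B. \<Sum>i\<in>Basis. (b \<bullet> i) * (L i \<bullet> b))"
  proof (rule sum.cong)
    fix b
    have "L b = L (\<Sum>i\<in>Basis. (b \<bullet> i) *\<^sub>R i)" by (simp add: euclidean_representation)
    also have "\<dots> = (\<Sum>i\<in>Basis. (b \<bullet> i) *\<^sub>R L i)"
      by (simp add: linear_sum[OF assms(1)] linear_cmul[OF assms(1)])
    finally show "L b \<bullet> b = (\<Sum>i\<in>Basis. (b \<bullet> i) * (L i \<bullet> b))"
      by (simp add: inner_sum_left)
  qed simp
  also have "\<dots> = (\<Sum>i\<in>Basis. \<Sum>b\<in>B. (b \<bullet> i) * (L i \<bullet> b))" by (rule sum.swap)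
  also have "\<dots> = (\<Sum>i\<in>Basis. L i \<bullet> i)"
  proof (rule sum.cong)
    fix i
    have "L i \<bullet> i = (\<Sum>b\<in>B. (L i \<bullet> b) *\<^sub>R b) \<bullet> i" by (simp add: ex)
    also have "\<dots> = (\<Sum>b\<in>B. (b \<bullet> i) * (L i \<bullet> b))"
      by (simp add: inner_sum_left mult.commute)
    finally show "(\<Sum>b\<in>B. (b \<bullet> i) * (L i \<bullet> b)) = L i \<bullet> i" ..
  qed simp
  finally show ?thesis by (simp add: trace_form_def)
qed

lemma orthonormal_basis_insert:
  fixes n :: "'a::euclidean_space"
  assumes W: "subspace W" and n: "norm n = 1" "n \<in> W" and B: "is_orthonormal_basis B {v \<in> W. n \<bullet> v = 0}"
  shows "is_orthonormal_basis (insert n B) W" "n \<notin> B" "finite B"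
proof -
  have po: "pairwise orthogonal B" and n1: "\<And>i. i \<in> B \<Longrightarrow> norm i = 1"
    and sp: "span B = {v \<in> W. n \<bullet> v = 0}"
    using B by (auto simp: is_orthonormal_basis_def)
  have nb: "n \<bullet> b = 0" "b \<in> W" if "b \<in> B" for b using sp span_base[OF that] by auto
  have nn: "n \<bullet> n = 1" using n by (simp add: norm_eq_1)
  show "n \<notin> B" using nb nn by force
  have "independent B" by (rule pairwise_orthogonal_independent[OF po]) (use n1 in force)
  then show "finite B" by (rule independent_imp_finite)
  have "v \<in> span (insert n B)" if v: "v \<in> W" for v
  proof -
    have "v - (n \<bullet> v) *\<^sub>R n \<in> span B"
      unfolding sp using W v n(2) by (simp add: inner_diff_right nn subspace_diff subspace_scale)
    then show ?thesis unfolding span_insert by auto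
  qed
  moreover have "span (insert n B) \<subseteq> W" using nb n(2) W by (intro span_minimal) auto
  ultimately show "is_orthonormal_basis (insert n B) W"
    using po n1 n nb by (auto simp: is_orthonormal_basis_def pairwise_insert orthogonal_def inner_commute)
qed

lemma ex_orthonormal_basis_hyperplane:
  fixes n :: "'a::euclidean_space"
  obtains B where "is_orthonormal_basis B {v. n \<bullet> v = 0}"
  by (rule orthonormal_basis_subspace[OF subspace_hyperplane[of n]]) (auto simp: is_orthonormal_basis_def)

lemma trace_form_hyperplane:
  fixes L :: "'a::euclidean_space \<Rightarrow> 'a"
  assumes "linear L" "norm n = 1" "is_orthonormal_basis B {v. n \<bullet> v = 0}"
  shows "trace_form L = L n \<bullet> n + (\<Sum>b\<in>B. L b \<bullet> b)"
proof -
  have B: "is_orthonormal_basis B {v \<in> UNIV. n \<bullet> v = 0}" using assms(3) by simp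
  show ?thesis
    using trace_form_orthonormal[OF assms(1) orthonormal_basis_insert(1)[OF subspace_UNIV assms(2) UNIV_I B]]
      orthonormal_basis_insert(2,3)[OF subspace_UNIV assms(2) UNIV_I B] by simp
qed

lemma trace_form_conj:
  fixes L R :: "'a::euclidean_space \<Rightarrow> 'a"
  assumes "linear L" "orthogonal_transformation R" and inv: "\<And>x. R (R x) = x"
  shows "trace_form (\<lambda>v. R (L (R v))) = trace_form L"
proof -
  have lin: "linear R" and inn: "\<And>v w. R v \<bullet> R w = v \<bullet> w"
    using assms(2) by (auto simp: orthogonal_transformation_def)
  have inj: "inj R" by (metis inv injI)
  have "is_orthonormal_basis (R ` Basis) UNIV"
    unfolding is_orthonormal_basis_def
  proof (intro conjI)
    show "pairwise orthogonal (R ` Basis)"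
      by (auto simp: pairwise_def orthogonal_def inn inner_Basis)
    show "\<forall>b\<in>R ` Basis. norm b = 1"
      using assms(2) by (simp add: orthogonal_transformation_norm)
    have "span (R ` Basis) = R ` UNIV"
      using linear_span_image[OF lin, of Basis] by (simp add: span_Basis)
    then show "span (R ` Basis) = UNIV" by (metis inv surjI)
  qed
  then have "trace_form L = (\<Sum>b\<in>R ` Basis. L b \<bullet> b)"
    using trace_form_orthonormal[OF assms(1)] by simp
  also have "\<dots> = (\<Sum>b\<in>Basis. L (R b) \<bullet> R b)"
    using inj by (subst sum.reindex) (auto intro: inj_on_subset)
  also have "\<dots> = (\<Sum>b\<in>Basis. R (L (R b)) \<bullet> b)"
    by (rule sum.cong) (metis inn inv)+
  finally show ?thesis by (simp add: trace_form_def)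
qed

lemma trace_form_diff: "trace_form (\<lambda>v. L v - M v) = trace_form L - trace_form M"
  by (simp add: trace_form_def inner_diff_left sum_subtractf)

lemma trace_form_add: "trace_form (\<lambda>v. L v + M v) = trace_form L + trace_form M"
  by (simp add: trace_form_def inner_add_left sum.distrib)

lemma trace_form_scale: "trace_form (\<lambda>v. c *\<^sub>R L v) = c * trace_form L"
  by (simp add: trace_form_def sum_distrib_left)

lemma trace_form_rank_one: "trace_form (\<lambda>v. (a \<bullet> v) *\<^sub>R b) = a \<bullet> b"
  by (simp add: trace_form_def euclidean_inner[of a b] mult.commute)

lemma trace_form_id: "trace_form (\<lambda>v::'a::euclidean_space. v) = real DIM('a)"
  by (simp add: trace_form_def)

section \<open>Maximum principles for differences of solutions\<close>

text \<open>
  The trace of \<open>L\<close> against the matrix \<open>(1 + |p|\<^sup>2) I - p \<otimes> p\<close>, which has the eigenvalue \<open>1\<close> in the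
  direction of \<open>p\<close> and \<open>1 + |p|\<^sup>2\<close> on its orthogonal complement. It is the second-order part of the
  equation after multiplication with \<open>(1 + |Du|\<^sup>2)\<^sup>3\<^sup>/\<^sup>2\<close>.
\<close>

definition ell :: "'a::euclidean_space \<Rightarrow> ('a \<Rightarrow> 'a) \<Rightarrow> real" where
  "ell p L = (1 + p \<bullet> p) * trace_form L - L p \<bullet> p"

lemma ell_add: "ell p (\<lambda>v. L v + M v) = ell p L + ell p M"
  by (simp add: ell_def trace_form_add inner_add_left algebra_simps)

lemma ell_diff: "ell p (\<lambda>v. L v - M v) = ell p L - ell p M"
  by (simp add: ell_def trace_form_diff inner_diff_left algebra_simps)

lemma ell_scale: "ell p (\<lambda>v. c *\<^sub>R L v) = c * ell p L"
  by (simp add: ell_def trace_form_scale algebra_simps)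

lemma ell_rank_one:
  "ell p (\<lambda>v. (a \<bullet> v) *\<^sub>R b) = (1 + p \<bullet> p) * (a \<bullet> b) - (a \<bullet> p) * (b \<bullet> p)"
  by (simp add: ell_def trace_form_rank_one)

lemma ell_id: "ell (p::'a::euclidean_space) (\<lambda>v. v) = (1 + p \<bullet> p) * real DIM('a) - p \<bullet> p"
  by (simp add: ell_def trace_form_id)

text \<open>
  In an orthonormal basis that contains \<open>p / |p|\<close>, the value is a combination of diagonal entries of
  \<open>L\<close> with positive coefficients.
\<close>

lemma ell_nonneg:
  assumes lin: "linear L" and psd: "\<And>v. L v \<bullet> v \<ge> 0"
  shows "ell p L \<ge> 0"
proof (cases "p = 0")
  case True
  then show ?thesis using psd by (simp add: ell_def trace_form_def sum_nonneg)
next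
  case False
  define n where "n = p /\<^sub>R norm p"
  have n: "norm n = 1" and p: "p = norm p *\<^sub>R n" using False by (simp_all add: n_def)
  obtain B where B: "is_orthonormal_basis B {v. n \<bullet> v = 0}"
    by (rule ex_orthonormal_basis_hyperplane)
  define S where "S = (\<Sum>b\<in>B. L b \<bullet> b)"
  have "S \<ge> 0" by (simp add: S_def psd sum_nonneg)
  have "L p \<bullet> p = (p \<bullet> p) * (L n \<bullet> n)"
    by (subst (1 2) p) (simp add: linear_cmul[OF lin] power2_eq_square flip: power2_norm_eq_inner)
  then have "ell p L = L n \<bullet> n + (1 + p \<bullet> p) * S"
    by (simp add: ell_def trace_form_hyperplane[OF lin n B] S_def algebra_simps)
  then show ?thesis using psd[of n] \<open>S \<ge> 0\<close> by simp
qed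

lemma ell_rank_one_ge: "ell p (\<lambda>v. (a \<bullet> v) *\<^sub>R a) \<ge> a \<bullet> a"
proof -
  have "(a \<bullet> p)\<^sup>2 \<le> (a \<bullet> a) * (p \<bullet> p)" by (rule Cauchy_Schwarz_ineq)
  then show ?thesis by (simp add: ell_rank_one power2_eq_square algebra_simps)
qed

lemma grad_hess_mult:
  assumes f: "grad_hess S f Df Lf" and g: "grad_hess S g Dg Lg"
  shows "grad_hess S (\<lambda>x. f x * g x) (\<lambda>x. f x *\<^sub>R Dg x + g x *\<^sub>R Df x)
    (\<lambda>x v. (f x *\<^sub>R Lg x v + (Df x \<bullet> v) *\<^sub>R Dg x) + (g x *\<^sub>R Lf x v + (Dg x \<bullet> v) *\<^sub>R Df x))"
  unfolding grad_hess_def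
proof (intro ballI conjI)
  fix x assume x: "x \<in> S"
  show "((\<lambda>x. f x * g x) has_derivative (\<lambda>v. (f x *\<^sub>R Dg x + g x *\<^sub>R Df x) \<bullet> v)) (at x within S)"
    by (rule has_derivative_eq_rhs[OF has_derivative_mult[OF grad_hessD(1)[OF f x] grad_hessD(1)[OF g x]]])
       (auto simp: inner_add_left)
  show "((\<lambda>x. f x *\<^sub>R Dg x + g x *\<^sub>R Df x) has_derivative
     (\<lambda>v. (f x *\<^sub>R Lg x v + (Df x \<bullet> v) *\<^sub>R Dg x) + (g x *\<^sub>R Lf x v + (Dg x \<bullet> v) *\<^sub>R Df x))) (at x within S)"
    by (intro has_derivative_add has_derivative_scaleR grad_hessD(1,2)[OF f x] grad_hessD(1,2)[OF g x])
qed

lemma grad_hess_exp_linear: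
  "grad_hess S (\<lambda>x. exp (k * (e \<bullet> (x - c))) - d) (\<lambda>x. (k * exp (k * (e \<bullet> (x - c)))) *\<^sub>R e)
     (\<lambda>x v. (k\<^sup>2 * exp (k * (e \<bullet> (x - c)))) *\<^sub>R (e \<bullet> v) *\<^sub>R e)"
  unfolding grad_hess_def
  by (auto intro!: derivative_eq_intros simp: power2_eq_square algebra_simps fun_eq_iff)

lemma grad_hess_gauss:
  "grad_hess S (\<lambda>x. exp (- k * ((x - c) \<bullet> (x - c))) - d)
     (\<lambda>x. (- 2 * k * exp (- k * ((x - c) \<bullet> (x - c)))) *\<^sub>R (x - c))
     (\<lambda>x v. (4 * k\<^sup>2 * exp (- k * ((x - c) \<bullet> (x - c)))) *\<^sub>R ((x - c) \<bullet> v) *\<^sub>R (x - c)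
          - (2 * k * exp (- k * ((x - c) \<bullet> (x - c)))) *\<^sub>R v)"
  unfolding grad_hess_def
proof (intro ballI conjI)
  fix x assume "x \<in> S"
  have q: "((\<lambda>x. (x - c) \<bullet> (x - c)) has_derivative (\<lambda>v. 2 * ((x - c) \<bullet> v))) (at x within S)"
    by (auto intro!: derivative_eq_intros simp: inner_commute)
  have E: "((\<lambda>x. exp (- k * ((x - c) \<bullet> (x - c)))) has_derivative
      (\<lambda>v. exp (- k * ((x - c) \<bullet> (x - c))) * (- k * (2 * ((x - c) \<bullet> v))))) (at x within S)"
    by (rule has_derivative_eq_rhs[OF has_derivative_exp[OF has_derivative_mult_right[OF q]]])
      (simp add: mult_ac)
  show "((\<lambda>x. exp (- k * ((x - c) \<bullet> (x - c))) - d) has_derivative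
     (\<lambda>v. ((- 2 * k * exp (- k * ((x - c) \<bullet> (x - c)))) *\<^sub>R (x - c)) \<bullet> v)) (at x within S)"
    by (rule has_derivative_eq_rhs[OF has_derivative_diff[OF E has_derivative_const[of d]]])
      (auto simp: fun_eq_iff)
  have "((\<lambda>x. - 2 * k * exp (- k * ((x - c) \<bullet> (x - c)))) has_derivative
      (\<lambda>v. - 2 * k * (exp (- k * ((x - c) \<bullet> (x - c))) * (- k * (2 * ((x - c) \<bullet> v)))))) (at x within S)"
    by (intro has_derivative_mult_right E)
  moreover have "((\<lambda>x. x - c) has_derivative (\<lambda>v. v)) (at x within S)"
    by (auto intro!: derivative_eq_intros)
  ultimately show "((\<lambda>x. (- 2 * k * exp (- k * ((x - c) \<bullet> (x - c)))) *\<^sub>R (x - c)) has_derivative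
     (\<lambda>v. (4 * k\<^sup>2 * exp (- k * ((x - c) \<bullet> (x - c)))) *\<^sub>R ((x - c) \<bullet> v) *\<^sub>R (x - c)
          - (2 * k * exp (- k * ((x - c) \<bullet> (x - c)))) *\<^sub>R v)) (at x within S)"
    by (rule has_derivative_eq_rhs[OF has_derivative_scaleR]) (simp add: fun_eq_iff power2_eq_square)
qed

text \<open>
  Away from the centre the second derivatives of a steep Gaussian are dominated by the term with
  \<open>k\<^sup>2\<close>, which beats everything that is linear in \<open>k\<close>. The surplus \<open>C k E\<close> absorbs the cross terms that
  appear when the Gaussian is multiplied by another barrier.
\<close>

lemma gauss_barrier:
  fixes y :: "'a::euclidean_space"
  assumes p: "p \<bullet> p \<le> B" and q: "q \<bullet> q \<le> B" and y: "0 < \<rho>" "\<rho> \<le> norm y" "norm y \<le> r" and "K \<ge> 0" "C \<ge> 0"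
    and k: "k * (8 * \<rho>\<^sup>2) > 4 * real DIM('a) * (1 + B) + 2 * K * r + C" and k0: "k > 0" and E: "E > 0"
  defines "H \<equiv> \<lambda>v. (4 * k\<^sup>2 * E) *\<^sub>R (y \<bullet> v) *\<^sub>R y - (2 * k * E) *\<^sub>R v"
  shows "ell p H + ell q H > K * norm ((- 2 * k * E) *\<^sub>R y) + C * k * E"
proof -
  have one: "ell p H \<ge> 4 * k\<^sup>2 * E * \<rho>\<^sup>2 - 2 * k * E * (real DIM('a) * (1 + B))" if "p \<bullet> p \<le> B" for p :: 'a
  proof -
    have yy: "\<rho>\<^sup>2 \<le> y \<bullet> y" using y by (simp add: power_mono flip: power2_norm_eq_inner)
    have "4 * k\<^sup>2 * E * \<rho>\<^sup>2 \<le> 4 * k\<^sup>2 * E * ell p (\<lambda>v. (y \<bullet> v) *\<^sub>R y)"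
      using yy ell_rank_one_ge[of y p] E by (intro mult_left_mono) auto
    moreover have "2 * k * E * ell p (\<lambda>v. v) \<le> 2 * k * E * (real DIM('a) * (1 + B))"
      unfolding ell_id using that E k0
      by (intro mult_left_mono) (auto simp: mult.commute intro: order_trans[of _ "real DIM('a) * (1 + p \<bullet> p)"])
    ultimately show ?thesis
      unfolding H_def ell_diff ell_scale by linarith
  qed
  have "K * norm ((- 2 * k * E) *\<^sub>R y) = k * E * (2 * K * norm y)"
    using k0 E by (simp add: abs_mult)
  also have "\<dots> \<le> k * E * (2 * K * r)"
    using k0 E y assms(6) by (intro mult_left_mono) auto
  finally have "K * norm ((- 2 * k * E) *\<^sub>R y) + C * k * E \<le> k * E * (2 * K * r + C)"
    by (simp add: algebra_simps)
  also have "\<dots> < k * E * (k * (8 * \<rho>\<^sup>2) - 4 * real DIM('a) * (1 + B))"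
    using k0 E k by (intro mult_strict_left_mono) auto
  also have "\<dots> = 2 * (4 * k\<^sup>2 * E * \<rho>\<^sup>2 - 2 * k * E * (real DIM('a) * (1 + B)))"
    by (simp add: power2_eq_square algebra_simps)
  also have "\<dots> \<le> ell p H + ell q H" using add_mono[OF one[OF p] one[OF q]] by (simp only: mult_2)
  finally show ?thesis .
qed

text \<open>
  The inequality satisfied by the difference of two solutions with gradients \<open>p\<close> and \<open>q\<close>. The two
  gradients enter symmetrically: on a plane of reflection this makes the coefficients that couple the
  normal with tangential directions cancel, as the corner lemma requires.
\<close>

definition supersolution ::
    "'a::euclidean_space set \<Rightarrow> ('a \<Rightarrow> 'a) \<Rightarrow> ('a \<Rightarrow> 'a) \<Rightarrow> real \<Rightarrow> ('a \<Rightarrow> real) \<Rightarrow> ('a \<Rightarrow> 'a) \<Rightarrow> ('a \<Rightarrow> 'a \<Rightarrow> 'a) \<Rightarrow> bool" where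
  "supersolution S p q K w D L \<longleftrightarrow> grad_hess S w D L \<and>
     (\<forall>x\<in>S. ell (p x) (L x) + ell (q x) (L x) \<le> K * norm (D x))"

lemma supersolution_subset:
  "supersolution S p q K w D L \<Longrightarrow> T \<subseteq> S \<Longrightarrow> supersolution T p q K w D L"
  unfolding supersolution_def using grad_hess_subset by blast

text \<open>
  At an interior minimum of \<open>w - \<epsilon> h\<close> the gradients of \<open>w\<close> and \<open>\<epsilon> h\<close> agree and their Hessians are
  ordered, so the strict inequality for \<open>h\<close> contradicts the inequality for \<open>w\<close>.
\<close>

lemma comparison_principle:
  fixes S :: "'a::euclidean_space set"
  assumes S: "open S" "bounded S" and sup: "supersolution S p q K w D L"
    and cw: "continuous_on (closure S) w" and ch: "continuous_on (closure S) h"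
    and gh: "grad_hess S h D' L'"
    and strict: "\<And>x. x \<in> S \<Longrightarrow> K * norm (D' x) < ell (p x) (L' x) + ell (q x) (L' x)"
    and "\<epsilon> > 0"
    and bdry: "\<And>x. x \<in> frontier S \<Longrightarrow> \<epsilon> * h x \<le> w x"
    and x: "x \<in> S"
  shows "\<epsilon> * h x \<le> w x"
proof -
  define f where "f = (\<lambda>x. w x - \<epsilon> * h x)"
  have "compact (closure S)" using S by simp
  moreover have "closure S \<noteq> {}" using x by auto
  moreover have "continuous_on (closure S) f"
    unfolding f_def by (intro continuous_intros cw ch)
  ultimately obtain x0 where x0: "x0 \<in> closure S" "\<And>y. y \<in> closure S \<Longrightarrow> f x0 \<le> f y"
    using continuous_attains_inf by metis
  have "x0 \<notin> S"
  proof
    assume xS: "x0 \<in> S"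
    have gw: "grad_hess S w D L" using sup by (simp add: supersolution_def)
    have gf: "grad_hess S f (\<lambda>x. D x - \<epsilon> *\<^sub>R D' x) (\<lambda>x v. L x v - \<epsilon> *\<^sub>R L' x v)"
      unfolding grad_hess_def f_def
    proof (intro ballI conjI)
      fix y assume y: "y \<in> S"
      show "((\<lambda>x. w x - \<epsilon> * h x) has_derivative (\<lambda>v. (D y - \<epsilon> *\<^sub>R D' y) \<bullet> v)) (at y within S)"
        by (rule has_derivative_eq_rhs[OF has_derivative_diff[OF grad_hessD(1)[OF gw y]
              has_derivative_mult_right[OF grad_hessD(1)[OF gh y]]]])
           (simp add: fun_eq_iff inner_diff_left)
      show "((\<lambda>x. D x - \<epsilon> *\<^sub>R D' x) has_derivative (\<lambda>v. L y v - \<epsilon> *\<^sub>R L' y v)) (at y within S)"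
        by (intro has_derivative_diff has_derivative_scaleR_right grad_hessD(2)[OF gw y] grad_hessD(2)[OF gh y])
    qed
    have m: "f x0 \<le> f y" if "y \<in> S" for y using x0(2) that closure_subset by blast
    have D0: "D x0 = \<epsilon> *\<^sub>R D' x0" using second_derivative_test(1)[OF S(1) xS gf m] by simp
    have psd: "(L x0 v - \<epsilon> *\<^sub>R L' x0 v) \<bullet> v \<ge> 0" for v
      using second_derivative_test(2)[OF S(1) xS gf m] by simp
    have lin: "linear (\<lambda>v. L x0 v - \<epsilon> *\<^sub>R L' x0 v)" using grad_hessD(3)[OF gf xS] .
    have "ell r (L x0) \<ge> \<epsilon> * ell r (L' x0)" for r
      using ell_nonneg[OF lin psd, of r] by (simp add: ell_diff ell_scale)
    then have "\<epsilon> * (ell (p x0) (L' x0) + ell (q x0) (L' x0)) \<le> K * norm (D x0)"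
      using sup xS unfolding supersolution_def by (smt (verit) distrib_left)
    also have "\<dots> = \<epsilon> * (K * norm (D' x0))" using D0 assms(8) by simp
    finally show False using strict[OF xS] assms(8) by simp
  qed
  then have "x0 \<in> frontier S" using x0(1) S(1) by (simp add: frontier_def interior_open)
  then have "0 \<le> f x0" using bdry by (simp add: f_def)
  also have "\<dots> \<le> f x" using x0(2) x closure_subset by blast
  finally show ?thesis by (simp add: f_def)
qed

text \<open>
  The barrier is a small multiple of \<open>exp (k (e \<bullet> x)) - M\<close>, nonpositive on the closure of \<open>S\<close>.
\<close>

lemma weak_maximum_principle:
  fixes S :: "'a::euclidean_space set"
  assumes S: "open S" "bounded S" and sup: "supersolution S p q K w D L" and "K \<ge> 0"
    and cw: "continuous_on (closure S) w"
    and bdry: "\<And>x. x \<in> frontier S \<Longrightarrow> 0 \<le> w x" and x: "x \<in> S"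
  shows "0 \<le> w x"
proof -
  obtain e :: 'a where e: "e \<in> Basis" using nonempty_Basis by blast
  define k where "k = K + 1"
  have k: "k > 0" "K < k" using assms(4) by (auto simp: k_def)
  define h0 where "h0 = (\<lambda>x. exp (k * (e \<bullet> (x - 0))))"
  have "compact (h0 ` closure S)"
    unfolding h0_def using S by (intro compact_continuous_image continuous_intros) auto
  then obtain M where M: "\<And>x. x \<in> closure S \<Longrightarrow> norm (h0 x) \<le> M"
    using compact_imp_bounded bounded_iff by (metis imageI)
  define h where "h = (\<lambda>x. exp (k * (e \<bullet> (x - 0))) - M)"
  have gh: "grad_hess S h (\<lambda>x. (k * exp (k * (e \<bullet> (x - 0)))) *\<^sub>R e)
     (\<lambda>x v. (k\<^sup>2 * exp (k * (e \<bullet> (x - 0)))) *\<^sub>R (e \<bullet> v) *\<^sub>R e)"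
    unfolding h_def by (rule grad_hess_exp_linear)
  have ch: "continuous_on (closure S) h" unfolding h_def by (intro continuous_intros)
  have strict: "K * norm ((k * exp (k * (e \<bullet> (x - 0)))) *\<^sub>R e)
      < ell (p x) (\<lambda>v. (k\<^sup>2 * exp (k * (e \<bullet> (x - 0)))) *\<^sub>R (e \<bullet> v) *\<^sub>R e)
      + ell (q x) (\<lambda>v. (k\<^sup>2 * exp (k * (e \<bullet> (x - 0)))) *\<^sub>R (e \<bullet> v) *\<^sub>R e)" for x
  proof -
    define E where "E = exp (k * (e \<bullet> (x - 0)))"
    have E: "E > 0" by (simp add: E_def)
    have 1: "ell r (\<lambda>v. (e \<bullet> v) *\<^sub>R e) \<ge> 1" for r using ell_rank_one_ge[of e r] e by simp
    have 2: "k\<^sup>2 * E \<le> k\<^sup>2 * E * ell r (\<lambda>v. (e \<bullet> v) *\<^sub>R e)" for r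
      using mult_left_mono[OF 1[of r], of "k\<^sup>2 * E"] E by simp
    have "K * norm ((k * E) *\<^sub>R e) = (k * E) * K" using k E e by simp
    also have "\<dots> < (k * E) * k" using k E by simp
    also have "\<dots> = k\<^sup>2 * E" by (simp add: power2_eq_square)
    also have "\<dots> \<le> k\<^sup>2 * E + k\<^sup>2 * E" using E by simp
    finally show ?thesis unfolding ell_scale E_def[symmetric] using 2[of "p x"] 2[of "q x"] by linarith
  qed
  have low: "- M * \<epsilon> \<le> w x" if \<epsilon>: "\<epsilon> > 0" for \<epsilon>
  proof -
    have "\<epsilon> * h x \<le> w x"
    proof (rule comparison_principle[OF S sup cw ch gh strict \<epsilon> _ x])
      fix y assume y: "y \<in> frontier S"
      then have "y \<in> closure S" by (simp add: frontier_def)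
      then have "h y \<le> 0" using M[of y] by (simp add: h_def h0_def)
      then have "\<epsilon> * h y \<le> 0" using \<epsilon> by (simp add: mult_nonneg_nonpos)
      then show "\<epsilon> * h y \<le> w y" using bdry[OF y] by linarith
    qed
    moreover have "\<epsilon> * (- M) \<le> \<epsilon> * h x" using \<epsilon> by (intro mult_left_mono) (auto simp: h_def)
    ultimately show ?thesis by (simp add: mult.commute)
  qed
  have "M > 0" using M[of x] x closure_subset[of S] by (auto simp: h0_def intro: less_le_trans[OF exp_gt_zero])
  show ?thesis
  proof (rule ccontr)
    assume neg: "\<not> 0 \<le> w x"
    then have "- M * (- w x / (2 * M)) \<le> w x" using low[of "- w x / (2 * M)"] \<open>M > 0\<close> by (simp add: divide_neg_pos)
    then show False using \<open>M > 0\<close> neg by simp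
  qed
qed

text \<open>
  Comparison with a Gaussian in the annulus \<open>r/2 < |x - c| < r\<close>. The conclusion is a growth rate along
  the radius and not a statement on a derivative, because \<open>z\<close> may be a boundary point of the domain of
  \<open>w\<close>.
\<close>

lemma hopf_lemma:
  fixes c z :: "'a::euclidean_space"
  assumes sup: "supersolution (ball c r) p q K w D L" and "K \<ge> 0" and r: "r > 0"
    and bd: "\<And>x. x \<in> ball c r \<Longrightarrow> p x \<bullet> p x \<le> B" "\<And>x. x \<in> ball c r \<Longrightarrow> q x \<bullet> q x \<le> B"
    and cw: "continuous_on (cball c r) w" and pos: "\<And>x. x \<in> ball c r \<Longrightarrow> w x > 0"
    and z: "norm (z - c) = r"
  shows "\<exists>\<kappa>>0. \<forall>t. 0 \<le> t \<and> t \<le> 1/2 \<longrightarrow> \<kappa> * t \<le> w (z + t *\<^sub>R (c - z))"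
proof -
  have nonneg: "w x \<ge> 0" if "x \<in> cball c r" for x
    using continuous_ge_on_closure[of "ball c r" w x 0] cw that pos r by (force simp: less_imp_le)
  have "cball c (r/2) \<subseteq> cball c r" using r by (intro subset_cball) simp
  then have "compact (cball c (r/2))" "cball c (r/2) \<noteq> {}" "continuous_on (cball c (r/2)) w"
    using r continuous_on_subset[OF cw] by auto
  then obtain x0 where x0: "x0 \<in> cball c (r/2)" "\<And>y. y \<in> cball c (r/2) \<Longrightarrow> w x0 \<le> w y"
    using continuous_attains_inf by metis
  define m where "m = w x0"
  have m: "m > 0" unfolding m_def using x0(1) r by (intro pos) auto
  define S where "S = ball c r - cball c (r/2)"
  have Ssub: "S \<subseteq> ball c r" by (auto simp: S_def)
  have S: "open S" "bounded S" by (auto simp: S_def)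
  have clS: "closure S \<subseteq> cball c r - ball c (r/2)"
    by (rule closure_minimal) (auto simp: S_def)
  define k where "k = (4 * real DIM('a) * (1 + \<bar>B\<bar>) + 2 * K * r + 1) / (8 * (r/2)\<^sup>2)"
  have k: "k * (8 * (r/2)\<^sup>2) > 4 * real DIM('a) * (1 + \<bar>B\<bar>) + 2 * K * r + 0"
    using r by (simp add: k_def)
  have k0: "k > 0" unfolding k_def using r assms(2) by (intro divide_pos_pos add_nonneg_pos) auto
  define d where "d = exp (- k * r\<^sup>2)"
  define h where "h = (\<lambda>x. exp (- k * ((x - c) \<bullet> (x - c))) - d)"
  have gh: "grad_hess S h (\<lambda>x. (- 2 * k * exp (- k * ((x - c) \<bullet> (x - c)))) *\<^sub>R (x - c))
     (\<lambda>x v. (4 * k\<^sup>2 * exp (- k * ((x - c) \<bullet> (x - c)))) *\<^sub>R ((x - c) \<bullet> v) *\<^sub>R (x - c)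
          - (2 * k * exp (- k * ((x - c) \<bullet> (x - c)))) *\<^sub>R v)"
    unfolding h_def by (rule grad_hess_gauss)
  have ch: "continuous_on A h" for A unfolding h_def by (intro continuous_intros)
  have comp: "m * h x \<le> w x" if "x \<in> S" for x
  proof (rule comparison_principle[OF S supersolution_subset[OF sup Ssub] _ ch gh _ m _ that])
    show "continuous_on (closure S) w" using cw by (rule continuous_on_subset) (use clS in auto)
  next
    fix y assume y: "y \<in> S"
    then have yb: "y \<in> ball c r" and yn: "r/2 \<le> norm (y - c)" "norm (y - c) \<le> r"
      by (auto simp: S_def dist_norm norm_minus_commute)
    show "K * norm ((- 2 * k * exp (- k * ((y - c) \<bullet> (y - c)))) *\<^sub>R (y - c))
      < ell (p y) (\<lambda>v. (4 * k\<^sup>2 * exp (- k * ((y - c) \<bullet> (y - c)))) *\<^sub>R ((y - c) \<bullet> v) *\<^sub>R (y - c) - (2 * k * exp (- k * ((y - c) \<bullet> (y - c)))) *\<^sub>R v)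
      + ell (q y) (\<lambda>v. (4 * k\<^sup>2 * exp (- k * ((y - c) \<bullet> (y - c)))) *\<^sub>R ((y - c) \<bullet> v) *\<^sub>R (y - c) - (2 * k * exp (- k * ((y - c) \<bullet> (y - c)))) *\<^sub>R v)"
      using gauss_barrier[of "p y" "\<bar>B\<bar>" "q y" "r/2" "y - c" r K 0 k "exp (- k * ((y - c) \<bullet> (y - c)))"]
        bd(1)[OF yb] bd(2)[OF yb] yn r assms(2) k k0 by simp
  next
    fix y assume "y \<in> frontier S"
    then have "y \<in> closure S" "y \<notin> S" using S(1) by (auto simp: frontier_def interior_open)
    then have "y \<in> cball c r" and alt: "norm (y - c) = r \<or> y \<in> cball c (r/2)"
      using clS by (auto simp: S_def dist_norm norm_minus_commute)
    from alt show "m * h y \<le> w y"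
    proof
      assume "norm (y - c) = r"
      then have "h y = 0" by (simp add: h_def d_def flip: power2_norm_eq_inner)
      then show ?thesis using nonneg[OF \<open>y \<in> cball c r\<close>] by simp
    next
      assume y2: "y \<in> cball c (r/2)"
      have "exp (- k * ((y - c) \<bullet> (y - c))) \<le> 1" using k0 by simp
      then have "h y \<le> 1" using exp_ge_zero[of "- k * r\<^sup>2"] unfolding h_def d_def by linarith
      then have "m * h y \<le> m" using m by simp
      then show ?thesis using x0(2)[OF y2] by (simp add: m_def)
    qed
  qed
  show ?thesis
  proof (intro exI[of _ "m * (d * (k * r\<^sup>2))"] conjI allI impI)
    show "m * (d * (k * r\<^sup>2)) > 0" using m k0 r by (simp add: d_def)
    fix t :: real assume t: "0 \<le> t \<and> t \<le> 1/2"
    define x where "x = z + t *\<^sub>R (c - z)"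
    have xc: "x - c = (1 - t) *\<^sub>R (z - c)" by (simp add: x_def algebra_simps)
    have nx: "norm (x - c) = (1 - t) * r" using t z by (simp add: xc)
    have "d * (k * r\<^sup>2) * t \<le> h x"
    proof -
      have "(x - c) \<bullet> (x - c) = ((1 - t) * r)\<^sup>2" by (simp add: nx flip: power2_norm_eq_inner)
      then have "- k * ((x - c) \<bullet> (x - c)) = - k * r\<^sup>2 + k * r\<^sup>2 * (2 * t - t\<^sup>2)"
        by (simp only: power_mult_distrib power2_eq_square) (simp add: algebra_simps)
      then have "h x = d * (exp (k * r\<^sup>2 * (2 * t - t\<^sup>2)) - 1)"
        by (simp only: h_def d_def exp_add right_diff_distrib mult_1_right)
      moreover have "k * r\<^sup>2 * t \<le> exp (k * r\<^sup>2 * (2 * t - t\<^sup>2)) - 1"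
      proof -
        have "t * t \<le> t * 1" using t by (intro mult_left_mono) auto
        then have "t \<le> 2 * t - t\<^sup>2" by (simp add: power2_eq_square)
        then have "k * r\<^sup>2 * t \<le> k * r\<^sup>2 * (2 * t - t\<^sup>2)" using k0 by (intro mult_left_mono) auto
        also have "\<dots> \<le> exp (k * r\<^sup>2 * (2 * t - t\<^sup>2)) - 1"
          using exp_ge_add_one_self[of "k * r\<^sup>2 * (2 * t - t\<^sup>2)"] by linarith
        finally show ?thesis .
      qed
      ultimately show ?thesis by (simp add: d_def mult.assoc)
    qed
    then have "m * (d * (k * r\<^sup>2)) * t \<le> m * h x" using m by (simp add: mult.assoc)
    also have "\<dots> \<le> w x"
    proof (cases "t = 0 \<or> t = 1/2")
      case True
      then show ?thesis
      proof
        assume "t = 0"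
        then have "norm (x - c) = r" using nx by simp
        then have "h x = 0" "x \<in> cball c r" by (simp_all add: h_def d_def dist_norm norm_minus_commute flip: power2_norm_eq_inner)
        then show ?thesis using nonneg by simp
      next
        assume "t = 1/2"
        then have "norm (x - c) = r/2" unfolding nx by simp
        then have x2: "x \<in> cball c (r/2)" by (simp add: dist_norm norm_minus_commute)
        have "exp (- k * ((x - c) \<bullet> (x - c))) \<le> 1" using k0 by simp
        then have "h x \<le> 1" using exp_ge_zero[of "- k * r\<^sup>2"] unfolding h_def d_def by linarith
        then have "m * h x \<le> m" using m by simp
        then show ?thesis using x0(2)[OF x2] by (simp add: m_def)
      qed
    next
      case False
      then have "r/2 < norm (x - c)" "norm (x - c) < r" using t r by (auto simp: nx)
      then have "x \<in> S" by (auto simp: S_def dist_norm norm_minus_commute)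
      then show ?thesis by (rule comp)
    qed
    finally show "m * (d * (k * r\<^sup>2)) * t \<le> w (z + t *\<^sub>R (c - z))" by (simp add: x_def)
  qed
qed

lemma derivative_ge_of_linear_growth:
  fixes \<phi> :: "real \<Rightarrow> real"
  assumes "(\<phi> has_real_derivative d) (at 0 within {0..})" "\<phi> 0 = 0" "\<delta> > 0"
    and "\<And>t. 0 < t \<Longrightarrow> t < \<delta> \<Longrightarrow> \<kappa> * t \<le> \<phi> t"
  shows "\<kappa> \<le> d"
proof (rule ccontr)
  assume "\<not> \<kappa> \<le> d"
  then obtain \<delta>' where "\<delta>' > 0" "\<And>t. 0 < t \<Longrightarrow> t < \<delta>' \<Longrightarrow> \<phi> t < \<kappa> * t"
    using real_function_at_right_less[OF assms(1,2), of \<kappa>] by auto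
  moreover define t where "t = min \<delta> \<delta>' / 2"
  ultimately have "0 < t" "t < \<delta>" "t < \<delta>'" using assms(3) by auto
  then show False using assms(4)[of t] \<open>\<And>t. 0 < t \<Longrightarrow> t < \<delta>' \<Longrightarrow> \<phi> t < \<kappa> * t\<close>[of t] by simp
qed

text \<open>
  If the zero set were not open, a ball on which \<open>w > 0\<close> would touch it at an interior point. There
  \<open>w\<close> has a minimum, so its gradient vanishes, against the Hopf lemma.
\<close>

lemma strong_maximum_principle:
  fixes S :: "'a::euclidean_space set"
  assumes S: "open S" and sup: "supersolution S p q K w D L" and "K \<ge> 0"
    and bd: "\<And>x. x \<in> S \<Longrightarrow> p x \<bullet> p x \<le> B" "\<And>x. x \<in> S \<Longrightarrow> q x \<bullet> q x \<le> B"
    and nonneg: "\<And>x. x \<in> S \<Longrightarrow> w x \<ge> 0"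
  shows "open {x \<in> S. w x = 0}"
proof (rule ccontr)
  assume no: "\<not> open {x \<in> S. w x = 0}"
  then obtain x where x: "x \<in> S" "w x = 0" and not_int: "\<And>e. e > 0 \<Longrightarrow> \<not> ball x e \<subseteq> {x \<in> S. w x = 0}"
    unfolding open_contains_ball by blast
  have gw: "grad_hess S w D L" using sup by (simp add: supersolution_def)
  have cont: "continuous_on S w"
    using grad_hess_continuous_on(1)[OF gw] .
  obtain e where e: "e > 0" "ball x e \<subseteq> S" using S x openE by blast
  define d where "d = e / 4"
  have d: "d > 0" using e by (simp add: d_def)
  obtain c where c: "c \<in> ball x d" "\<not> (c \<in> S \<and> w c = 0)" using not_int[OF d] by blast
  have sub: "cball c (2 * d) \<subseteq> S"
  proof
    fix y assume "y \<in> cball c (2 * d)"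
    then have "dist x y < e" using c(1) dist_triangle[of x y c] d by (auto simp: d_def)
    then show "y \<in> S" using e by auto
  qed
  have cS: "c \<in> S" using sub d by auto
  then have wc: "w c > 0" using c nonneg[of c] by force
  define A where "A = {y \<in> cball c (2 * d). w y = 0}"
  have "closed A" unfolding A_def
    by (rule continuous_closed_preimage_constant) (use continuous_on_subset[OF cont sub] in auto)
  moreover have xA: "x \<in> A" using x c(1) d by (auto simp: A_def dist_commute)
  ultimately obtain z where z: "z \<in> A" "\<And>y. y \<in> A \<Longrightarrow> dist c z \<le> dist c y"
    using distance_attains_inf[of A c] by blast
  define r where "r = dist c z"
  have zc: "z \<noteq> c" using z(1) wc by (auto simp: A_def)
  have r: "r > 0" "r < d" using zc z(2)[OF xA] c(1) by (auto simp: r_def dist_commute)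
  have csub: "cball c r \<subseteq> S" using r sub by (auto simp: subset_iff)
  have pos: "w y > 0" if "y \<in> ball c r" for y
  proof -
    have "y \<in> S" using csub that by auto
    have "y \<notin> A" using z(2)[of y] that by (auto simp: r_def)
    then have "w y \<noteq> 0" using that r by (auto simp: A_def)
    then show ?thesis using nonneg[OF \<open>y \<in> S\<close>] by simp
  qed
  have bS: "ball c r \<subseteq> S" using csub by auto
  obtain \<kappa> where \<kappa>: "\<kappa> > 0" "\<And>t. 0 \<le> t \<Longrightarrow> t \<le> 1/2 \<Longrightarrow> \<kappa> * t \<le> w (z + t *\<^sub>R (c - z))"
    using hopf_lemma[OF supersolution_subset[OF sup bS] assms(3) r(1), of B z] bd bS pos
      continuous_on_subset[OF cont csub] by (auto simp: r_def dist_norm norm_minus_commute subset_iff)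
  have zS: "z \<in> S" and wz: "w z = 0" using z(1) sub by (auto simp: A_def)
  have "D z = 0" using second_derivative_test(1)[OF S zS gw] nonneg wz by auto
  then have "(w has_derivative (\<lambda>v. 0)) (at (z + 0 *\<^sub>R (c - z)))"
    using grad_hess_openD(1)[OF gw zS S] by simp
  from has_real_derivative_along_line[OF this]
  have "((\<lambda>t. w (z + t *\<^sub>R (c - z))) has_real_derivative 0) (at 0 within {0..})"
    by (rule has_field_derivative_at_within)
  from derivative_ge_of_linear_growth[OF this, of "1/2" \<kappa>] show False using \<kappa> wz by simp
qed

text \<open>
  Serrin's corner lemma. The half ball has a right-angled edge at \<open>Q\<close>, where the Hopf lemma says
  nothing, and the best possible growth is quadratic. The barrier is the product of
  \<open>exp (M s) - 1\<close>, which vanishes on the plane \<open>s = 0\<close>, and the Gaussian barrier, which vanishes on the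
  sphere. Its Hessian contains a cross term that is not small near the plane unless the second-order
  operator decouples there; this is the content of the hypothesis on the mixed products.
\<close>

lemma corner_lemma:
  fixes c Q e :: "'a::euclidean_space"
  assumes e: "norm e = 1" and r: "r > 0" and Qc: "norm (Q - c) = r" and Qe: "e \<bullet> (Q - c) = 0"
  defines "S \<equiv> {x. 0 < e \<bullet> (x - c) \<and> norm (x - c) < r \<and> norm (x - Q) < r/2}"
    and "R \<equiv> {x. 0 \<le> e \<bullet> (x - c) \<and> norm (x - c) \<le> r \<and> norm (x - Q) \<le> r/2}"
  assumes sup: "supersolution S p q K w D L" and K: "K \<ge> 0"
    and bd: "\<And>x. x \<in> S \<Longrightarrow> p x \<bullet> p x \<le> B" "\<And>x. x \<in> S \<Longrightarrow> q x \<bullet> q x \<le> B" and C: "C \<ge> 0"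
    and mixed: "\<And>x. x \<in> S \<Longrightarrow>
      \<bar>(p x \<bullet> e) * (p x \<bullet> (x - c)) + (q x \<bullet> e) * (q x \<bullet> (x - c))\<bar> \<le> C * (e \<bullet> (x - c))"
    and cw: "continuous_on R w" and nonneg: "\<And>x. x \<in> R \<Longrightarrow> w x \<ge> 0"
    and \<epsilon>: "\<epsilon> > 0" and low: "\<And>x. x \<in> R \<Longrightarrow> norm (x - Q) = r/2 \<Longrightarrow> \<epsilon> * (e \<bullet> (x - c)) \<le> w x"
  shows "\<exists>\<kappa>>0. \<forall>t. 0 < t \<and> t \<le> 1/4 \<longrightarrow> \<kappa> * t\<^sup>2 \<le> w (Q + t *\<^sub>R ((c - Q) + r *\<^sub>R e))"
proof -
  define s where "s x = e \<bullet> (x - c)" for x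
  have S_eq: "S = {x. 0 < s x} \<inter> (ball c r \<inter> ball Q (r/2))"
    by (auto simp: S_def s_def dist_norm norm_minus_commute)
  have R_eq: "R = {x. 0 \<le> s x} \<inter> (cball c r \<inter> cball Q (r/2))"
    by (auto simp: R_def s_def dist_norm norm_minus_commute)
  have opS: "open S" unfolding S_eq s_def
    by (intro open_Int open_ball open_Collect_less continuous_intros)
  have clR: "closed R" unfolding R_eq s_def
    by (intro closed_Int closed_cball closed_Collect_le continuous_intros)
  have SR: "S \<subseteq> R" by (auto simp: S_def R_def)
  have bS: "bounded S" unfolding S_eq by (meson bounded_Int bounded_ball)
  have clS: "closure S \<subseteq> R" using SR clR by (rule closure_minimal)
  define B' where "B' = \<bar>B\<bar>"
  have B': "B' \<ge> 0" "\<And>x. x \<in> S \<Longrightarrow> p x \<bullet> p x \<le> B'" "\<And>x. x \<in> S \<Longrightarrow> q x \<bullet> q x \<le> B'"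
    using bd by (fastforce simp: B'_def)+
  \<comment> \<open>The steepness of the first factor pays for the first-order term that does not vanish on the plane.\<close>
  define M where "M = K + 1"
  have M: "M > 0" "K \<le> 2 * M" using K by (auto simp: M_def)
  define A where "A = 4 * exp (M * r) * (2 + 2 * B' + C)"
  have A: "A \<ge> 0" using B' C by (simp add: A_def)
  define k where "k = (4 * real DIM('a) * (1 + B') + 2 * K * r + A + 1) / (8 * (r/2)\<^sup>2)"
  have k: "k * (8 * (r/2)\<^sup>2) > 4 * real DIM('a) * (1 + B') + 2 * K * r + A"
    using r by (simp add: k_def)
  have k0: "k > 0" unfolding k_def using r K A B' by (intro divide_pos_pos add_nonneg_pos) auto
  define E where "E x = exp (- k * ((x - c) \<bullet> (x - c)))" for x
  have E: "E x > 0" for x by (simp add: E_def)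
  define d where "d = exp (- k * r\<^sup>2)"
  define g where "g x = E x - d" for x
  define f where "f x = exp (M * s x) - 1" for x
  define Dg where "Dg x = (- 2 * k * E x) *\<^sub>R (x - c)" for x
  define Lg where "Lg x = (\<lambda>v. (4 * k\<^sup>2 * E x) *\<^sub>R ((x - c) \<bullet> v) *\<^sub>R (x - c) - (2 * k * E x) *\<^sub>R v)" for x
  define Df where "Df x = (M * exp (M * s x)) *\<^sub>R e" for x
  define Lf where "Lf x = (\<lambda>v. (M\<^sup>2 * exp (M * s x)) *\<^sub>R (e \<bullet> v) *\<^sub>R e)" for x
  have ghg: "grad_hess S g Dg Lg"
    unfolding g_def[abs_def] Dg_def[abs_def] Lg_def[abs_def] E_def by (rule grad_hess_gauss)
  have ghf: "grad_hess S f Df Lf"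
    unfolding f_def[abs_def] Df_def[abs_def] Lf_def[abs_def] s_def by (rule grad_hess_exp_linear)
  define h where "h = (\<lambda>x. f x * g x)"
  have gh: "grad_hess S h (\<lambda>x. f x *\<^sub>R Dg x + g x *\<^sub>R Df x)
    (\<lambda>x v. (f x *\<^sub>R Lg x v + (Df x \<bullet> v) *\<^sub>R Dg x) + (g x *\<^sub>R Lf x v + (Dg x \<bullet> v) *\<^sub>R Df x))"
    unfolding h_def by (rule grad_hess_mult[OF ghf ghg])
  have ch: "continuous_on T h" for T
    unfolding h_def f_def g_def E_def s_def by (intro continuous_intros)
  have snorm: "\<bar>s x\<bar> \<le> r" if "norm (x - c) \<le> r" for x
    using Cauchy_Schwarz_ineq2[of e "x - c"] e that by (simp add: s_def)
  have f_ge: "M * s x \<le> f x" for x 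
    using exp_ge_add_one_self[of "M * s x"] unfolding f_def by linarith
  have f_le: "f x \<le> M * exp (M * r) * s x" if "0 \<le> s x" "norm (x - c) \<le> r" for x
  proof -
    have "1 - M * s x \<le> exp (- (M * s x))" 
      using exp_ge_add_one_self[of "- (M * s x)"] by linarith
    then have "(1 - M * s x) * exp (M * s x) \<le> exp (- (M * s x)) * exp (M * s x)"
      by (intro mult_right_mono) auto
    then have "f x \<le> (M * s x) * exp (M * s x)" by (simp add: f_def algebra_simps flip: exp_add)
    also have "\<dots> \<le> (M * s x) * exp (M * r)"
      using that M snorm[OF that(2)] by (intro mult_left_mono) auto
    finally show ?thesis by (simp add: mult_ac)
  qed
  have g_nonneg: "g x \<ge> 0" if "norm (x - c) \<le> r" for x
  proof -
    have "(x - c) \<bullet> (x - c) \<le> r\<^sup>2" using that by (simp add: power_mono flip: power2_norm_eq_inner)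
    then show ?thesis using k0 by (simp add: g_def E_def d_def)
  qed
  have g_le: "g x \<le> 1" for x
  proof -
    have "E x \<le> 1" using k0 by (simp add: E_def)
    then show ?thesis using exp_ge_zero[of "- k * r\<^sup>2"] unfolding g_def d_def by linarith
  qed
  have strict: "K * norm (f x *\<^sub>R Dg x + g x *\<^sub>R Df x)
     < ell (p x) (\<lambda>v. (f x *\<^sub>R Lg x v + (Df x \<bullet> v) *\<^sub>R Dg x) + (g x *\<^sub>R Lf x v + (Dg x \<bullet> v) *\<^sub>R Df x))
     + ell (q x) (\<lambda>v. (f x *\<^sub>R Lg x v + (Df x \<bullet> v) *\<^sub>R Dg x) + (g x *\<^sub>R Lf x v + (Dg x \<bullet> v) *\<^sub>R Df x))"
    if xS: "x \<in> S" for x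
  proof -
    have sx: "s x > 0" and yr: "norm (x - c) < r" and xQ: "norm (x - Q) < r/2"
      using xS by (auto simp: S_def s_def)
    have y2: "r/2 \<le> norm (x - c)"
      using norm_triangle_ineq[of "x - c" "Q - x"] xQ Qc by (simp add: norm_minus_commute)
    define F where "F = exp (M * s x)"
    have F: "F > 0" "F \<le> exp (M * r)" using snorm[of x] yr M by (auto simp: F_def)
    have fpos: "f x > 0" using f_ge[of x] sx M by (smt (verit) mult_pos_pos)
    have ellh: "ell a (\<lambda>v. (f x *\<^sub>R Lg x v + (Df x \<bullet> v) *\<^sub>R Dg x) + (g x *\<^sub>R Lf x v + (Dg x \<bullet> v) *\<^sub>R Df x))
      = f x * ell a (Lg x) + g x * ell a (Lf x)
        - 4 * k * E x * (M * F) * ((1 + a \<bullet> a) * s x - (a \<bullet> e) * (a \<bullet> (x - c)))" for a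
    proof -
      define y where "y = x - c"
      have "Df x = (M * F) *\<^sub>R e" "Dg x = (- 2 * k * E x) *\<^sub>R y" "s x = e \<bullet> y"
        by (simp_all add: Df_def F_def Dg_def y_def s_def)
      then show ?thesis
        unfolding ell_add ell_scale ell_rank_one y_def[symmetric]
        by (simp add: algebra_simps inner_commute)
    qed
    have Lf_ge: "M\<^sup>2 * F \<le> ell a (Lf x)" for a
    proof -
      have "1 \<le> ell a (\<lambda>v. (e \<bullet> v) *\<^sub>R e)" using ell_rank_one_ge[of e a] e by (simp add: norm_eq_1)
      then have "M\<^sup>2 * F * 1 \<le> M\<^sup>2 * F * ell a (\<lambda>v. (e \<bullet> v) *\<^sub>R e)"
        using F by (intro mult_left_mono) auto
      then show ?thesis unfolding Lf_def F_def[symmetric] ell_scale by simp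
    qed
    \<comment> \<open>The cross term is of order \<open>s\<close> because the two operators together decouple the direction
        \<open>e\<close> from the hyperplane \<open>s = 0\<close> to first order.\<close>
    have cross: "4 * k * E x * (M * F) * (((1 + p x \<bullet> p x) * s x - (p x \<bullet> e) * (p x \<bullet> (x - c)))
        + ((1 + q x \<bullet> q x) * s x - (q x \<bullet> e) * (q x \<bullet> (x - c)))) \<le> f x * (A * k * E x)"
    proof -
      have "(1 + p x \<bullet> p x) * s x \<le> (1 + B') * s x" "(1 + q x \<bullet> q x) * s x \<le> (1 + B') * s x"
        using B'(2,3)[OF xS] sx by (auto intro!: mult_right_mono)
      then have "((1 + p x \<bullet> p x) * s x - (p x \<bullet> e) * (p x \<bullet> (x - c)))
        + ((1 + q x \<bullet> q x) * s x - (q x \<bullet> e) * (q x \<bullet> (x - c))) \<le> (2 + 2 * B' + C) * s x"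
        using mixed[OF xS] unfolding s_def[symmetric] by (simp add: algebra_simps)
      then have "4 * k * E x * (M * F) * (((1 + p x \<bullet> p x) * s x - (p x \<bullet> e) * (p x \<bullet> (x - c)))
        + ((1 + q x \<bullet> q x) * s x - (q x \<bullet> e) * (q x \<bullet> (x - c))))
        \<le> 4 * k * E x * (M * F) * ((2 + 2 * B' + C) * s x)"
        using k0 E[of x] M F by (intro mult_left_mono) auto
      also have "\<dots> = (4 * k * E x * F * (2 + 2 * B' + C)) * (M * s x)" by (simp add: mult_ac)
      also have "\<dots> \<le> (4 * k * E x * exp (M * r) * (2 + 2 * B' + C)) * f x"
        using k0 E[of x] M F B' C f_ge[of x] sx
        by (intro mult_mono mult_left_mono mult_right_mono mult_nonneg_nonneg add_nonneg_nonneg) auto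
      finally show ?thesis by (simp add: A_def mult_ac)
    qed
    have "K * norm (f x *\<^sub>R Dg x + g x *\<^sub>R Df x) \<le> K * (f x * norm (Dg x) + g x * (M * F))"
      using norm_triangle_ineq[of "f x *\<^sub>R Dg x" "g x *\<^sub>R Df x"] fpos g_nonneg[of x] yr K M F e
      by (intro mult_left_mono) (auto simp: Df_def F_def)
    also have "\<dots> \<le> f x * (K * norm (Dg x)) + g x * (2 * (M\<^sup>2 * F))"
    proof -
      have "K * (M * F) \<le> (2 * M) * (M * F)" using M F by (intro mult_right_mono) auto
      then have "g x * (K * (M * F)) \<le> g x * (2 * (M\<^sup>2 * F))"
        using g_nonneg[of x] yr by (intro mult_left_mono) (auto simp: power2_eq_square mult_ac)
      then show ?thesis by (simp add: algebra_simps)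
    qed
    also have "\<dots> < f x * (ell (p x) (Lg x) + ell (q x) (Lg x) - A * k * E x) + g x * (2 * (M\<^sup>2 * F))"
    proof -
      have "K * norm (Dg x) + A * k * E x < ell (p x) (Lg x) + ell (q x) (Lg x)"
        unfolding Lg_def Dg_def
        by (rule gauss_barrier[OF B'(2)[OF xS] B'(3)[OF xS] _ y2 _ K A k k0 E[of x]]) (use r yr in auto)
      then show ?thesis using fpos by simp
    qed
    also have "\<dots> \<le> f x * (ell (p x) (Lg x) + ell (q x) (Lg x) - A * k * E x)
        + g x * (ell (p x) (Lf x) + ell (q x) (Lf x))"
      using Lf_ge[of "p x"] Lf_ge[of "q x"] g_nonneg[of x] yr
      by (intro add_left_mono mult_left_mono) auto
    finally show ?thesis using cross unfolding ellh by (simp add: algebra_simps)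
  qed
  define \<epsilon>' where "\<epsilon>' = \<epsilon> / (M * exp (M * r))"
  have \<epsilon>': "\<epsilon>' > 0" using \<epsilon> M by (simp add: \<epsilon>'_def)
  have comp: "\<epsilon>' * h x \<le> w x" if "x \<in> S" for x
  proof (rule comparison_principle[OF opS bS sup continuous_on_subset[OF cw clS] ch gh strict \<epsilon>' _ that])
    fix y assume "y \<in> frontier S"
    then have yR: "y \<in> R" and "y \<notin> S" using clS opS by (auto simp: frontier_def interior_open)
    then consider "s y = 0" | "norm (y - c) = r" | "norm (y - Q) = r/2"
      by (force simp: R_def S_def s_def)
    then show "\<epsilon>' * h y \<le> w y"
    proof cases
      case 1
      then show ?thesis using nonneg[OF yR] by (simp add: h_def f_def)
    next
      case 2
      then have "g y = 0" by (simp add: g_def E_def d_def flip: power2_norm_eq_inner)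
      then show ?thesis using nonneg[OF yR] by (simp add: h_def)
    next
      case 3
      have sy: "0 \<le> s y" "norm (y - c) \<le> r" using yR by (auto simp: R_def s_def)
      have "f y \<ge> 0" using f_ge[of y] sy M by (smt (verit) mult_nonneg_nonneg)
      then have "h y \<le> f y" using g_le[of y] by (simp add: h_def mult_left_le)
      also have "\<dots> \<le> M * exp (M * r) * s y" using f_le sy by simp
      finally have "\<epsilon>' * h y \<le> \<epsilon>' * (M * exp (M * r) * s y)" using \<epsilon>' by simp
      also have "\<dots> = \<epsilon> * s y" using M by (simp add: \<epsilon>'_def)
      also have "\<dots> \<le> w y" using low[OF yR 3] by (simp add: s_def)
      finally show ?thesis .
    qed
  qed
  show ?thesis
  proof (intro exI[of _ "\<epsilon>' * (M * r * (d * (k * r\<^sup>2)))"] conjI allI impI)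
    show "0 < \<epsilon>' * (M * r * (d * (k * r\<^sup>2)))" using \<epsilon>' M r k0 by (simp add: d_def)
    fix t :: real assume t: "0 < t \<and> t \<le> 1/4"
    define x where "x = Q + t *\<^sub>R ((c - Q) + r *\<^sub>R e)"
    have ee: "e \<bullet> e = 1" using e by (simp add: norm_eq_1)
    have QQ: "(Q - c) \<bullet> (Q - c) = r\<^sup>2" using Qc by (simp flip: power2_norm_eq_inner)
    have Qe': "(Q - c) \<bullet> e = 0" using Qe by (simp add: inner_commute)
    have xc: "x - c = (1 - t) *\<^sub>R (Q - c) + (t * r) *\<^sub>R e" by (simp add: x_def algebra_simps)
    have sx: "s x = t * r" unfolding s_def xc by (simp add: inner_add_right Qe ee)
    have n2: "(x - c) \<bullet> (x - c) = r\<^sup>2 * (1 - 2 * t + 2 * t\<^sup>2)"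
      unfolding xc inner_add_left inner_add_right inner_scaleR_left inner_scaleR_right Qe Qe' QQ ee
      by (simp add: power2_eq_square algebra_simps)
    have tt: "t * t \<le> t * (1/4)" using t by (intro mult_left_mono) auto
    have "(norm (x - c))\<^sup>2 < r\<^sup>2"
      unfolding power2_norm_eq_inner n2 using tt t r by (simp add: power2_eq_square)
    then have xr: "norm (x - c) < r" by (rule power2_less_imp_less) (use r in simp)
    have "x - Q = t *\<^sub>R ((c - Q) + r *\<^sub>R e)" by (simp add: x_def)
    then have "(norm (x - Q))\<^sup>2 = t\<^sup>2 * (norm (- (Q - c) + r *\<^sub>R e))\<^sup>2" by (simp add: power_mult_distrib)
    also have "(norm (- (Q - c) + r *\<^sub>R e))\<^sup>2 = 2 * r\<^sup>2"
      unfolding power2_norm_eq_inner inner_add_left inner_add_right inner_minus_left inner_minus_right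
        inner_scaleR_left inner_scaleR_right Qe Qe' QQ ee by (simp add: power2_eq_square)
    also have "t\<^sup>2 * (2 * r\<^sup>2) \<le> (1/16) * (2 * r\<^sup>2)"
    proof (rule mult_right_mono)
      show "t\<^sup>2 \<le> 1/16" using tt t unfolding power2_eq_square by linarith
    qed simp
    also have "\<dots> < (r/2)\<^sup>2" using r by (simp add: power2_eq_square)
    finally have xQ: "norm (x - Q) < r/2" by (rule power2_less_imp_less) (use r in simp)
    have "0 < s x" unfolding sx using t r by simp
    then have xS: "x \<in> S" using xr xQ unfolding S_def s_def by blast
    have "- k * ((x - c) \<bullet> (x - c)) = - k * r\<^sup>2 + k * r\<^sup>2 * (2 * t - 2 * t\<^sup>2)"
      unfolding n2 by (simp add: algebra_simps)
    then have "g x = d * (exp (k * r\<^sup>2 * (2 * t - 2 * t\<^sup>2)) - 1)"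
      by (simp only: g_def E_def d_def exp_add right_diff_distrib mult_1_right)
    moreover have "k * r\<^sup>2 * t \<le> exp (k * r\<^sup>2 * (2 * t - 2 * t\<^sup>2)) - 1"
    proof -
      have "t \<le> 2 * t - 2 * t\<^sup>2" using tt t by (simp add: power2_eq_square)
      then have "k * r\<^sup>2 * t \<le> k * r\<^sup>2 * (2 * t - 2 * t\<^sup>2)" using k0 by (intro mult_left_mono) auto
      also have "\<dots> \<le> exp (k * r\<^sup>2 * (2 * t - 2 * t\<^sup>2)) - 1"
        using exp_ge_add_one_self[of "k * r\<^sup>2 * (2 * t - 2 * t\<^sup>2)"] by linarith
      finally show ?thesis .
    qed
    ultimately have gx: "d * (k * r\<^sup>2) * t \<le> g x" by (simp add: d_def mult.assoc)
    have fx: "M * r * t \<le> f x" using f_ge[of x] sx by (simp add: mult_ac)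
    have "0 \<le> M * r * t" "0 \<le> d * (k * r\<^sup>2) * t" using M r t k0 by (simp_all add: d_def)
    then have "M * r * t * (d * (k * r\<^sup>2) * t) \<le> h x"
      unfolding h_def using fx gx by (intro mult_mono) auto
    then have "\<epsilon>' * (M * r * t * (d * (k * r\<^sup>2) * t)) \<le> \<epsilon>' * h x" using \<epsilon>' by simp
    also have "\<dots> \<le> w x" by (rule comp[OF xS])
    finally show "\<epsilon>' * (M * r * (d * (k * r\<^sup>2))) * t\<^sup>2 \<le> w (Q + t *\<^sub>R ((c - Q) + r *\<^sub>R e))"
      by (simp add: x_def power2_eq_square mult_ac)
  qed
qed

section \<open>Boundary charts\<close>

definition thrice_differentiable :: "('a::euclidean_space \<Rightarrow> real) \<Rightarrow> ('a \<Rightarrow> 'a) \<Rightarrow> ('a \<Rightarrow> 'a \<Rightarrow> 'a) \<Rightarrow> ('a \<Rightarrow> 'a \<Rightarrow> 'a \<Rightarrow> 'a) \<Rightarrow> bool" where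
  "thrice_differentiable g D H T \<longleftrightarrow> (\<forall>x. (g has_derivative (\<lambda>v. D x \<bullet> v)) (at x)) \<and>
     (\<forall>x. (D has_derivative H x) (at x)) \<and> (\<forall>x k. ((\<lambda>x. H x k) has_derivative (\<lambda>v. T x v k)) (at x))"

lemma has_derivative_gradient:
  fixes f :: "'a::euclidean_space \<Rightarrow> real"
  assumes "f differentiable (at x)"
  shows "(f has_derivative (\<lambda>v. gradient f x \<bullet> v)) (at x)"
proof -
  have d: "(f has_derivative frechet_derivative f (at x)) (at x)"
    using assms frechet_derivative_works by blast
  have lin: "linear (frechet_derivative f (at x))" using d by (rule has_derivative_linear)
  have "frechet_derivative f (at x) v = gradient f x \<bullet> v" for v
  proof -
    have "frechet_derivative f (at x) v = frechet_derivative f (at x) (\<Sum>b\<in>Basis. (v \<bullet> b) *\<^sub>R b)"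
      by (simp add: euclidean_representation)
    also have "\<dots> = (\<Sum>b\<in>Basis. (v \<bullet> b) * frechet_derivative f (at x) b)"
      by (simp add: linear_sum[OF lin] linear_cmul[OF lin])
    also have "\<dots> = gradient f x \<bullet> v"
      unfolding gradient_def inner_sum_left by (simp add: mult.commute inner_commute)
    finally show ?thesis .
  qed
  then show ?thesis using d by (metis (no_types, lifting) ext)
qed

lemma holder_space_thrice_differentiable:
  fixes g :: "'a::euclidean_space \<Rightarrow> real"
  assumes g: "g \<in> holder_space_closure 4 \<alpha> UNIV"
  shows "\<exists>D H T. thrice_differentiable g D H T"
proof -
  have dif: "iter_partial bs g differentiable (at x)" if "bs \<in> lists Basis" "length bs < 4" for bs x
    using g that unfolding holder_space_closure_def by blast
  have grad: "gradient (iter_partial bs g) x = (\<Sum>b\<in>Basis. iter_partial (b # bs) g x *\<^sub>R b)" for bs x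
    by (simp add: gradient_def)
  define D where "D x = (\<Sum>b\<in>Basis. iter_partial [b] g x *\<^sub>R b)" for x
  define H where "H x v = (\<Sum>b\<in>Basis. (\<Sum>c\<in>Basis. iter_partial [c, b] g x * (c \<bullet> v)) *\<^sub>R b)" for x v
  define T where "T x w v = (\<Sum>b\<in>Basis. (\<Sum>c\<in>Basis. (gradient (iter_partial [c, b] g) x \<bullet> w) * (c \<bullet> v)) *\<^sub>R b)" for x w v
  have 1: "(g has_derivative (\<lambda>v. D x \<bullet> v)) (at x)" for x
    using has_derivative_gradient[of g x] dif[of "[]" x] grad[of "[]" x] by (simp add: D_def)
  have 2: "(D has_derivative H x) (at x)" for x
  proof -
    have "(iter_partial [b] g has_derivative (\<lambda>v. \<Sum>c\<in>Basis. iter_partial [c, b] g x * (c \<bullet> v))) (at x)"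
      if "b \<in> Basis" for b
      using has_derivative_gradient[of "iter_partial [b] g" x] dif[of "[b]" x] grad[of "[b]" x] that
      by (simp add: inner_sum_left del: iter_partial.simps)
    then have "((\<lambda>x. \<Sum>b\<in>Basis. iter_partial [b] g x *\<^sub>R b) has_derivative
        (\<lambda>v. \<Sum>b\<in>Basis. (\<Sum>c\<in>Basis. iter_partial [c, b] g x * (c \<bullet> v)) *\<^sub>R b)) (at x)"
      by (intro has_derivative_sum has_derivative_scaleR_left)
    then show ?thesis unfolding D_def[abs_def] H_def[abs_def] .
  qed
  have 3: "((\<lambda>x. H x k) has_derivative (\<lambda>v. T x v k)) (at x)" for x k
  proof -
    have "(iter_partial [c, b] g has_derivative (\<lambda>v. gradient (iter_partial [c, b] g) x \<bullet> v)) (at x)"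
      if "b \<in> Basis" "c \<in> Basis" for b c
      using has_derivative_gradient[of "iter_partial [c, b] g" x] dif[of "[c, b]" x] that
      by (simp del: iter_partial.simps)
    then have "((\<lambda>x. \<Sum>b\<in>Basis. (\<Sum>c\<in>Basis. iter_partial [c, b] g x * (c \<bullet> k)) *\<^sub>R b) has_derivative
        (\<lambda>v. \<Sum>b\<in>Basis. (\<Sum>c\<in>Basis. (gradient (iter_partial [c, b] g) x \<bullet> v) * (c \<bullet> k)) *\<^sub>R b)) (at x)"
      by (intro has_derivative_sum has_derivative_scaleR_left has_derivative_mult_left)
    then show ?thesis unfolding H_def T_def .
  qed
  show ?thesis unfolding thrice_differentiable_def using 1 2 3 by blast
qed

text \<open>
  For a function with gradient \<open>p\<close> and Hessian \<open>L\<close> at a point, the sum of the principal curvatures of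
  its level set there, signed so that convex superlevel sets give negative values.
\<close>

definition level_curv :: "'a::euclidean_space \<Rightarrow> ('a \<Rightarrow> 'a) \<Rightarrow> real" where
  "level_curv p L = (trace_form L - (L p \<bullet> p) / (p \<bullet> p)) / norm p"

lemma level_curv_basis:
  assumes lin: "linear L" and "p \<noteq> 0" and B: "is_orthonormal_basis B {v. p \<bullet> v = 0}"
  shows "level_curv p L = (\<Sum>b\<in>B. L b \<bullet> b) / norm p"
proof -
  define n where "n = p /\<^sub>R norm p"
  have n: "norm n = 1" and p: "p = norm p *\<^sub>R n" using assms(2) by (simp_all add: n_def)
  have "{v. p \<bullet> v = 0} = {v. n \<bullet> v = 0}" using assms(2) by (simp add: n_def)
  then have B': "is_orthonormal_basis B {v. n \<bullet> v = 0}" using B by simp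
  have "L p \<bullet> p = (p \<bullet> p) * (L n \<bullet> n)"
    by (subst (1 2) p) (simp add: linear_cmul[OF lin] power2_eq_square flip: power2_norm_eq_inner)
  then have "L p \<bullet> p / (p \<bullet> p) = L n \<bullet> n" using assms(2) by simp
  then show ?thesis
    unfolding level_curv_def trace_form_hyperplane[OF lin n B'] by simp
qed

text \<open>
  In place of a graph the boundary is described by a defining function \<open>G\<close>, the height above the
  graph. It is defined on the whole space and grows with unit speed in the direction \<open>e\<close>, so no change
  of coordinates to the tangent plane is ever made.
\<close>

locale boundary_chart =
  fixes \<Omega> :: "'a::euclidean_space set" and p :: 'a and r :: real and e :: 'a
    and G :: "'a \<Rightarrow> real" and D :: "'a \<Rightarrow> 'a" and H :: "'a \<Rightarrow> 'a \<Rightarrow> 'a" and T :: "'a \<Rightarrow> 'a \<Rightarrow> 'a \<Rightarrow> 'a"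
  assumes r_pos: "r > 0" and norm_e: "norm e = 1"
    and C3: "thrice_differentiable G D H T"
    and shift: "\<And>x t. G (x + t *\<^sub>R e) = G x + t"
    and \<Omega>_iff: "\<And>x. x \<in> ball p r \<Longrightarrow> x \<in> \<Omega> \<longleftrightarrow> G x > 0"
    and open_\<Omega>: "open \<Omega>"
begin

lemma dG: "(G has_derivative (\<lambda>v. D x \<bullet> v)) (at x)"
  and dD: "(D has_derivative H x) (at x)"
  and dH: "((\<lambda>x. H x k) has_derivative (\<lambda>v. T x v k)) (at x)"
  using C3 unfolding thrice_differentiable_def by blast+

lemma linear_H: "linear (H x)" using dD by (rule has_derivative_linear)

lemma symmetric_H: "H x h \<bullet> k = H x k \<bullet> h"
  using second_derivative_symmetric[OF open_UNIV UNIV_I, where f = G and x = x and D = D and L = "H x"] dG dD by blast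

lemma symmetric_T: "T x h k \<bullet> l = T x l k \<bullet> h"
proof -
  have "((\<lambda>x. D x \<bullet> k) has_derivative (\<lambda>v. H x k \<bullet> v)) (at x)" for x
    using has_derivative_inner_left[OF dD[of x], of k] by (simp add: symmetric_H[of x _ k])
  then show ?thesis
    using second_derivative_symmetric[OF open_UNIV UNIV_I, where f = "\<lambda>x. D x \<bullet> k" and x = x and D = "\<lambda>x. H x k" and L = "\<lambda>v. T x v k"] dH by blast
qed

lemma isCont_G: "isCont G x" and isCont_D: "isCont D x"
  using has_derivative_continuous[OF dG] has_derivative_continuous[OF dD] by auto

lemma D_e: "D x \<bullet> e = 1"
proof -
  have "((\<lambda>t. G (x + t *\<^sub>R e)) has_real_derivative D x \<bullet> e) (at 0)"
    using has_real_derivative_along_line[of G _ x 0 e] dG[of x] by simp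
  moreover have "((\<lambda>t. G (x + t *\<^sub>R e)) has_real_derivative 1) (at 0)"
    unfolding shift by (auto intro!: derivative_eq_intros)
  ultimately show ?thesis by (rule DERIV_unique)
qed

lemma D_nonzero: "D x \<noteq> 0"
  using D_e[of x] by force

lemma closure_iff:
  assumes x: "x \<in> ball p r"
  shows "x \<in> closure \<Omega> \<longleftrightarrow> G x \<ge> 0"
proof
  assume cl: "x \<in> closure \<Omega>"
  show "G x \<ge> 0"
  proof (rule ccontr)
    assume "\<not> G x \<ge> 0"
    define U where "U = ball p r \<inter> {y. G y < 0}"
    have "open U" unfolding U_def
      by (intro open_Int open_ball open_Collect_less continuous_intros)
         (use isCont_G in \<open>auto intro: continuous_at_imp_continuous_on\<close>)
    moreover have "x \<in> U" using x \<open>\<not> G x \<ge> 0\<close> by (simp add: U_def)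
    moreover have "U \<inter> \<Omega> = {}" using \<Omega>_iff by (force simp: U_def)
    ultimately show False using cl open_Int_closure_eq_empty by fastforce
  qed
next
  assume G: "G x \<ge> 0"
  obtain \<delta> where \<delta>: "\<delta> > 0" "ball x \<delta> \<subseteq> ball p r"
    using x open_ball openE by blast
  have "\<exists>y\<in>\<Omega>. dist y x < \<epsilon>" if "\<epsilon> > 0" for \<epsilon>
  proof -
    define t where "t = min \<delta> \<epsilon> / 2"
    have t: "0 < t" "t < \<delta>" "t < \<epsilon>" using \<delta> that by (auto simp: t_def)
    have "x + t *\<^sub>R e \<in> ball x \<delta>" using t norm_e by (simp add: dist_norm)
    then have "x + t *\<^sub>R e \<in> ball p r" using \<delta> by blast
    then have "x + t *\<^sub>R e \<in> \<Omega>" using \<Omega>_iff G t by (simp add: shift)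
    moreover have "dist (x + t *\<^sub>R e) x < \<epsilon>" using t norm_e by (simp add: dist_norm)
    ultimately show ?thesis by blast
  qed
  then show "x \<in> closure \<Omega>" by (simp add: closure_approachable)
qed

lemma frontier_iff:
  assumes x: "x \<in> ball p r"
  shows "x \<in> frontier \<Omega> \<longleftrightarrow> G x = 0"
  using closure_iff[OF x] \<Omega>_iff[OF x] open_\<Omega> by (auto simp: frontier_def interior_open)

text \<open>
  Since \<open>G\<close> grows with unit speed along \<open>e\<close>, subtracting \<open>G y\<close> times \<open>e\<close> projects \<open>y\<close> onto the level
  set \<open>G = 0\<close>.
\<close>

definition curve :: "'a \<Rightarrow> 'a \<Rightarrow> real \<Rightarrow> 'a" where
  "curve x v t = x + t *\<^sub>R v - G (x + t *\<^sub>R v) *\<^sub>R e"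

lemma G_curve: "G (curve x v t) = 0"
  using shift[of "x + t *\<^sub>R v" "- G (x + t *\<^sub>R v)"] by (simp add: curve_def)

lemma curve_0: "G x = 0 \<Longrightarrow> curve x v 0 = x"
  by (simp add: curve_def)

lemma curve_derivative:
  assumes "D x \<bullet> v = 0"
  shows "(curve x v has_vector_derivative v) (at 0)"
proof -
  have "((\<lambda>t. G (x + t *\<^sub>R v)) has_derivative (\<lambda>h. h *\<^sub>R (D x \<bullet> v))) (at 0)"
    using has_derivative_along_line[of G _ x 0 v] dG[of x] by simp
  then have "((\<lambda>t. x + t *\<^sub>R v - G (x + t *\<^sub>R v) *\<^sub>R e) has_derivative (\<lambda>h. 0 + h *\<^sub>R v - (h *\<^sub>R (D x \<bullet> v)) *\<^sub>R e)) (at 0)"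
    by (intro has_derivative_diff has_derivative_add has_derivative_const has_derivative_scaleR_left has_derivative_ident)
  then show ?thesis using assms by (simp add: has_vector_derivative_def curve_def[abs_def])
qed

lemma eventually_curve_in_ball:
  assumes "x \<in> ball p r" "G x = 0" "D x \<bullet> v = 0"
  shows "\<exists>\<delta>>0. \<forall>t. \<bar>t\<bar> < \<delta> \<longrightarrow> curve x v t \<in> ball p r"
proof -
  have "isCont (curve x v) 0"
    using has_vector_derivative_continuous[OF curve_derivative[OF assms(3)]] .
  then have "((curve x v) \<longlongrightarrow> x) (at 0)" using curve_0[OF assms(2)] by (simp add: isCont_def)
  then have "\<forall>\<^sub>F t in at 0. curve x v t \<in> ball p r"
    using assms(1) open_ball topological_tendstoD by blast
  then obtain \<delta> where "\<delta> > 0" "\<And>t. t \<noteq> 0 \<Longrightarrow> dist t 0 < \<delta> \<Longrightarrow> curve x v t \<in> ball p r"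
    unfolding eventually_at by blast
  then show ?thesis using assms(1) curve_0[OF assms(2)]
    by (intro exI[of _ \<delta>]) (metis dist_0_norm dist_commute real_norm_def)
qed

lemma tangent_space_frontier:
  assumes x: "x \<in> frontier \<Omega>" "x \<in> ball p r"
  shows "tangent_space (frontier \<Omega>) x = {v. D x \<bullet> v = 0}"
proof (intro equalityI subsetI)
  have G0: "G x = 0" using frontier_iff x by simp
  fix v assume "v \<in> {v. D x \<bullet> v = 0}"
  then have v: "D x \<bullet> v = 0" by simp
  obtain \<delta> where "\<delta> > 0" "\<And>t. \<bar>t\<bar> < \<delta> \<Longrightarrow> curve x v t \<in> ball p r"
    using eventually_curve_in_ball[OF x(2) G0 v] by blast
  then show "v \<in> tangent_space (frontier \<Omega>) x"
    unfolding tangent_space_def using curve_0[OF G0] curve_derivative[OF v] frontier_iff G_curve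
    by (auto intro!: exI[of _ "curve x v"] exI[of _ \<delta>])
next
  fix v assume "v \<in> tangent_space (frontier \<Omega>) x"
  then obtain c \<epsilon> where c: "\<epsilon> > 0" "c 0 = x" "\<And>t. t \<in> {-\<epsilon><..<\<epsilon>} \<Longrightarrow> c t \<in> frontier \<Omega>"
      "(c has_vector_derivative v) (at 0)"
    unfolding tangent_space_def by blast
  have "isCont c 0" using has_vector_derivative_continuous[OF c(4)] .
  then have "(c \<longlongrightarrow> x) (at 0)" using c(2) by (simp add: isCont_def)
  then have "\<forall>\<^sub>F t in at 0. c t \<in> ball p r" using x(2) open_ball topological_tendstoD by blast
  then obtain \<delta> where \<delta>: "\<delta> > 0" "\<And>t. t \<noteq> 0 \<Longrightarrow> dist t 0 < \<delta> \<Longrightarrow> c t \<in> ball p r"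
    unfolding eventually_at by blast
  have "(G has_derivative (\<lambda>v. D x \<bullet> v)) (at (c 0))" using c(2) dG by simp
  from diff_chain_at[OF c(4)[unfolded has_vector_derivative_def] this]
  have "(G \<circ> c has_derivative (\<lambda>t. t * (D x \<bullet> v))) (at 0)" by (simp add: o_def)
  then have "(G \<circ> c has_real_derivative (D x \<bullet> v)) (at 0)"
    by (simp add: has_field_derivative_def mult_commute_abs)
  moreover have "(G \<circ> c has_real_derivative 0) (at 0)"
  proof (rule has_field_derivative_transform_within_open)
    show "((\<lambda>t. 0) has_real_derivative 0) (at (0::real))" by simp
    show "open {- min \<epsilon> \<delta> <..< min \<epsilon> \<delta>}" "0 \<in> {- min \<epsilon> \<delta> <..< min \<epsilon> \<delta>}" using c(1) \<delta>(1) by auto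
    fix t assume t: "t \<in> {- min \<epsilon> \<delta> <..< min \<epsilon> \<delta>}"
    then have "c t \<in> ball p r" using \<delta>(2)[of t] c(2) x(2) by (cases "t = 0") auto
    moreover have "c t \<in> frontier \<Omega>" using c(3) t by auto
    ultimately show "0 = (G \<circ> c) t" using frontier_iff by simp
  qed
  ultimately show "v \<in> {v. D x \<bullet> v = 0}" using DERIV_unique by blast
qed

lemma sign_along_line:
  assumes x: "x \<in> ball p r" "G x = 0" and v: "D x \<bullet> v > 0"
  shows "\<exists>\<delta>>0. \<forall>t. 0 < t \<and> t < \<delta> \<longrightarrow> x + t *\<^sub>R v \<in> \<Omega> \<and> x - t *\<^sub>R v \<notin> closure \<Omega>"
proof -
  have d: "((\<lambda>t. G (x + t *\<^sub>R v)) has_real_derivative D x \<bullet> v) (at 0)"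
    using has_real_derivative_along_line[of G _ x 0 v] dG[of x] by simp
  obtain d1 where d1: "d1 > 0" "\<And>h. 0 < h \<Longrightarrow> h < d1 \<Longrightarrow> G (x + 0 *\<^sub>R v) < G (x + (0 + h) *\<^sub>R v)"
    using DERIV_pos_inc_right[OF d v] by blast
  obtain d2 where d2: "d2 > 0" "\<And>h. 0 < h \<Longrightarrow> h < d2 \<Longrightarrow> G (x + (0 - h) *\<^sub>R v) < G (x + 0 *\<^sub>R v)"
    using DERIV_pos_inc_left[OF d v] by blast
  obtain \<eta> where \<eta>: "\<eta> > 0" "ball x \<eta> \<subseteq> ball p r" using x(1) open_ball openE by blast
  have nv: "norm v > 0" using v by force
  define \<delta> where "\<delta> = min (min d1 d2) (\<eta> / norm v)"
  show ?thesis
  proof (intro exI[of _ \<delta>] conjI allI impI)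
    show "\<delta> > 0" using d1 d2 \<eta> nv by (simp add: \<delta>_def)
    fix t assume t: "0 < t \<and> t < \<delta>"
    then have "t * norm v < \<eta>" using nv by (simp add: \<delta>_def field_simps)
    then have b: "x + t *\<^sub>R v \<in> ball p r" "x - t *\<^sub>R v \<in> ball p r"
      using \<eta> t by (auto simp: subset_iff dist_norm)
    show "x + t *\<^sub>R v \<in> \<Omega>" using d1(2)[of t] t \<Omega>_iff[OF b(1)] x(2) by (simp add: \<delta>_def)
    show "x - t *\<^sub>R v \<notin> closure \<Omega>" using d2(2)[of t] t closure_iff[OF b(2)] x(2) by (simp add: \<delta>_def)
  qed
qed

lemma outer_normal_eq:
  assumes x: "x \<in> frontier \<Omega>" "x \<in> ball p r"
  shows "outer_normal \<Omega> x = - (inverse (norm (D x)) *\<^sub>R D x)"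
  unfolding outer_normal_def
proof (rule the_equality)
  have G0: "G x = 0" using frontier_iff x by simp
  have nD: "norm (D x) > 0" using D_nonzero by simp
  let ?w = "- (inverse (norm (D x)) *\<^sub>R D x)"
  have pos: "D x \<bullet> (- ?w) > 0" using D_nonzero[of x] by simp
  show "is_outer_unit_normal \<Omega> x ?w"
    unfolding is_outer_unit_normal_def tangent_space_frontier[OF x]
    using nD sign_along_line[OF x(2) G0 pos] by auto
  fix w assume w: "is_outer_unit_normal \<Omega> x w"
  define l where "l = (D x \<bullet> w) / (D x \<bullet> D x)"
  define v where "v = w - l *\<^sub>R D x"
  have Dv: "D x \<bullet> v = 0" using D_nonzero[of x] by (simp add: v_def l_def inner_diff_right)
  then have "w \<bullet> v = 0" using w unfolding is_outer_unit_normal_def tangent_space_frontier[OF x] by blast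
  then have "v \<bullet> v = 0" using Dv by (simp add: v_def inner_diff_left inner_diff_right inner_commute)
  then have wl: "w = l *\<^sub>R D x" by (simp add: v_def)
  have "\<bar>l\<bar> * norm (D x) = norm w" by (simp add: wl)
  also have "\<dots> = 1" using w by (simp add: is_outer_unit_normal_def)
  finally have l: "\<bar>l\<bar> = inverse (norm (D x))" using nD by (simp add: field_simps)
  have "l \<le> 0"
  proof (rule ccontr)
    assume "\<not> l \<le> 0"
    then have "D x \<bullet> w > 0" using D_nonzero[of x] by (simp add: wl)
    then obtain \<delta> where \<delta>: "\<delta> > 0" "\<And>t. 0 < t \<Longrightarrow> t < \<delta> \<Longrightarrow> x - t *\<^sub>R w \<notin> closure \<Omega>"
      using sign_along_line[OF x(2) G0] by blast
    obtain \<epsilon> where \<epsilon>: "\<epsilon> > 0" "\<And>t. t \<in> {0<..<\<epsilon>} \<Longrightarrow> x - t *\<^sub>R w \<in> \<Omega>"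
      using w unfolding is_outer_unit_normal_def by blast
    define t where "t = min \<delta> \<epsilon> / 2"
    have "0 < t" "t < \<delta>" "t < \<epsilon>" using \<delta> \<epsilon> by (auto simp: t_def)
    then show False using \<delta>(2)[of t] \<epsilon>(2)[of t] closure_subset[of \<Omega>] by auto
  qed
  then have "l = - inverse (norm (D x))" using l by simp
  then show "w = ?w" using wl by simp
qed

text \<open>
  The derivative of the normal within the boundary is determined on tangent vectors, and there the
  derivative of the normalising factor drops out because it multiplies the normal itself.
\<close>

lemma mean_curvature_eq:
  assumes x: "x \<in> frontier \<Omega>" "x \<in> ball p r"
  shows "mean_curvature \<Omega> x = level_curv (D x) (H x) / (real DIM('a) - 1)"
proof -
  let ?M = "frontier \<Omega>" and ?N = "outer_normal \<Omega>"
  let ?X = "\<lambda>y. - (inverse (norm (D y)) *\<^sub>R D y)"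
  have "(\<lambda>y. norm (D y)) differentiable (at x)"
    using differentiable_chain_at[of D x norm] differentiable_norm_at[OF D_nonzero[of x]] dD[of x]
    by (auto simp: o_def differentiable_def)
  then have "(\<lambda>y. inverse (norm (D y))) differentiable (at x)"
    using D_nonzero by (intro differentiable_inverse) auto
  then obtain i where i: "((\<lambda>y. inverse (norm (D y))) has_derivative i) (at x)"
    unfolding differentiable_def by blast
  define X' where "X' = (\<lambda>v. - (inverse (norm (D x)) *\<^sub>R H x v + i v *\<^sub>R D x))"
  have dX: "(?X has_derivative X') (at x within ?M)"
    unfolding X'_def
    by (rule has_derivative_at_withinI, rule has_derivative_minus, rule has_derivative_scaleR[OF i dD])
  obtain \<delta> where \<delta>: "\<delta> > 0" "ball x \<delta> \<subseteq> ball p r" using x(2) open_ball openE by blast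
  have dN: "(?N has_derivative X') (at x within ?M)"
    using dX \<delta>(1) x(1)
  proof (rule has_derivative_transform_within)
    fix y assume "y \<in> ?M" "dist y x < \<delta>"
    then show "?X y = ?N y" using outer_normal_eq[of y] \<delta>(2) by (auto simp: dist_commute subset_iff)
  qed
  then have "(?N has_derivative frechet_derivative ?N (at x within ?M)) (at x within ?M)"
    unfolding frechet_derivative_works[symmetric] differentiable_def by blast
  then have F: "frechet_derivative ?N (at x within ?M) v = X' v" if "v \<in> tangent_space ?M x" for v
    using has_derivative_within_tangent_unique dN that by blast
  have T: "tangent_space ?M x = {v. D x \<bullet> v = 0}" by (rule tangent_space_frontier[OF x])
  define B where "B = (SOME B. is_orthonormal_basis B (tangent_space ?M x))"
  have "\<exists>B. is_orthonormal_basis B (tangent_space ?M x)"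
    unfolding T using ex_orthonormal_basis_hyperplane[of "D x"] by blast
  then have B: "is_orthonormal_basis B (tangent_space ?M x)" unfolding B_def by (rule someI_ex)
  have "(\<Sum>\<tau>\<in>B. frechet_derivative ?N (at x within ?M) \<tau> \<bullet> \<tau>) = (\<Sum>\<tau>\<in>B. - ((H x \<tau> \<bullet> \<tau>) / norm (D x)))"
  proof (rule sum.cong)
    fix \<tau> assume "\<tau> \<in> B"
    then have t: "\<tau> \<in> tangent_space ?M x" using B span_base unfolding is_orthonormal_basis_def by blast
    then have "D x \<bullet> \<tau> = 0" by (simp add: T)
    then show "frechet_derivative ?N (at x within ?M) \<tau> \<bullet> \<tau> = - ((H x \<tau> \<bullet> \<tau>) / norm (D x))"
      by (simp add: F[OF t] X'_def inner_add_left inner_diff_left divide_inverse mult.commute)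
  qed simp
  also have "\<dots> = - level_curv (D x) (H x)"
    using level_curv_basis[OF linear_H D_nonzero B[unfolded T]] by (simp add: sum_negf sum_divide_distrib)
  finally show ?thesis
    by (simp add: mean_curvature_def surface_divergence_def B_def[symmetric])
qed

lemma quadratic_lower_bound:
  assumes "G x = 0"
  shows "\<exists>C>0. \<exists>\<delta>>0. \<forall>y. norm (y - x) < \<delta> \<longrightarrow> G y \<ge> D x \<bullet> (y - x) - C * (norm (y - x))\<^sup>2"
proof -
  obtain B where B: "\<And>v. norm (H x v) \<le> B * norm v" "B > 0"
    using bounded_linear.pos_bounded[OF has_derivative_bounded_linear[OF dD[of x]]] by (metis mult.commute)
  obtain \<delta> where \<delta>: "\<delta> > 0" "\<And>y. norm (y - x) < \<delta> \<Longrightarrow> norm (D y - D x - H x (y - x)) \<le> 1 * norm (y - x)"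
    using dD[of x] zero_less_one unfolding has_derivative_at_alt by blast
  have lip: "norm (D y - D x) \<le> (B + 1) * norm (y - x)" if "norm (y - x) < \<delta>" for y
    using \<delta>(2)[OF that] B(1)[of "y - x"] norm_triangle_ineq[of "D y - D x - H x (y - x)" "H x (y - x)"]
    by (simp add: algebra_simps)
  show ?thesis
  proof (rule exI[of _ "B + 1"], rule conjI, use B in simp, intro exI[of _ \<delta>] conjI allI impI \<delta>(1))
    fix y assume y: "norm (y - x) < \<delta>"
    define v where "v = y - x"
    have der: "((\<lambda>t. G (x + t *\<^sub>R v) - t * (D x \<bullet> v)) has_real_derivative (D (x + t *\<^sub>R v) \<bullet> v - D x \<bullet> v)) (at t)" for t
      by (intro DERIV_diff has_real_derivative_along_line dG) (auto intro!: derivative_eq_intros)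
    define \<phi> where "\<phi> t = G (x + t *\<^sub>R v) - t * (D x \<bullet> v)" for t
    have "(\<phi> has_real_derivative (D (x + t *\<^sub>R v) \<bullet> v - D x \<bullet> v)) (at t)" for t
      unfolding \<phi>_def by (rule der)
    then obtain z where z: "0 < z" "z < 1" "\<phi> 1 - \<phi> 0 = (1 - 0) * (D (x + z *\<^sub>R v) \<bullet> v - D x \<bullet> v)"
      using MVT2[of 0 1 \<phi> "\<lambda>t. D (x + t *\<^sub>R v) \<bullet> v - D x \<bullet> v"] by auto
    have zv: "norm (z *\<^sub>R v) \<le> norm v" using z by (simp add: mult_left_le_one_le)
    have "\<bar>(D (x + z *\<^sub>R v) - D x) \<bullet> v\<bar> \<le> norm (D (x + z *\<^sub>R v) - D x) * norm v"
      by (rule Cauchy_Schwarz_ineq2)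
    also have "\<dots> \<le> ((B + 1) * norm v) * norm v"
    proof (rule mult_right_mono)
      have "norm (D (x + z *\<^sub>R v) - D x) \<le> (B + 1) * norm (z *\<^sub>R v)"
        using lip[of "x + z *\<^sub>R v"] zv y by (simp add: v_def)
      also have "\<dots> \<le> (B + 1) * norm v" using zv B by (intro mult_left_mono) auto
      finally show "norm (D (x + z *\<^sub>R v) - D x) \<le> (B + 1) * norm v" .
    qed simp
    finally show "D x \<bullet> (y - x) - (B + 1) * (norm (y - x))\<^sup>2 \<le> G y"
      using z(3) assms by (simp add: \<phi>_def v_def inner_diff_left power2_eq_square mult.assoc)
  qed
qed

text \<open>
  In the ball of radius \<open>\<rho>\<close> that touches at \<open>x\<close>, a displacement \<open>v\<close> satisfies \<open>|v|\<^sup>2 \<le> 2 \<rho> (n \<bullet> v)\<close>.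
  For small \<open>\<rho>\<close> the linear part of \<open>G\<close> therefore dominates its quadratic remainder.
\<close>

lemma interior_ball:
  assumes x: "x \<in> ball p r" "G x = 0"
  defines "n \<equiv> inverse (norm (D x)) *\<^sub>R D x"
  shows "\<exists>\<rho>0>0. \<forall>\<rho>. 0 < \<rho> \<and> \<rho> \<le> \<rho>0 \<longrightarrow> cball (x + \<rho> *\<^sub>R n) \<rho> - {x} \<subseteq> \<Omega>"
proof -
  obtain C \<delta> where C: "C > 0" and \<delta>: "\<delta> > 0"
    "\<And>y. norm (y - x) < \<delta> \<Longrightarrow> G y \<ge> D x \<bullet> (y - x) - C * (norm (y - x))\<^sup>2"
    using quadratic_lower_bound[OF x(2)] by blast
  obtain \<eta> where \<eta>: "\<eta> > 0" "ball x \<eta> \<subseteq> ball p r" using x(1) open_ball openE by blast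
  have nD: "norm (D x) > 0" using D_nonzero by simp
  define \<rho>0 where "\<rho>0 = min (min \<delta> \<eta> / 4) (norm (D x) / (4 * C))"
  show ?thesis
  proof (intro exI[of _ \<rho>0] conjI allI impI subsetI)
    show "\<rho>0 > 0" using C \<delta> \<eta> nD by (simp add: \<rho>0_def)
    fix \<rho> y assume \<rho>: "0 < \<rho> \<and> \<rho> \<le> \<rho>0" and y: "y \<in> cball (x + \<rho> *\<^sub>R n) \<rho> - {x}"
    define v where "v = y - x"
    have v0: "v \<noteq> 0" using y by (simp add: v_def)
    have nn: "norm n = 1" using nD by (simp add: n_def)
    have "norm (v - \<rho> *\<^sub>R n) \<le> \<rho>" using y by (simp add: v_def dist_norm norm_minus_commute algebra_simps)
    then have "(norm (v - \<rho> *\<^sub>R n))\<^sup>2 \<le> \<rho>\<^sup>2" by (rule power_mono) simp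
    then have vv: "(norm v)\<^sup>2 \<le> 2 * \<rho> * (n \<bullet> v)"
      using nn unfolding power2_norm_eq_inner
      by (simp add: inner_diff_left inner_diff_right inner_commute norm_eq_1 power2_eq_square)
    have "norm v \<le> norm (v - \<rho> *\<^sub>R n) + norm (\<rho> *\<^sub>R n)" using norm_triangle_ineq[of "v - \<rho> *\<^sub>R n" "\<rho> *\<^sub>R n"] by simp
    also have "\<dots> \<le> 2 * \<rho>" using \<open>norm (v - \<rho> *\<^sub>R n) \<le> \<rho>\<close> nn \<rho> by simp
    also have "\<dots> < min \<delta> \<eta>" using \<rho> \<delta> \<eta> by (auto simp: \<rho>0_def)
    finally have small: "norm v < \<delta>" "norm v < \<eta>" by auto
    have Dv: "D x \<bullet> v = norm (D x) * (n \<bullet> v)" using nD by (simp add: n_def)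
    have nv: "n \<bullet> v > 0" using vv v0 \<rho> by (smt (verit) zero_less_norm_iff zero_less_power zero_less_mult_iff)
    have "C * (norm v)\<^sup>2 \<le> C * (2 * \<rho> * (n \<bullet> v))" using vv C by simp
    also have "\<dots> = (2 * C * \<rho>) * (n \<bullet> v)" by simp
    also have "\<dots> < norm (D x) * (n \<bullet> v)"
    proof -
      have "\<rho> \<le> norm (D x) / (4 * C)" using \<rho> by (simp add: \<rho>0_def)
      then have "2 * C * \<rho> \<le> norm (D x) / 2" using C by (simp add: field_simps)
      moreover have "0 < C * \<rho>" using C \<rho> by simp
      ultimately have "2 * C * \<rho> < norm (D x)" using nD by linarith
      then show ?thesis using nv by (rule mult_strict_right_mono)
    qed
    finally have "G y > 0" using \<delta>(2)[of y] small Dv by (simp add: v_def)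
    moreover have "y \<in> ball p r" using \<eta> small by (auto simp: v_def dist_norm norm_minus_commute)
    ultimately show "y \<in> \<Omega>" using \<Omega>_iff by simp
  qed
qed

end

lemma holder_boundary_chart:
  fixes \<Omega> :: "'a::euclidean_space set"
  assumes "open \<Omega>" and hb: "holder_boundary 4 \<alpha> \<Omega>" and p: "p \<in> frontier \<Omega>"
  shows "\<exists>r e G D H T. boundary_chart \<Omega> p r e G D H T"
proof -
  obtain r e g where r: "r > 0" and g: "g \<in> holder_space_closure 4 \<alpha> UNIV" and e: "norm e = 1"
    and \<Omega>: "\<Omega> \<inter> ball p r = {x \<in> ball p r. g (x - (x \<bullet> e) *\<^sub>R e) < x \<bullet> e}"
    using hb p unfolding holder_boundary_def by blast
  obtain D H T where C3: "thrice_differentiable g D H T"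
    using holder_space_thrice_differentiable[OF g] by blast
  define \<pi> where "\<pi> x = x - (x \<bullet> e) *\<^sub>R e" for x
  have ee: "e \<bullet> e = 1" using e by (simp add: norm_eq_1)
  have bl: "bounded_linear \<pi>" unfolding \<pi>_def[abs_def]
    by (intro bounded_linear_sub bounded_linear_ident bounded_linear_scaleR_const bounded_linear_inner_left)
  have d\<pi>: "(\<pi> has_derivative \<pi>) F" for F by (rule bounded_linear_imp_has_derivative[OF bl])
  have adj: "\<pi> x \<bullet> y = x \<bullet> \<pi> y" for x y
    by (simp add: \<pi>_def inner_diff_left inner_diff_right inner_commute)
  define G where "G x = x \<bullet> e - g (\<pi> x)" for x
  define D' where "D' x = e - \<pi> (D (\<pi> x))" for x
  define H' where "H' x v = - \<pi> (H (\<pi> x) (\<pi> v))" for x v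
  define T' where "T' x w v = - \<pi> (T (\<pi> x) (\<pi> w) (\<pi> v))" for x w v
  have dg: "(g has_derivative (\<lambda>v. D x \<bullet> v)) (at x)" and dD: "(D has_derivative H x) (at x)"
    and dH: "((\<lambda>x. H x k) has_derivative (\<lambda>v. T x v k)) (at x)" for x k
    using C3 unfolding thrice_differentiable_def by blast+
  have "(G has_derivative (\<lambda>v. D' x \<bullet> v)) (at x)" for x
  proof -
    have "((\<lambda>x. x \<bullet> e - g (\<pi> x)) has_derivative (\<lambda>v. v \<bullet> e - D (\<pi> x) \<bullet> \<pi> v)) (at x)"
      by (intro has_derivative_diff has_derivative_inner_left has_derivative_ident
          diff_chain_at[OF d\<pi> dg, unfolded o_def])
    moreover have "(\<lambda>v. v \<bullet> e - D (\<pi> x) \<bullet> \<pi> v) = (\<lambda>v. D' x \<bullet> v)"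
      by (auto simp: D'_def inner_diff_left inner_commute[of e] adj)
    ultimately show ?thesis unfolding G_def[abs_def] by simp
  qed
  moreover have "(D' has_derivative H' x) (at x)" for x
  proof -
    have "((\<lambda>x. e - \<pi> (D (\<pi> x))) has_derivative (\<lambda>v. 0 - \<pi> (H (\<pi> x) (\<pi> v)))) (at x)"
      by (intro has_derivative_diff has_derivative_const bounded_linear.has_derivative[OF bl]
          diff_chain_at[OF d\<pi> dD, unfolded o_def])
    then show ?thesis unfolding D'_def[abs_def] H'_def[abs_def] by simp
  qed
  moreover have "((\<lambda>x. H' x k) has_derivative (\<lambda>v. T' x v k)) (at x)" for x k
    unfolding H'_def T'_def
    by (intro has_derivative_minus bounded_linear.has_derivative[OF bl]
          diff_chain_at[OF d\<pi> dH, unfolded o_def])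
  ultimately have C3': "thrice_differentiable G D' H' T'" unfolding thrice_differentiable_def by blast
  have sh: "G (x + t *\<^sub>R e) = G x + t" for x t
  proof -
    have "\<pi> (x + t *\<^sub>R e) = \<pi> x" by (simp add: \<pi>_def inner_add_left ee algebra_simps)
    then show ?thesis by (simp add: G_def inner_add_left ee)
  qed
  have "x \<in> \<Omega> \<longleftrightarrow> G x > 0" if "x \<in> ball p r" for x
  proof -
    have "x \<in> \<Omega> \<longleftrightarrow> g (x - (x \<bullet> e) *\<^sub>R e) < x \<bullet> e" using \<Omega> that by blast
    then show ?thesis unfolding G_def \<pi>_def by simp
  qed
  then have "boundary_chart \<Omega> p r e G D' H' T'"
    by (intro boundary_chart.intro r e C3' sh assms(1))
  then show ?thesis by blast
qed

section \<open>Regularity up to the boundary\<close>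

lemma mean_value_on_segment:
  fixes f :: "'a::euclidean_space \<Rightarrow> real"
  assumes cont: "continuous_on C f" and inC: "\<And>t. 0 \<le> t \<Longrightarrow> t \<le> 1 \<Longrightarrow> a + t *\<^sub>R (b - a) \<in> C"
    and der: "\<And>t. 0 < t \<Longrightarrow> t < 1 \<Longrightarrow> (f has_derivative (\<lambda>v. F (a + t *\<^sub>R (b - a)) \<bullet> v)) (at (a + t *\<^sub>R (b - a)))"
    and bd: "\<And>t. 0 < t \<Longrightarrow> t < 1 \<Longrightarrow> norm (F (a + t *\<^sub>R (b - a)) - q) \<le> \<epsilon>"
  shows "\<bar>f b - f a - q \<bullet> (b - a)\<bar> \<le> \<epsilon> * norm (b - a)"
proof -
  define v where "v = b - a"
  define \<phi> where "\<phi> t = f (a + t *\<^sub>R v) - t * (q \<bullet> v)" for t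
  have "continuous_on {0..1} (\<lambda>t. f (a + t *\<^sub>R v))"
    by (rule continuous_on_compose2[OF cont]) (use inC in \<open>auto simp: v_def intro!: continuous_intros\<close>)
  then have c: "continuous_on {0..1} \<phi>" unfolding \<phi>_def by (intro continuous_intros)
  have d: "(\<phi> has_real_derivative (F (a + t *\<^sub>R v) \<bullet> v - q \<bullet> v)) (at t)" if "0 < t" "t < 1" for t
    unfolding \<phi>_def using der[OF that]
    by (intro DERIV_diff has_real_derivative_along_line) (auto simp: v_def intro!: derivative_eq_intros)
  then have "\<phi> differentiable (at t)" if "0 < t" "t < 1" for t
    using that real_differentiable_def by blast
  then obtain l z where z: "0 < z" "z < 1" "(\<phi> has_real_derivative l) (at z)" "\<phi> 1 - \<phi> 0 = (1 - 0) * l"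
    using MVT[OF zero_less_one c] by blast
  have "l = (F (a + z *\<^sub>R v) - q) \<bullet> v"
    using DERIV_unique[OF z(3) d[OF z(1,2)]] by (simp add: inner_diff_left)
  then have "f b - f a - q \<bullet> (b - a) = (F (a + z *\<^sub>R v) - q) \<bullet> v"
    using z(4) by (simp add: \<phi>_def v_def)
  also have "\<bar>\<dots>\<bar> \<le> norm (F (a + z *\<^sub>R v) - q) * norm v" by (rule Cauchy_Schwarz_ineq2)
  also have "\<dots> \<le> \<epsilon> * norm v" using bd[OF z(1,2)] by (intro mult_right_mono) (auto simp: v_def)
  finally show ?thesis by (simp add: v_def)
qed

lemma (in boundary_chart) G_locally_Lipschitz:
  shows "\<exists>B>0. \<exists>\<delta>>0. \<forall>y z. y \<in> ball x \<delta> \<and> z \<in> ball x \<delta> \<longrightarrow> \<bar>G y - G z\<bar> \<le> B * norm (y - z)"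
proof -
  have "\<forall>\<^sub>F y in at x. D y \<in> ball (D x) 1"
    using isCont_D[of x] unfolding isCont_def
    by (rule topological_tendstoD) auto
  then obtain \<delta> where \<delta>: "\<delta> > 0" "\<And>y. y \<noteq> x \<Longrightarrow> dist y x < \<delta> \<Longrightarrow> D y \<in> ball (D x) 1"
    unfolding eventually_at by blast
  have nD: "norm (D y) \<le> norm (D x) + 1" if y: "y \<in> ball x \<delta>" for y
  proof -
    have "dist (D x) (D y) < 1"
    proof (cases "y = x")
      case False
      then show ?thesis using \<delta>(2)[OF False] y by (simp add: dist_commute)
    qed simp
    then show ?thesis using norm_triangle_sub[of "D y" "D x"] by (simp add: dist_norm norm_minus_commute)
  qed
  show ?thesis
  proof (rule exI[of _ "norm (D x) + 1"], rule conjI, simp add: add_nonneg_pos, intro exI[of _ \<delta>] conjI allI impI \<delta>(1))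
    fix y z assume yz: "y \<in> ball x \<delta> \<and> z \<in> ball x \<delta>"
    have "norm (G y - G z) \<le> (norm (D x) + 1) * norm (y - z)"
    proof (rule differentiable_bound[of "ball x \<delta>" G "\<lambda>x v. D x \<bullet> v"])
      fix y assume y: "y \<in> ball x \<delta>"
      show "(G has_derivative (\<lambda>v. D y \<bullet> v)) (at y within ball x \<delta>)"
        using dG has_derivative_at_withinI by blast
      have "onorm (\<lambda>v. D y \<bullet> v) \<le> norm (D y)"
        by (rule onorm_bound) (auto simp: norm_cauchy_schwarz Cauchy_Schwarz_ineq2)
      then show "onorm (\<lambda>v. D y \<bullet> v) \<le> norm (D x) + 1" using nD[OF y] by simp
    qed (use yz in auto)
    then show "\<bar>G y - G z\<bar> \<le> (norm (D x) + 1) * norm (y - z)" by simp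
  qed
qed

text \<open>
  Near a boundary point the domain lies above a Lipschitz graph, so points of the closure are joined
  to \<open>p\<close> by paths inside the domain whose length is comparable to the distance. The mean value theorem
  along such a path turns a continuous extension of the gradient into a derivative.
\<close>

lemma (in boundary_chart) has_derivative_at_boundary:
  fixes f :: "'a \<Rightarrow> real"
  assumes p: "p \<in> frontier \<Omega>"
    and cf: "continuous_on (closure \<Omega>) f" and cF: "continuous_on (closure \<Omega>) F"
    and der: "\<And>x. x \<in> \<Omega> \<Longrightarrow> (f has_derivative (\<lambda>v. F x \<bullet> v)) (at x)"
  shows "(f has_derivative (\<lambda>v. F p \<bullet> v)) (at p within closure \<Omega>)"
  unfolding has_derivative_within_alt
proof (intro conjI allI impI)
  show "bounded_linear (\<lambda>v. F p \<bullet> v)" by (rule bounded_linear_inner_right)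
  fix \<epsilon> :: real assume \<epsilon>: "\<epsilon> > 0"
  have pb: "p \<in> ball p r" using r_pos by simp
  have Gp: "G p = 0" using frontier_iff[OF pb] p by simp
  have pcl: "p \<in> closure \<Omega>" using p by (simp add: frontier_def)
  obtain B \<delta>1 where B: "B > 0" and \<delta>1: "\<delta>1 > 0"
    and lip: "\<And>y z. y \<in> ball p \<delta>1 \<Longrightarrow> z \<in> ball p \<delta>1 \<Longrightarrow> \<bar>G y - G z\<bar> \<le> B * norm (y - z)"
    using G_locally_Lipschitz[of p] by blast
  \<comment> \<open>A lift by \<open>L\<close> times the distance, with \<open>L\<close> above the Lipschitz constant, clears the graph.\<close>
  define L where "L = B + 2"
  have L: "L > 2" using B by (simp add: L_def)
  define \<epsilon>' where "\<epsilon>' = \<epsilon> / (2 * L + 1)"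
  have \<epsilon>': "\<epsilon>' > 0" using \<epsilon> L by (simp add: \<epsilon>'_def)
  obtain \<delta>2 where \<delta>2: "\<delta>2 > 0" "\<And>z. z \<in> closure \<Omega> \<Longrightarrow> dist z p < \<delta>2 \<Longrightarrow> dist (F z) (F p) < \<epsilon>'"
    using cF pcl \<epsilon>' unfolding continuous_on_iff by blast
  define m where "m = min (min \<delta>1 \<delta>2) r"
  have m: "m > 0" using \<delta>1 \<delta>2 r_pos by (simp add: m_def)
  show "\<exists>d>0. \<forall>y\<in>closure \<Omega>. norm (y - p) < d \<longrightarrow> norm (f y - f p - F p \<bullet> (y - p)) \<le> \<epsilon> * norm (y - p)"
  proof (intro exI[of _ "m / (L + 1)"] conjI ballI impI)
    show "m / (L + 1) > 0" using m L by simp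
    fix y assume y: "y \<in> closure \<Omega>" and yp: "norm (y - p) < m / (L + 1)"
    define v where "v = y - p"
    define \<rho> where "\<rho> = L * norm v"
    show "norm (f y - f p - F p \<bullet> (y - p)) \<le> \<epsilon> * norm (y - p)"
    proof (cases "v = 0")
      case True
      then show ?thesis by (simp add: v_def)
    next
      case False
      then have \<rho>: "\<rho> > 0" using L by (simp add: \<rho>_def)
      have small: "(L + 1) * norm v < m" using yp L by (simp add: v_def field_simps)
      have near: "p + \<theta> *\<^sub>R v + \<tau> *\<^sub>R e \<in> ball p m" if "0 \<le> \<theta>" "\<theta> \<le> 1" "0 \<le> \<tau>" "\<tau> \<le> \<rho>" for \<theta> \<tau>
      proof -
        have "norm (\<theta> *\<^sub>R v + \<tau> *\<^sub>R e) \<le> \<theta> * norm v + \<tau>"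
          using norm_triangle_ineq[of "\<theta> *\<^sub>R v" "\<tau> *\<^sub>R e"] that norm_e by simp
        also have "\<dots> \<le> norm v + \<rho>" using that by (intro add_mono mult_left_le_one_le) auto
        also have "\<dots> < m" using small by (simp add: \<rho>_def algebra_simps)
        finally have "norm (\<theta> *\<^sub>R v + \<tau> *\<^sub>R e) < m" .
        moreover have "p - (p + \<theta> *\<^sub>R v + \<tau> *\<^sub>R e) = - (\<theta> *\<^sub>R v + \<tau> *\<^sub>R e)" by simp
        ultimately show ?thesis unfolding mem_ball dist_norm by (simp only: norm_minus_cancel)
      qed
      have mb: "ball p m \<subseteq> ball p r" "ball p m \<subseteq> ball p \<delta>1" by (auto simp: m_def)
      have inside: "p + \<theta> *\<^sub>R v + \<tau> *\<^sub>R e \<in> \<Omega>"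
        if "0 \<le> \<theta>" "\<theta> \<le> 1" "0 \<le> \<tau>" "\<tau> \<le> \<rho>" and pos: "G (p + \<theta> *\<^sub>R v) + \<tau> > 0" for \<theta> \<tau>
        using \<Omega>_iff[of "p + \<theta> *\<^sub>R v + \<tau> *\<^sub>R e"] near[OF that(1-4)] mb(1) pos by (auto simp: shift)
      have yb: "y \<in> ball p r" using near[of 1 0] \<rho> mb(1) by (auto simp: v_def)
      have Gy: "G (p + 1 *\<^sub>R v) \<ge> 0" using closure_iff[OF yb] y by (simp add: v_def)
      have G\<theta>: "G (p + \<theta> *\<^sub>R v) + \<rho> > 0" if \<theta>: "0 \<le> \<theta>" "\<theta> \<le> 1" for \<theta>
      proof -
        have "p + \<theta> *\<^sub>R v \<in> ball p m" using near[of \<theta> 0] \<theta> \<rho> by simp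
        then have "p + \<theta> *\<^sub>R v \<in> ball p \<delta>1" using mb(2) by blast
        then have "\<bar>G (p + \<theta> *\<^sub>R v) - G p\<bar> \<le> B * norm ((p + \<theta> *\<^sub>R v) - p)"
          using \<delta>1 by (intro lip) auto
        also have "\<dots> \<le> B * norm v" using \<theta> B by (simp add: mult_left_le_one_le)
        also have "\<dots> < \<rho>" using False by (simp add: \<rho>_def L_def algebra_simps add_pos_nonneg)
        finally show ?thesis using Gp by simp
      qed
      have Fb: "norm (F z - F p) \<le> \<epsilon>'" if "z \<in> \<Omega>" "z \<in> ball p m" for z
        using \<delta>2(2)[of z] that closure_subset[of \<Omega>] by (auto simp: m_def dist_norm norm_minus_commute subset_iff)
      \<comment> \<open>The path runs from \<open>p\<close> into the domain along \<open>e\<close>, then parallel to \<open>y - p\<close>, then back to \<open>y\<close>.\<close>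
      let ?p' = "p + \<rho> *\<^sub>R e" and ?y' = "y + \<rho> *\<^sub>R e"
      have seg: "\<bar>f b - f a - F p \<bullet> (b - a)\<bar> \<le> \<epsilon>' * norm (b - a)"
        if "\<And>t. 0 \<le> t \<Longrightarrow> t \<le> 1 \<Longrightarrow> a + t *\<^sub>R (b - a) \<in> closure \<Omega>"
          "\<And>t. 0 < t \<Longrightarrow> t < 1 \<Longrightarrow> a + t *\<^sub>R (b - a) \<in> \<Omega> \<inter> ball p m" for a b
        using that der Fb by (intro mean_value_on_segment[OF cf, where F = F]) auto
      have 1: "\<bar>f ?p' - f p - F p \<bullet> (?p' - p)\<bar> \<le> \<epsilon>' * norm (?p' - p)"
      proof (rule seg)
        have *: "p + t *\<^sub>R (?p' - p) \<in> \<Omega> \<inter> ball p m" if "0 < t" "t \<le> 1" for t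
          using inside[of 0 "t * \<rho>"] near[of 0 "t * \<rho>"] that \<rho> Gp by (simp add: mult_left_le_one_le)
        then show "p + t *\<^sub>R (?p' - p) \<in> \<Omega> \<inter> ball p m" if "0 < t" "t < 1" for t using that by simp
        show "p + t *\<^sub>R (?p' - p) \<in> closure \<Omega>" if "0 \<le> t" "t \<le> 1" for t
          using *[of t] that pcl closure_subset[of \<Omega>] by (cases "t = 0") auto
      qed
      have 2: "\<bar>f ?y' - f ?p' - F p \<bullet> (?y' - ?p')\<bar> \<le> \<epsilon>' * norm (?y' - ?p')"
      proof (rule seg)
        have *: "?p' + t *\<^sub>R (?y' - ?p') \<in> \<Omega> \<inter> ball p m" if "0 \<le> t" "t \<le> 1" for t
          using inside[of t \<rho>] near[of t \<rho>] that \<rho> G\<theta>[of t] by (simp add: v_def algebra_simps)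
        then show "?p' + t *\<^sub>R (?y' - ?p') \<in> \<Omega> \<inter> ball p m" if "0 < t" "t < 1" for t using that by simp
        show "?p' + t *\<^sub>R (?y' - ?p') \<in> closure \<Omega>" if "0 \<le> t" "t \<le> 1" for t
          using *[of t] that closure_subset[of \<Omega>] by auto
      qed
      have 3: "\<bar>f ?y' - f y - F p \<bullet> (?y' - y)\<bar> \<le> \<epsilon>' * norm (?y' - y)"
      proof (rule seg)
        have *: "y + t *\<^sub>R (?y' - y) \<in> \<Omega> \<inter> ball p m" if "0 < t" "t \<le> 1" for t
          using inside[of 1 "t * \<rho>"] near[of 1 "t * \<rho>"] that \<rho> Gy
          by (simp add: mult_left_le_one_le v_def add_nonneg_pos)
        then show "y + t *\<^sub>R (?y' - y) \<in> \<Omega> \<inter> ball p m" if "0 < t" "t < 1" for t using that by simp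
        show "y + t *\<^sub>R (?y' - y) \<in> closure \<Omega>" if "0 \<le> t" "t \<le> 1" for t
          using *[of t] that y closure_subset[of \<Omega>] by (cases "t = 0") auto
      qed
      have "f y - f p - F p \<bullet> (y - p) = (f ?p' - f p - F p \<bullet> (?p' - p)) + (f ?y' - f ?p' - F p \<bullet> (?y' - ?p'))
          - (f ?y' - f y - F p \<bullet> (?y' - y))"
        by (simp add: inner_diff_right inner_add_right)
      then have "\<bar>f y - f p - F p \<bullet> (y - p)\<bar> \<le> \<epsilon>' * norm (?p' - p) + \<epsilon>' * norm (?y' - ?p') + \<epsilon>' * norm (?y' - y)"
        using 1 2 3 by linarith
      also have "\<dots> = \<epsilon>' * ((2 * L + 1) * norm v)"
        using \<rho> norm_e by (simp add: v_def \<rho>_def algebra_simps)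
      also have "\<dots> = \<epsilon> * norm v" using L by (simp add: \<epsilon>'_def)
      finally show ?thesis by (simp add: v_def)
    qed
  qed
qed

lemma has_derivative_up_to_boundary:
  fixes f :: "'a::euclidean_space \<Rightarrow> real"
  assumes op: "open \<Omega>" and hb: "holder_boundary 4 \<alpha> \<Omega>"
    and cf: "continuous_on (closure \<Omega>) f" and cF: "continuous_on (closure \<Omega>) F"
    and der: "\<And>x. x \<in> \<Omega> \<Longrightarrow> (f has_derivative (\<lambda>v. F x \<bullet> v)) (at x)"
    and x: "x \<in> closure \<Omega>"
  shows "(f has_derivative (\<lambda>v. F x \<bullet> v)) (at x within closure \<Omega>)"
proof (cases "x \<in> \<Omega>")
  case True
  then show ?thesis using der has_derivative_at_withinI by blast
next
  case False
  then have fr: "x \<in> frontier \<Omega>" using x op by (simp add: frontier_def interior_open)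
  then obtain r e G D H T where "boundary_chart \<Omega> x r e G D H T"
    using holder_boundary_chart[OF op hb] by blast
  then show ?thesis using boundary_chart.has_derivative_at_boundary fr cf cF der by blast
qed

lemma holder_space_grad_hess:
  fixes u :: "'a::euclidean_space \<Rightarrow> real"
  assumes op: "open \<Omega>" and hb: "holder_boundary 4 \<alpha> \<Omega>" and u: "u \<in> holder_space_closure 4 \<alpha> \<Omega>"
  shows "\<exists>P X. grad_hess (closure \<Omega>) u P X \<and> (\<forall>k. continuous_on (closure \<Omega>) (\<lambda>x. X x k))"
proof -
  have dif: "iter_partial bs u differentiable (at x)" if "bs \<in> lists Basis" "length bs < 4" "x \<in> \<Omega>" for bs x
    using u that unfolding holder_space_closure_def by blast
  have "\<forall>bs. bs \<in> lists Basis \<and> length bs \<le> 4 \<longrightarrow> (\<exists>g. continuous_on (closure \<Omega>) g \<and> (\<forall>x\<in>\<Omega>. g x = iter_partial bs u x))"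
    using u unfolding holder_space_closure_def by blast
  then obtain E where E: "\<And>bs. bs \<in> lists Basis \<Longrightarrow> length bs \<le> 4 \<Longrightarrow> continuous_on (closure \<Omega>) (E bs)"
      "\<And>bs x. bs \<in> lists Basis \<Longrightarrow> length bs \<le> 4 \<Longrightarrow> x \<in> \<Omega> \<Longrightarrow> E bs x = iter_partial bs u x"
    by metis
  have cu: "continuous_on (closure \<Omega>) u" using u unfolding holder_space_closure_def by blast
  define F where "F bs x = (\<Sum>b\<in>Basis. E (b # bs) x *\<^sub>R b)" for bs x
  have cF: "continuous_on (closure \<Omega>) (F bs)" if "bs \<in> lists Basis" "length bs < 4" for bs
    unfolding F_def[abs_def] using that by (intro continuous_intros E) auto
  have FG: "F bs x = gradient (iter_partial bs u) x" if "bs \<in> lists Basis" "length bs < 4" "x \<in> \<Omega>" for bs x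
    unfolding F_def gradient_def using that by (intro sum.cong) (auto simp: E(2))
  have dI: "(iter_partial bs u has_derivative (\<lambda>v. F bs x \<bullet> v)) (at x)"
    if "bs \<in> lists Basis" "length bs < 4" "x \<in> \<Omega>" for bs x
    using has_derivative_gradient[OF dif[OF that]] FG[OF that] by simp
  have dE: "(E bs has_derivative (\<lambda>v. F bs x \<bullet> v)) (at x)"
    if bs: "bs \<in> lists Basis" "length bs < 4" "x \<in> \<Omega>" for bs x
    using dI[OF bs] op bs(3)
    by (rule has_derivative_transform_within_open) (use E(2)[OF bs(1)] bs(2) in simp)
  have du: "(u has_derivative (\<lambda>v. F [] x \<bullet> v)) (at x within closure \<Omega>)" if "x \<in> closure \<Omega>" for x
    by (rule has_derivative_up_to_boundary[OF op hb cu cF _ that]) (use dI[of "[]"] in auto)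
  define X where "X x v = (\<Sum>b\<in>Basis. (F [b] x \<bullet> v) *\<^sub>R b)" for x v
  have dF: "(F [] has_derivative X x) (at x within closure \<Omega>)" if x: "x \<in> closure \<Omega>" for x
  proof -
    have "(E [b] has_derivative (\<lambda>v. F [b] x \<bullet> v)) (at x within closure \<Omega>)" if "b \<in> Basis" for b
      by (rule has_derivative_up_to_boundary[OF op hb _ cF _ x]) (use that E(1) dE in auto)
    then show ?thesis unfolding F_def[of "[]", abs_def] X_def[abs_def]
      by (intro has_derivative_sum has_derivative_scaleR_left)
  qed
  have "continuous_on (closure \<Omega>) (\<lambda>x. X x k)" for k
    unfolding X_def using cF by (intro continuous_intros) auto
  then show ?thesis unfolding grad_hess_def using du dF by blast
qed

lemma translator_equation_ell:
  fixes u :: "'a::euclidean_space \<Rightarrow> real"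
  assumes op: "open \<Omega>" and gh: "grad_hess \<Omega> u P X" and x: "x \<in> \<Omega>"
    and eq: "- divergence (\<lambda>y. gradient u y /\<^sub>R sqrt (1 + (norm (gradient u y))\<^sup>2)) x
        = 1 / sqrt (1 + (norm (gradient u x))\<^sup>2)"
  shows "ell (P x) (X x) = - (1 + P x \<bullet> P x)"
proof -
  have grad: "gradient u y = P y" if "y \<in> \<Omega>" for y
  proof -
    have d: "(u has_derivative (\<lambda>v. P y \<bullet> v)) (at y)" using grad_hess_openD(1)[OF gh that op] .
    then have "frechet_derivative u (at y) = (\<lambda>v. P y \<bullet> v)" by (rule frechet_derivative_at[symmetric])
    then show ?thesis by (simp add: gradient_def euclidean_representation)
  qed
  define W where "W = sqrt (1 + P x \<bullet> P x)"
  have W2: "W\<^sup>2 = 1 + P x \<bullet> P x" unfolding W_def by (rule real_sqrt_pow2) simp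
  have W: "W > 0" unfolding W_def by (simp add: add_pos_nonneg)
  have dP: "(P has_derivative X x) (at x)" using grad_hess_openD(2)[OF gh x op] .
  have lin: "linear (X x)" using dP by (rule has_derivative_linear)
  have "((\<lambda>y. P y \<bullet> P y) has_derivative (\<lambda>v. P x \<bullet> X x v + X x v \<bullet> P x)) (at x)"
    by (rule has_derivative_inner[OF dP dP])
  moreover have "((\<lambda>z. inverse (sqrt (1 + z))) has_real_derivative (- 1 / (2 * W^3))) (at (P x \<bullet> P x))"
    using W W2
    by (auto intro!: derivative_eq_intros simp: W_def[symmetric] add_pos_nonneg field_simps power2_eq_square power3_eq_cube)
      (use inner_ge_zero[of "P x"] in linarith)
  ultimately have "((\<lambda>y. inverse (sqrt (1 + P y \<bullet> P y))) has_derivative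
      (\<lambda>v. (P x \<bullet> X x v + X x v \<bullet> P x) * (- 1 / (2 * W^3)))) (at x)"
    by (intro DERIV_compose_FDERIV[where f = "\<lambda>z. inverse (sqrt (1 + z))"])
  from has_derivative_scaleR[OF this dP]
  have "((\<lambda>y. P y /\<^sub>R sqrt (1 + (norm (P y))\<^sup>2)) has_derivative
      (\<lambda>v. inverse W *\<^sub>R X x v - ((X x v \<bullet> P x) / W^3) *\<^sub>R P x)) (at x)"
    by (simp add: W_def power2_norm_eq_inner inner_commute)
  then have "((\<lambda>y. gradient u y /\<^sub>R sqrt (1 + (norm (gradient u y))\<^sup>2)) has_derivative
      (\<lambda>v. inverse W *\<^sub>R X x v - ((X x v \<bullet> P x) / W^3) *\<^sub>R P x)) (at x)"
    using op x by (rule has_derivative_transform_within_open) (simp add: grad)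
  then have fr: "frechet_derivative (\<lambda>y. gradient u y /\<^sub>R sqrt (1 + (norm (gradient u y))\<^sup>2)) (at x)
      = (\<lambda>v. inverse W *\<^sub>R X x v - ((X x v \<bullet> P x) / W^3) *\<^sub>R P x)"
    by (rule frechet_derivative_at[symmetric])
  have sum: "(\<Sum>b\<in>Basis. (X x b \<bullet> P x) * (P x \<bullet> b)) = X x (P x) \<bullet> P x"
  proof -
    have "X x (P x) = X x (\<Sum>b\<in>Basis. (P x \<bullet> b) *\<^sub>R b)" by (simp add: euclidean_representation)
    then show ?thesis
      by (simp add: linear_sum[OF lin] linear_cmul[OF lin] inner_sum_left mult.commute)
  qed
  have "divergence (\<lambda>y. gradient u y /\<^sub>R sqrt (1 + (norm (gradient u y))\<^sup>2)) x
      = inverse W * trace_form (X x) - (\<Sum>b\<in>Basis. (X x b \<bullet> P x) * (P x \<bullet> b)) / W^3"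
    unfolding divergence_def fr trace_form_def
    by (simp add: inner_diff_left sum_subtractf sum_distrib_left sum_divide_distrib)
  then have "- (inverse W * trace_form (X x) - (X x (P x) \<bullet> P x) / W^3) = 1 / W"
    using eq grad[OF x] unfolding sum by (simp add: W_def power2_norm_eq_inner)
  then have "inverse W * trace_form (X x) - (X x (P x) \<bullet> P x) / W^3 = - 1 / W" by linarith
  then have "W^3 * (inverse W * trace_form (X x) - (X x (P x) \<bullet> P x) / W^3) = W^3 * (- 1 / W)"
    by (rule arg_cong)
  moreover have "W^3 * (inverse W * t - q / W^3) = W\<^sup>2 * t - q" for t q
    using W by (simp add: field_simps power2_eq_square power3_eq_cube)
  moreover have "W^3 * (- 1 / W) = - W\<^sup>2"
    using W by (simp add: power2_eq_square power3_eq_cube)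
  ultimately have "W\<^sup>2 * trace_form (X x) - X x (P x) \<bullet> P x = - W\<^sup>2" by simp
  then show ?thesis unfolding ell_def W2 .
qed

section \<open>Reflections\<close>

definition refl0 :: "'a::euclidean_space \<Rightarrow> 'a \<Rightarrow> 'a" where
  "refl0 e v = v - (2 * (v \<bullet> e)) *\<^sub>R e"

definition refl :: "'a::euclidean_space \<Rightarrow> real \<Rightarrow> 'a \<Rightarrow> 'a" where
  "refl e l x = x - (2 * (x \<bullet> e - l)) *\<^sub>R e"

lemma refl_diff: "refl e l x - refl e l y = refl0 e (x - y)"
  by (simp add: refl_def refl0_def inner_diff_left algebra_simps)

lemma linear_refl0: "linear (refl0 e)"
  by (intro linearI) (simp_all add: refl0_def inner_add_left algebra_simps)

lemma bounded_linear_refl0: "bounded_linear (refl0 e)"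
  by (rule linear_conv_bounded_linear[THEN iffD1, OF linear_refl0])

lemma refl0_adjoint: "refl0 e v \<bullet> w = v \<bullet> refl0 e w"
  by (simp add: refl0_def inner_diff_left inner_diff_right inner_commute)

lemma refl_on_plane: "x \<bullet> e = l \<Longrightarrow> refl e l x = x"
  by (simp add: refl_def)

context
  fixes e :: "'a::euclidean_space"
  assumes e: "norm e = 1"
begin

lemma refl0_invol [simp]: "refl0 e (refl0 e v) = v"
  using e by (simp add: refl0_def inner_diff_left norm_eq_1 algebra_simps)

lemma refl0_inner [simp]: "refl0 e v \<bullet> refl0 e w = v \<bullet> w"
  by (simp add: refl0_adjoint)

lemma refl_invol [simp]: "refl e l (refl e l x) = x"
  using e by (simp add: refl_def inner_diff_left norm_eq_1 algebra_simps)

lemma refl_inner: "refl e l x \<bullet> e = 2 * l - x \<bullet> e"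
  using e by (simp add: refl_def inner_diff_left norm_eq_1 algebra_simps)

lemma orthogonal_refl0: "orthogonal_transformation (refl0 e)"
  by (simp add: orthogonal_transformation_def linear_refl0)

lemma norm_refl0 [simp]: "norm (refl0 e v) = norm v"
  using orthogonal_refl0 by (rule orthogonal_transformation_norm)

lemma dist_refl [simp]: "dist (refl e l x) (refl e l y) = dist x y"
  by (simp add: dist_norm refl_diff)

end

lemma has_derivative_refl: "(refl e l has_derivative refl0 e) F"
  unfolding refl_def[abs_def] refl0_def[abs_def]
  by (rule has_derivative_eq_rhs, (rule derivative_intros)+) (auto simp: algebra_simps)

lemma continuous_on_refl: "continuous_on S (refl e l)"
  unfolding refl_def[abs_def] by (intro continuous_intros)

lemma refl_line: "refl e l (x + t *\<^sub>R v) = refl e l x + t *\<^sub>R refl0 e v"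
  by (simp add: refl_def refl0_def inner_add_left algebra_simps)

lemma has_derivative_comp_refl:
  assumes "(f has_derivative f') (at (refl e l x))"
  shows "((\<lambda>x. f (refl e l x)) has_derivative (\<lambda>v. f' (refl0 e v))) (at x)"
  using diff_chain_at[OF has_derivative_refl assms] by (simp add: o_def)

text \<open>
  The preimage of \<open>\<Omega>\<close> under a reflection again has a chart, so that a domain and its mirror image can
  be compared on an equal footing.
\<close>

lemma boundary_chart_refl:
  assumes "boundary_chart \<Omega> p r k G D H T" and e: "norm e = 1"
  shows "boundary_chart (refl e l -` \<Omega>) (refl e l p) r (refl0 e k) (\<lambda>x. G (refl e l x)) (\<lambda>x. refl0 e (D (refl e l x)))
    (\<lambda>x v. refl0 e (H (refl e l x) (refl0 e v))) (\<lambda>x w v. refl0 e (T (refl e l x) (refl0 e w) (refl0 e v)))"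
proof -
  interpret boundary_chart \<Omega> p r k G D H T by fact
  show ?thesis
  proof
    show "thrice_differentiable (\<lambda>x. G (refl e l x)) (\<lambda>x. refl0 e (D (refl e l x)))
     (\<lambda>x v. refl0 e (H (refl e l x) (refl0 e v))) (\<lambda>x w v. refl0 e (T (refl e l x) (refl0 e w) (refl0 e v)))"
      unfolding thrice_differentiable_def
    proof (intro conjI allI)
      show "((\<lambda>x. G (refl e l x)) has_derivative (\<lambda>v. refl0 e (D (refl e l x)) \<bullet> v)) (at x)" for x
        using has_derivative_comp_refl[OF dG] by (simp add: refl0_adjoint)
      show "((\<lambda>x. refl0 e (D (refl e l x))) has_derivative (\<lambda>v. refl0 e (H (refl e l x) (refl0 e v)))) (at x)" for x
        by (rule bounded_linear.has_derivative[OF bounded_linear_refl0 has_derivative_comp_refl[OF dD]])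
      show "((\<lambda>x. refl0 e (H (refl e l x) (refl0 e k))) has_derivative
          (\<lambda>v. refl0 e (T (refl e l x) (refl0 e v) (refl0 e k)))) (at x)" for x k
        by (rule bounded_linear.has_derivative[OF bounded_linear_refl0 has_derivative_comp_refl[OF dH]])
    qed
    show "G (refl e l (x + t *\<^sub>R refl0 e k)) = G (refl e l x) + t" for x t
      by (simp add: refl_line shift e)
    show "x \<in> refl e l -` \<Omega> \<longleftrightarrow> 0 < G (refl e l x)" if "x \<in> ball (refl e l p) r" for x
    proof -
      have "dist p (refl e l x) = dist (refl e l p) x"
        using dist_refl[OF e, of l "refl e l p" x] by (simp add: refl_invol[OF e])
      then have "refl e l x \<in> ball p r" using that by simp
      then show ?thesis using \<Omega>_iff by simp
    qed
    show "open (refl e l -` \<Omega>)"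
      using open_\<Omega> continuous_on_refl[of UNIV e l] by (simp add: continuous_on_open_vimage)
  qed (use r_pos norm_e e in auto)
qed

lemma level_curv_refl:
  assumes e: "norm e = 1" and lin: "linear L"
  shows "level_curv (refl0 e p) (\<lambda>v. refl0 e (L (refl0 e v))) = level_curv p L"
  using trace_form_conj[OF lin orthogonal_refl0[OF e]] e by (simp add: level_curv_def)

section \<open>Comparison of curvatures at an interior contact point\<close>

lemma increase_of_positive_second_derivative:
  fixes \<phi> \<psi> :: "real \<Rightarrow> real"
  assumes der: "\<And>t. (\<phi> has_real_derivative \<psi> t) (at t)"
    and "\<psi> 0 = 0" and "(\<psi> has_real_derivative d) (at 0)" and "d > 0"
  shows "\<exists>\<delta>>0. \<forall>t. 0 < t \<and> t < \<delta> \<longrightarrow> \<phi> 0 < \<phi> t"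
proof -
  have "((\<lambda>t. - \<psi> t) has_real_derivative - d) (at 0 within {0..})"
    using DERIV_minus[OF assms(3)] by (rule has_field_derivative_at_within)
  then obtain \<delta> where \<delta>: "\<delta> > 0" "\<And>t. 0 < t \<Longrightarrow> t < \<delta> \<Longrightarrow> - \<psi> t < 0 * t"
    using real_function_at_right_less[of "\<lambda>t. - \<psi> t" "- d" 0] assms(2,4) by auto
  have "\<phi> 0 < \<phi> t" if t: "0 < t" "t < \<delta>" for t
  proof -
    obtain z where z: "0 < z" "z < t" "\<phi> t - \<phi> 0 = (t - 0) * \<psi> z"
      using MVT2[of 0 t \<phi> \<psi>] der t by blast
    then have "t * \<psi> z > 0" using \<delta>(2)[of z] t by simp
    then show ?thesis using z by simp
  qed
  then show ?thesis using \<delta>(1) by blast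
qed

lemma increase_along_parabola:
  fixes f :: "'a::euclidean_space \<Rightarrow> real"
  assumes df: "\<And>x. (f has_derivative (\<lambda>v. D x \<bullet> v)) (at x)" and dD: "(D has_derivative L) (at x)"
    and "D x \<bullet> v = 0" and pos: "L v \<bullet> v + 2 * (D x \<bullet> w) > 0"
  shows "\<exists>\<delta>>0. \<forall>t. 0 < t \<and> t < \<delta> \<longrightarrow> f x < f (x + t *\<^sub>R v + t\<^sup>2 *\<^sub>R w)"
proof -
  define c where "c t = x + t *\<^sub>R v + t\<^sup>2 *\<^sub>R w" for t
  have dc: "(c has_derivative (\<lambda>h. h *\<^sub>R (v + (2 * t) *\<^sub>R w))) (at t)" for t
    unfolding c_def[abs_def] by (auto intro!: derivative_eq_intros simp: algebra_simps)
  define \<phi> where "\<phi> t = f (c t)" for t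
  define \<psi> where "\<psi> t = D (c t) \<bullet> (v + (2 * t) *\<^sub>R w)" for t
  have "(\<phi> has_real_derivative \<psi> t) (at t)" for t
    using diff_chain_at[OF dc df, of t]
    by (simp add: \<phi>_def[abs_def] \<psi>_def o_def has_field_derivative_def mult_commute_abs)
  moreover have "\<psi> 0 = 0" using assms(3) by (simp add: \<psi>_def c_def)
  moreover have "(\<psi> has_real_derivative (L v \<bullet> v + 2 * (D x \<bullet> w))) (at 0)"
  proof -
    have "((\<lambda>t. D (c t)) has_derivative (\<lambda>h. L (h *\<^sub>R v))) (at 0)"
      using diff_chain_at[OF dc[of 0], of D L] dD by (simp add: o_def c_def)
    moreover have "((\<lambda>t. v + (2 * t) *\<^sub>R w) has_derivative (\<lambda>h. (2 * h) *\<^sub>R w)) (at 0)"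
      by (auto intro!: derivative_eq_intros)
    ultimately have "((\<lambda>t. D (c t) \<bullet> (v + (2 * t) *\<^sub>R w)) has_derivative
        (\<lambda>h. D (c 0) \<bullet> ((2 * h) *\<^sub>R w) + L (h *\<^sub>R v) \<bullet> (v + (2 * 0) *\<^sub>R w))) (at 0)"
      by (rule has_derivative_inner)
    moreover have "(\<lambda>h. D (c 0) \<bullet> ((2 * h) *\<^sub>R w) + L (h *\<^sub>R v) \<bullet> (v + (2 * 0) *\<^sub>R w)) = (*) (L v \<bullet> v + 2 * (D x \<bullet> w))"
      using linear_cmul[OF has_derivative_linear[OF dD]] by (auto simp: c_def algebra_simps)
    ultimately show ?thesis by (simp only: \<psi>_def[abs_def] has_field_derivative_def)
  qed
  ultimately show ?thesis
    using increase_of_positive_second_derivative[of \<phi> \<psi> "L v \<bullet> v + 2 * (D x \<bullet> w)"] pos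
    by (simp add: \<phi>_def c_def)
qed

lemma (in boundary_chart) chart_above_parabola:
  assumes x: "x \<in> ball p r" "G x = 0" and "D x \<bullet> v = 0"
  shows "H x v \<bullet> v + 2 * (D x \<bullet> w) > 0 \<Longrightarrow> \<exists>\<delta>>0. \<forall>t. 0 < t \<and> t < \<delta> \<longrightarrow> 0 < G (x + t *\<^sub>R v + t\<^sup>2 *\<^sub>R w)"
    and "H x v \<bullet> v + 2 * (D x \<bullet> w) < 0 \<Longrightarrow> \<exists>\<delta>>0. \<forall>t. 0 < t \<and> t < \<delta> \<longrightarrow> G (x + t *\<^sub>R v + t\<^sup>2 *\<^sub>R w) < 0"
proof -
  show "\<exists>\<delta>>0. \<forall>t. 0 < t \<and> t < \<delta> \<longrightarrow> 0 < G (x + t *\<^sub>R v + t\<^sup>2 *\<^sub>R w)" if "H x v \<bullet> v + 2 * (D x \<bullet> w) > 0"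
    using increase_along_parabola[OF dG dD assms(3) that] x(2) by simp
  assume neg: "H x v \<bullet> v + 2 * (D x \<bullet> w) < 0"
  have "((\<lambda>x. - G x) has_derivative (\<lambda>v. (- D x) \<bullet> v)) (at x)" for x
    using has_derivative_minus[OF dG] by simp
  moreover have "((\<lambda>x. - D x) has_derivative (\<lambda>v. - H x v)) (at x)" by (intro has_derivative_minus dD)
  ultimately show "\<exists>\<delta>>0. \<forall>t. 0 < t \<and> t < \<delta> \<longrightarrow> G (x + t *\<^sub>R v + t\<^sup>2 *\<^sub>R w) < 0"
    using increase_along_parabola[of "\<lambda>x. - G x" "\<lambda>x. - D x" "\<lambda>v. - H x v" x v w] assms(3) neg x(2) by simp
qed

lemma parabola_in_ball:
  fixes x :: "'a::euclidean_space"
  assumes "\<delta> > 0"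
  shows "\<exists>\<eta>>0. \<forall>t. 0 < t \<and> t < \<eta> \<longrightarrow> x + t *\<^sub>R v + t\<^sup>2 *\<^sub>R w \<in> ball x \<delta>"
proof -
  have "isCont (\<lambda>t. x + t *\<^sub>R v + t\<^sup>2 *\<^sub>R w) 0" by (intro continuous_intros)
  then have "((\<lambda>t. x + t *\<^sub>R v + t\<^sup>2 *\<^sub>R w) \<longlongrightarrow> x) (at 0)" by (simp add: isCont_def)
  then have "\<forall>\<^sub>F t in at 0. x + t *\<^sub>R v + t\<^sup>2 *\<^sub>R w \<in> ball x \<delta>"
    by (rule topological_tendstoD) (use assms in auto)
  then show ?thesis unfolding eventually_at by (auto simp: dist_real_def)
qed

text \<open>
  A parabola that touches at \<open>y\<close> and is bent slightly further inwards than \<open>\<partial>\<Omega>2\<close> runs inside \<open>\<Omega>2\<close>,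
  hence inside \<open>\<Omega>1\<close>, so \<open>\<partial>\<Omega>1\<close> is not bent inwards more than this parabola. This orders the normal curvatures in every tangential
  direction, and their sums.
\<close>

lemma tangency_comparison:
  assumes c1: "boundary_chart \<Omega>1 y r1 e1 G1 D1 H1 T1" and c2: "boundary_chart \<Omega>2 y r2 e2 G2 D2 H2 T2"
    and y: "G1 y = 0" "G2 y = 0"
    and incl: "\<delta> > 0" "\<And>z. z \<in> ball y \<delta> \<Longrightarrow> z \<in> \<Omega>2 \<Longrightarrow> z \<in> \<Omega>1"
  shows "D1 y /\<^sub>R norm (D1 y) = D2 y /\<^sub>R norm (D2 y)"
    and "level_curv (D2 y) (H2 y) \<le> level_curv (D1 y) (H1 y)"
proof -
  interpret c1: boundary_chart \<Omega>1 y r1 e1 G1 D1 H1 T1 by fact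
  interpret c2: boundary_chart \<Omega>2 y r2 e2 G2 D2 H2 T2 by fact
  have yb: "y \<in> ball y r1" "y \<in> ball y r2" using c1.r_pos c2.r_pos by auto
  have d1: "norm (D1 y) > 0" and d2: "norm (D2 y) > 0" using c1.D_nonzero c2.D_nonzero by auto
  have half: "D1 y \<bullet> v \<ge> 0" if v: "D2 y \<bullet> v > 0" for v
  proof (rule ccontr)
    assume "\<not> D1 y \<bullet> v \<ge> 0"
    then have "D1 y \<bullet> (- v) > 0" by simp
    then obtain \<delta>1 where \<delta>1: "\<delta>1 > 0" "\<And>t. 0 < t \<Longrightarrow> t < \<delta>1 \<Longrightarrow> y - t *\<^sub>R (- v) \<notin> closure \<Omega>1"
      using c1.sign_along_line[OF yb(1) y(1)] by blast
    obtain \<delta>2 where \<delta>2: "\<delta>2 > 0" "\<And>t. 0 < t \<Longrightarrow> t < \<delta>2 \<Longrightarrow> y + t *\<^sub>R v \<in> \<Omega>2"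
      using c2.sign_along_line[OF yb(2) y(2) v] by blast
    obtain \<delta>3 where \<delta>3: "\<delta>3 > 0" "\<And>t. 0 < t \<Longrightarrow> t < \<delta>3 \<Longrightarrow> y + t *\<^sub>R v \<in> ball y \<delta>"
      using parabola_in_ball[OF incl(1), of y v 0] by auto
    define t where "t = min \<delta>1 (min \<delta>2 \<delta>3) / 2"
    have t: "0 < t" "t < \<delta>1" "t < \<delta>2" "t < \<delta>3" using \<delta>1 \<delta>2 \<delta>3 by (auto simp: t_def)
    have "y + t *\<^sub>R v \<in> \<Omega>1" using incl(2) \<delta>2 \<delta>3 t by blast
    then show False using \<delta>1(2)[OF t(1,2)] closure_subset[of \<Omega>1] by auto
  qed
  define n1 where "n1 = D1 y /\<^sub>R norm (D1 y)"
  define n2 where "n2 = D2 y /\<^sub>R norm (D2 y)"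
  have "norm n1 = 1" "norm n2 = 1" using d1 d2 by (simp_all add: n1_def n2_def)
  then have nn: "n1 \<bullet> n1 = 1" "n2 \<bullet> n2 = 1" by (simp_all add: norm_eq_1)
  have half': "n1 \<bullet> v \<ge> 0" if "n2 \<bullet> v > 0" for v
    using half[of v] that d1 d2 by (simp add: n1_def n2_def zero_less_mult_iff)
  have n12: "n1 = n2"
  proof (rule ccontr)
    assume "n1 \<noteq> n2"
    then have "(n2 - n1) \<bullet> (n2 - n1) > 0" by simp
    then have *: "n1 \<bullet> n2 < 1" using nn by (simp add: inner_diff_left inner_diff_right inner_commute)
    then have "n2 \<bullet> (n2 - n1) > 0" using nn by (simp add: inner_diff_right inner_commute)
    then have "n1 \<bullet> (n2 - n1) \<ge> 0" by (rule half')
    then show False using nn * by (simp add: inner_diff_right)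
  qed
  then show "D1 y /\<^sub>R norm (D1 y) = D2 y /\<^sub>R norm (D2 y)" by (simp add: n1_def n2_def)
  have D1: "D1 y = norm (D1 y) *\<^sub>R n1" using d1 by (simp add: n1_def)
  have D2: "D2 y = norm (D2 y) *\<^sub>R n1" unfolding n12 using d2 by (simp add: n2_def)
  have D1n: "D1 y \<bullet> n1 = norm (D1 y)" by (subst D1) (simp add: nn)
  have D2n: "D2 y \<bullet> n1 = norm (D2 y)" by (subst D2) (simp add: nn)
  have tang: "(H2 y \<tau> \<bullet> \<tau>) / norm (D2 y) \<le> (H1 y \<tau> \<bullet> \<tau>) / norm (D1 y)" if \<tau>: "n1 \<bullet> \<tau> = 0" for \<tau>
  proof (rule ccontr)
    assume "\<not> ?thesis"
    then obtain \<beta> where \<beta>: "(H1 y \<tau> \<bullet> \<tau>) / norm (D1 y) < \<beta>" "\<beta> < (H2 y \<tau> \<bullet> \<tau>) / norm (D2 y)"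
      using dense not_le by blast
    have perp: "D1 y \<bullet> \<tau> = 0" "D2 y \<bullet> \<tau> = 0" using \<tau> by (subst D1, simp) (subst D2, simp add: \<tau>)
    define w where "w = (- \<beta> / 2) *\<^sub>R n1"
    have Dw: "D1 y \<bullet> w = - (\<beta> * norm (D1 y)) / 2" "D2 y \<bullet> w = - (\<beta> * norm (D2 y)) / 2"
      by (simp_all add: w_def D1n D2n)
    have "H1 y \<tau> \<bullet> \<tau> < \<beta> * norm (D1 y)" using \<beta>(1) d1 by (simp add: pos_divide_less_eq)
    then have neg: "H1 y \<tau> \<bullet> \<tau> + 2 * (D1 y \<bullet> w) < 0" unfolding Dw by simp
    obtain \<delta>1 where \<delta>1: "\<delta>1 > 0" "\<And>t. 0 < t \<Longrightarrow> t < \<delta>1 \<Longrightarrow> G1 (y + t *\<^sub>R \<tau> + t\<^sup>2 *\<^sub>R w) < 0"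
      using c1.chart_above_parabola(2)[OF yb(1) y(1) perp(1) neg] by blast
    have "\<beta> * norm (D2 y) < H2 y \<tau> \<bullet> \<tau>" using \<beta>(2) d2 by (simp add: pos_less_divide_eq)
    then have pos: "H2 y \<tau> \<bullet> \<tau> + 2 * (D2 y \<bullet> w) > 0" unfolding Dw by simp
    obtain \<delta>2 where \<delta>2: "\<delta>2 > 0" "\<And>t. 0 < t \<Longrightarrow> t < \<delta>2 \<Longrightarrow> G2 (y + t *\<^sub>R \<tau> + t\<^sup>2 *\<^sub>R w) > 0"
      using c2.chart_above_parabola(1)[OF yb(2) y(2) perp(2) pos] by blast
    have mpos: "min \<delta> (min r1 r2) > 0" using incl(1) c1.r_pos c2.r_pos by simp
    obtain \<delta>3 where \<delta>3: "\<delta>3 > 0" "\<And>t. 0 < t \<Longrightarrow> t < \<delta>3 \<Longrightarrow> y + t *\<^sub>R \<tau> + t\<^sup>2 *\<^sub>R w \<in> ball y (min \<delta> (min r1 r2))"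
      using parabola_in_ball[OF mpos, of y \<tau> w] by blast
    define t where "t = min \<delta>1 (min \<delta>2 \<delta>3) / 2"
    have t: "0 < t" "t < \<delta>1" "t < \<delta>2" "t < \<delta>3" using \<delta>1 \<delta>2 \<delta>3 by (auto simp: t_def)
    define z where "z = y + t *\<^sub>R \<tau> + t\<^sup>2 *\<^sub>R w"
    have z: "z \<in> ball y \<delta>" "z \<in> ball y r1" "z \<in> ball y r2" using \<delta>3(2)[OF t(1,4)] by (auto simp: z_def)
    have "z \<in> \<Omega>2" using c2.\<Omega>_iff[OF z(3)] \<delta>2(2)[OF t(1,3)] by (simp add: z_def)
    then have "G1 z > 0" using incl(2)[OF z(1)] c1.\<Omega>_iff[OF z(2)] by simp
    then show False using \<delta>1(2)[OF t(1,2)] by (simp add: z_def)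
  qed
  obtain B where B: "is_orthonormal_basis B {v. n1 \<bullet> v = 0}"
    by (rule ex_orthonormal_basis_hyperplane)
  have hyp: "{v. D1 y \<bullet> v = 0} = {v. n1 \<bullet> v = 0}" "{v. D2 y \<bullet> v = 0} = {v. n1 \<bullet> v = 0}"
  proof -
    have "D1 y \<bullet> v = norm (D1 y) * (n1 \<bullet> v)" "D2 y \<bullet> v = norm (D2 y) * (n1 \<bullet> v)" for v
      by (subst D1, simp) (subst D2, simp)
    then show "{v. D1 y \<bullet> v = 0} = {v. n1 \<bullet> v = 0}" "{v. D2 y \<bullet> v = 0} = {v. n1 \<bullet> v = 0}"
      using d1 d2 by auto
  qed
  have Bt: "n1 \<bullet> b = 0" if "b \<in> B" for b
    using B span_base[OF that] by (auto simp: is_orthonormal_basis_def)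
  have "level_curv (D2 y) (H2 y) = (\<Sum>b\<in>B. (H2 y b \<bullet> b) / norm (D2 y))"
    using level_curv_basis[OF c2.linear_H c2.D_nonzero, of B y y] B hyp by (simp add: sum_divide_distrib)
  also have "\<dots> \<le> (\<Sum>b\<in>B. (H1 y b \<bullet> b) / norm (D1 y))"
    by (intro sum_mono tang Bt)
  also have "\<dots> = level_curv (D1 y) (H1 y)"
    using level_curv_basis[OF c1.linear_H c1.D_nonzero, of B y y] B hyp by (simp add: sum_divide_distrib)
  finally show "level_curv (D2 y) (H2 y) \<le> level_curv (D1 y) (H1 y)" .
qed

section \<open>The curvature at a corner point\<close>

lemma peano_taylor:
  fixes f :: "'a::euclidean_space \<Rightarrow> real"
  assumes df: "\<And>x. (f has_derivative (\<lambda>v. D x \<bullet> v)) (at x)" and dD: "(D has_derivative A) (at x)" and "\<epsilon> > 0"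
  shows "\<exists>\<delta>>0. \<forall>v. norm v < \<delta> \<longrightarrow> \<bar>f (x + v) - f x - D x \<bullet> v - (A v \<bullet> v) / 2\<bar> \<le> \<epsilon> * (norm v)\<^sup>2"
proof -
  have lin: "linear A" using dD by (rule has_derivative_linear)
  obtain \<delta> where \<delta>: "\<delta> > 0" "\<And>y. norm (y - x) < \<delta> \<Longrightarrow> norm (D y - D x - A (y - x)) \<le> \<epsilon> * norm (y - x)"
    using dD assms(3) unfolding has_derivative_at_alt by blast
  show ?thesis
  proof (intro exI[of _ \<delta>] conjI allI impI \<delta>(1))
    fix v :: 'a assume v: "norm v < \<delta>"
    define \<phi> where "\<phi> t = f (x + t *\<^sub>R v) - t * (D x \<bullet> v) - t\<^sup>2 * ((A v \<bullet> v) / 2)" for t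
    define \<psi> where "\<psi> t = D (x + t *\<^sub>R v) \<bullet> v - D x \<bullet> v - t * (A v \<bullet> v)" for t
    have "(\<phi> has_real_derivative \<psi> t) (at t)" for t
      unfolding \<phi>_def \<psi>_def
      by (intro DERIV_diff has_real_derivative_along_line df) (auto intro!: derivative_eq_intros)
    then obtain z where z: "0 < z" "z < 1" "\<phi> 1 - \<phi> 0 = (1 - 0) * \<psi> z"
      using MVT2[of 0 1 \<phi> \<psi>] by auto
    have zv: "norm (z *\<^sub>R v) \<le> norm v" using z by (simp add: mult_left_le_one_le)
    have "\<psi> z = (D (x + z *\<^sub>R v) - D x - A (z *\<^sub>R v)) \<bullet> v"
      by (simp add: \<psi>_def inner_diff_left linear_cmul[OF lin])
    also have "\<bar>\<dots>\<bar> \<le> norm (D (x + z *\<^sub>R v) - D x - A (z *\<^sub>R v)) * norm v"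
      by (rule Cauchy_Schwarz_ineq2)
    also have "\<dots> \<le> (\<epsilon> * norm v) * norm v"
    proof (rule mult_right_mono)
      have "norm (D (x + z *\<^sub>R v) - D x - A (z *\<^sub>R v)) \<le> \<epsilon> * norm (z *\<^sub>R v)"
        using \<delta>(2)[of "x + z *\<^sub>R v"] zv v by simp
      also have "\<dots> \<le> \<epsilon> * norm v" using zv assms(3) by simp
      finally show "norm (D (x + z *\<^sub>R v) - D x - A (z *\<^sub>R v)) \<le> \<epsilon> * norm v" .
    qed simp
    finally have "\<bar>\<phi> 1 - \<phi> 0\<bar> \<le> \<epsilon> * (norm v)\<^sup>2" using z(3) by (simp add: power2_eq_square mult.assoc)
    moreover have "\<phi> 1 - \<phi> 0 = f (x + v) - f x - D x \<bullet> v - (A v \<bullet> v) / 2" by (simp add: \<phi>_def)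
    ultimately show "\<bar>f (x + v) - f x - D x \<bullet> v - (A v \<bullet> v) / 2\<bar> \<le> \<epsilon> * (norm v)\<^sup>2" by simp
  qed
qed

lemma leading_coefficient_nonneg:
  fixes a K :: real
  assumes "t0 > 0" and "\<And>t. 0 < t \<Longrightarrow> t < t0 \<Longrightarrow> 0 \<le> t * a + t\<^sup>2 * K"
  shows "a \<ge> 0"
proof (rule ccontr)
  assume "\<not> a \<ge> 0"
  define m where "m = min t0 (- a / (\<bar>K\<bar> + 1))"
  define t where "t = m / 2"
  have pos: "- a / (\<bar>K\<bar> + 1) > 0" using \<open>\<not> a \<ge> 0\<close> by (intro divide_pos_pos) auto
  have t: "0 < t" "t < t0" "t < - a / (\<bar>K\<bar> + 1)" 
  proof -
    have "m > 0" "m \<le> t0" "m \<le> - a / (\<bar>K\<bar> + 1)" using assms(1) pos by (auto simp: m_def)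
    then show "0 < t" "t < t0" "t < - a / (\<bar>K\<bar> + 1)" unfolding t_def by linarith+
  qed
  have "0 < \<bar>K\<bar> + 1" by simp
  then have "t * (\<bar>K\<bar> + 1) < - a" using t(3) pos_less_divide_eq by blast
  moreover have "t * K \<le> t * (\<bar>K\<bar> + 1)" using t(1) by (intro mult_left_mono) auto
  ultimately have "a + t * K < 0" by linarith
  then have "t * (a + t * K) < 0" using t(1) by (simp add: mult_pos_neg)
  then show False using assms(2)[OF t(1,2)] by (simp add: power2_eq_square algebra_simps)
qed

context boundary_chart
begin

abbreviation unit_normal :: "'a \<Rightarrow> 'a" where
  "unit_normal x \<equiv> D x /\<^sub>R norm (D x)"

text \<open>
  The level set \<open>G = 0\<close> is squeezed between two parabolas whose coefficients differ from \<open>\<kappa>/2\<close> by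
  \<open>\<delta>\<close>. Moving in the normal direction keeps these points in a plane that contains \<open>v\<close> and the normal,
  which the projection along \<open>e\<close> would not do.
\<close>

lemma zero_on_parabola:
  assumes x: "x \<in> ball p r" "G x = 0" and v: "D x \<bullet> v = 0" and "\<delta> > 0"
  defines "\<kappa> \<equiv> - (H x v \<bullet> v) / norm (D x)"
  shows "\<exists>t0>0. \<forall>t. 0 < t \<and> t < t0 \<longrightarrow> (\<exists>\<theta>. \<bar>\<theta> - \<kappa> / 2\<bar> \<le> \<delta> \<and> G (x + t *\<^sub>R v + (t\<^sup>2 * \<theta>) *\<^sub>R unit_normal x) = 0)"
proof -
  have nD: "norm (D x) > 0" using D_nonzero by simp
  have Dn: "D x \<bullet> unit_normal x = norm (D x)"
    using nD by (simp add: power2_eq_square flip: power2_norm_eq_inner)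
  have "H x v \<bullet> v + 2 * (D x \<bullet> ((\<kappa> / 2 + \<delta>) *\<^sub>R unit_normal x)) = 2 * norm (D x) * \<delta>"
    unfolding inner_scaleR_right[of _ "\<kappa> / 2 + \<delta>"] Dn using nD by (simp add: \<kappa>_def field_simps)
  then have "H x v \<bullet> v + 2 * (D x \<bullet> ((\<kappa> / 2 + \<delta>) *\<^sub>R unit_normal x)) > 0" using nD assms(4) by simp
  from chart_above_parabola(1)[OF x v this] obtain t1 where t1: "t1 > 0"
    "\<And>t. 0 < t \<Longrightarrow> t < t1 \<Longrightarrow> 0 < G (x + t *\<^sub>R v + t\<^sup>2 *\<^sub>R (\<kappa> / 2 + \<delta>) *\<^sub>R unit_normal x)" by blast
  have "H x v \<bullet> v + 2 * (D x \<bullet> ((\<kappa> / 2 - \<delta>) *\<^sub>R unit_normal x)) = - 2 * norm (D x) * \<delta>"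
    unfolding inner_scaleR_right[of _ "\<kappa> / 2 - \<delta>"] Dn using nD by (simp add: \<kappa>_def field_simps)
  then have "H x v \<bullet> v + 2 * (D x \<bullet> ((\<kappa> / 2 - \<delta>) *\<^sub>R unit_normal x)) < 0" using nD assms(4) by simp
  from chart_above_parabola(2)[OF x v this] obtain t2 where t2: "t2 > 0"
    "\<And>t. 0 < t \<Longrightarrow> t < t2 \<Longrightarrow> G (x + t *\<^sub>R v + t\<^sup>2 *\<^sub>R (\<kappa> / 2 - \<delta>) *\<^sub>R unit_normal x) < 0" by blast
  have "\<exists>\<theta>. \<bar>\<theta> - \<kappa> / 2\<bar> \<le> \<delta> \<and> G (x + t *\<^sub>R v + (t\<^sup>2 * \<theta>) *\<^sub>R unit_normal x) = 0"
    if t: "0 < t" "t < min t1 t2" for t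
  proof -
    define h where "h \<theta> = G (x + t *\<^sub>R v + (t\<^sup>2 * \<theta>) *\<^sub>R unit_normal x)" for \<theta>
    have "isCont h \<theta>" for \<theta>
      unfolding h_def by (rule continuous_within_compose3[OF isCont_G]) (intro continuous_intros)
    then have "continuous_on {\<kappa> / 2 - \<delta>..\<kappa> / 2 + \<delta>} h" by (simp add: continuous_at_imp_continuous_on)
    moreover have "h (\<kappa> / 2 - \<delta>) \<le> 0" "0 \<le> h (\<kappa> / 2 + \<delta>)"
      using t1(2)[of t] t2(2)[of t] t by (auto simp: h_def mult.assoc)
    ultimately obtain \<theta> where "\<kappa> / 2 - \<delta> \<le> \<theta>" "\<theta> \<le> \<kappa> / 2 + \<delta>" "h \<theta> = 0"
      using IVT'[of h "\<kappa> / 2 - \<delta>" 0 "\<kappa> / 2 + \<delta>"] assms(4) by auto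
    then show ?thesis by (intro exI[of _ \<theta>]) (auto simp: h_def)
  qed
  then show ?thesis using t1 t2 by (intro exI[of _ "min t1 t2"]) auto
qed

lemma D_inner_taylor:
  assumes "\<epsilon> > 0"
  shows "\<exists>\<delta>>0. \<forall>v. norm v < \<delta> \<longrightarrow> \<bar>D (x + v) \<bullet> s - D x \<bullet> s - H x s \<bullet> v - (T x v s \<bullet> v) / 2\<bar> \<le> \<epsilon> * (norm v)\<^sup>2"
proof (rule peano_taylor[of "\<lambda>x. D x \<bullet> s" "\<lambda>x. H x s" "\<lambda>v. T x v s" x, OF _ dH assms])
  show "((\<lambda>x. D x \<bullet> s) has_derivative (\<lambda>v. H x s \<bullet> v)) (at x)" for x
    using has_derivative_inner_left[OF dD[of x], of s] by (simp add: symmetric_H[of x _ s])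
qed

lemma linear_T: "linear (\<lambda>v. T x v k)"
  using dH by (rule has_derivative_linear)

lemma symmetric_T': "T x h k \<bullet> l = T x h l \<bullet> k"
proof -
  have "((\<lambda>x. H x k \<bullet> l) has_derivative (\<lambda>v. T x v k \<bullet> l)) (at x)"
    by (rule has_derivative_inner_left[OF dH])
  moreover have "((\<lambda>x. H x k \<bullet> l) has_derivative (\<lambda>v. T x v l \<bullet> k)) (at x)"
    unfolding symmetric_H[of _ k l] by (rule has_derivative_inner_left[OF dH])
  ultimately show ?thesis using has_derivative_unique by metis
qed

lemma T_add: "T x (v + w) k = T x v k + T x w k" and T_diff: "T x (v - w) k = T x v k - T x w k"
  and T_scale: "T x (c *\<^sub>R v) k = c *\<^sub>R T x v k"
  using linear_add[OF linear_T] linear_diff[OF linear_T] linear_cmul[OF linear_T] by blast+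

context
  fixes x s :: 'a and \<delta>0 :: real
  assumes x: "x \<in> ball p r" "G x = 0" and s: "norm s = 1" "D x \<bullet> s = 0"
    and \<delta>0: "\<delta>0 > 0"
    and incl: "\<And>z. z \<in> ball x \<delta>0 \<Longrightarrow> (z - x) \<bullet> s > 0 \<Longrightarrow> z - (2 * ((z - x) \<bullet> s)) *\<^sub>R s \<in> \<Omega> \<Longrightarrow> z \<in> \<Omega>"
begin

lemma ss1: "s \<bullet> s = 1" using s by (simp add: norm_eq_1)

lemma normal_s: "unit_normal x \<bullet> s = 0" using s by simp

lemma norm_normal: "norm (unit_normal x) = 1" using D_nonzero by simp

text \<open>
  At a boundary point of the plane where \<open>G\<close> decreased in the direction \<open>s\<close>, the points just behind
  the plane would be inside and their mirror images outside.
\<close>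

lemma corner_slope_nonneg:
  assumes y: "y \<in> ball x (min \<delta>0 (r - dist p x))" "(y - x) \<bullet> s = 0" "G y = 0"
  shows "D y \<bullet> s \<ge> 0"
proof (rule ccontr)
  assume "\<not> D y \<bullet> s \<ge> 0"
  then have neg: "D y \<bullet> (- s) > 0" by simp
  have yp: "y \<in> ball p r" using y(1) dist_triangle[of p y x] by auto
  obtain \<delta>1 where \<delta>1: "\<delta>1 > 0" "\<And>t. 0 < t \<Longrightarrow> t < \<delta>1 \<Longrightarrow> y + t *\<^sub>R (- s) \<in> \<Omega> \<and> y - t *\<^sub>R (- s) \<notin> closure \<Omega>"
    using sign_along_line[OF yp y(3) neg] by blast
  have yb: "y \<in> ball x \<delta>0" using y(1) by auto
  then obtain \<eta> where \<eta>: "\<eta> > 0" "ball y \<eta> \<subseteq> ball x \<delta>0" using open_ball openE by blast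
  define t where "t = min \<delta>1 \<eta> / 2"
  have t: "0 < t" "t < \<delta>1" "t < \<eta>" using \<delta>1 \<eta> by (auto simp: t_def)
  define z where "z = y + t *\<^sub>R s"
  have "z \<in> ball y \<eta>" using t s(1) by (simp add: z_def dist_norm)
  then have zb: "z \<in> ball x \<delta>0" using \<eta> by blast
  have zs: "(z - x) \<bullet> s = t" using y(2) by (simp add: z_def inner_diff_left inner_add_left ss1)
  have "z - (2 * ((z - x) \<bullet> s)) *\<^sub>R s = y + t *\<^sub>R (- s)"
    unfolding zs by (simp add: z_def algebra_simps flip: scaleR_2)
  then have "z \<in> \<Omega>" using incl[OF zb] \<delta>1(2)[OF t(1,2)] zs t(1) by simp
  moreover have "z \<notin> closure \<Omega>" using \<delta>1(2)[OF t(1,2)] by (simp add: z_def)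
  ultimately show False using closure_subset by blast
qed

text \<open>
  The slope \<open>D y \<bullet> s\<close> is nonnegative at the boundary points \<open>y\<close> of the plane and vanishes at \<open>x\<close>. Here it
  is expanded to second order at the boundary points in the direction \<open>\<tau>\<close>, whose normal component
  is \<open>\<kappa> t\<^sup>2 / 2\<close> up to an error.
\<close>

lemma corner_tangential_expansion:
  assumes \<tau>: "\<tau> \<bullet> s = 0" "D x \<bullet> \<tau> = 0" and \<epsilon>: "\<epsilon> > 0"
  defines "\<kappa> \<equiv> - (H x \<tau> \<bullet> \<tau>) / norm (D x)"
  shows "\<exists>t0>0. \<forall>t. 0 < t \<and> t < t0 \<longrightarrow>
    0 \<le> t * (H x s \<bullet> \<tau>) + t\<^sup>2 * (\<kappa> * (H x s \<bullet> unit_normal x) / 2 + (T x \<tau> s \<bullet> \<tau>) / 2 + \<epsilon>)"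
proof -
  define n where "n = unit_normal x"
  have nn: "norm n = 1" using norm_normal by (simp add: n_def)
  define a where "a = H x s \<bullet> \<tau>"
  define b where "b = H x s \<bullet> n"
  define c where "c = T x \<tau> s \<bullet> \<tau>"
  define \<Theta> where "\<Theta> = \<bar>\<kappa>\<bar> / 2 + 1"
  define C where "C = norm \<tau> + \<Theta>"
  define m1 where "m1 = \<bar>T x n s \<bullet> \<tau>\<bar> + \<bar>T x \<tau> s \<bullet> n\<bar>"
  define m2 where "m2 = \<bar>T x n s \<bullet> n\<bar>"
  define M where "M = \<Theta> * m1 + \<Theta>\<^sup>2 * m2"
  have \<Theta>: "\<Theta> \<ge> 1" by (simp add: \<Theta>_def)
  have C: "C \<ge> 1" using \<Theta> by (simp add: C_def add_increasing)
  have m: "m1 \<ge> 0" "m2 \<ge> 0" by (simp_all add: m1_def m2_def)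
  have M: "M \<ge> 0" using \<Theta> m by (simp add: M_def)
  define \<delta> where "\<delta> = min 1 (\<epsilon> / (4 * (\<bar>b\<bar> + 1)))"
  have \<delta>: "\<delta> > 0" using \<epsilon> by (simp add: \<delta>_def)
  have "\<delta> \<le> \<epsilon> / (4 * (\<bar>b\<bar> + 1))" by (simp add: \<delta>_def)
  then have "\<delta> * (\<bar>b\<bar> + 1) \<le> \<epsilon> / 4" by (simp add: field_simps)
  moreover have "\<delta> * \<bar>b\<bar> \<le> \<delta> * (\<bar>b\<bar> + 1)" using \<delta> by (intro mult_left_mono) auto
  ultimately have \<delta>b: "\<delta> * \<bar>b\<bar> \<le> \<epsilon> / 4" by linarith
  define \<eta> where "\<eta> = \<epsilon> / (4 * C\<^sup>2)"
  have \<eta>: "\<eta> > 0" "\<eta> * C\<^sup>2 = \<epsilon> / 4" using \<epsilon> C by (auto simp: \<eta>_def)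
  obtain d where d: "d > 0" "\<And>v. norm v < d \<Longrightarrow> \<bar>D (x + v) \<bullet> s - D x \<bullet> s - H x s \<bullet> v - (T x v s \<bullet> v) / 2\<bar> \<le> \<eta> * (norm v)\<^sup>2"
    using D_inner_taylor[OF \<eta>(1), of x s] by blast
  obtain t1 where t1: "t1 > 0" "\<And>t. 0 < t \<Longrightarrow> t < t1 \<Longrightarrow> \<exists>\<theta>. \<bar>\<theta> - \<kappa> / 2\<bar> \<le> \<delta> \<and> G (x + t *\<^sub>R \<tau> + (t\<^sup>2 * \<theta>) *\<^sub>R n) = 0"
    using zero_on_parabola[OF x \<tau>(2) \<delta>] unfolding \<kappa>_def n_def by blast
  define \<rho> where "\<rho> = min d (min \<delta>0 (r - dist p x))"
  have \<rho>: "\<rho> > 0" using d \<delta>0 x(1) by (simp add: \<rho>_def)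
  define t0 where "t0 = min (min t1 1) (min (\<rho> / C) (\<epsilon> / (2 * (M + 1))))"
  show ?thesis
  proof (intro exI[of _ t0] conjI allI impI)
    show "t0 > 0" unfolding t0_def using t1 \<rho> C \<epsilon> M by simp
    fix t assume t: "0 < t \<and> t < t0"
    then have t': "0 < t" "t < t1" "t < 1" "t < \<rho> / C" "t < \<epsilon> / (2 * (M + 1))" by (auto simp: t0_def)
    obtain \<theta> where \<theta>: "\<bar>\<theta> - \<kappa> / 2\<bar> \<le> \<delta>" "G (x + t *\<^sub>R \<tau> + (t\<^sup>2 * \<theta>) *\<^sub>R n) = 0"
      using t1(2)[OF t'(1,2)] by blast
    have "\<delta> \<le> 1" by (simp add: \<delta>_def)
    then have \<theta>b: "\<bar>\<theta>\<bar> \<le> \<Theta>" using \<theta>(1) unfolding \<Theta>_def by linarith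
    define w where "w = \<tau> + (t * \<theta>) *\<^sub>R n"
    define v where "v = t *\<^sub>R w"
    have v_eq: "v = t *\<^sub>R \<tau> + (t\<^sup>2 * \<theta>) *\<^sub>R n" by (simp add: v_def w_def scaleR_add_right power2_eq_square mult.assoc)
    have "norm w \<le> norm \<tau> + \<bar>t * \<theta>\<bar>"
      using norm_triangle_ineq[of \<tau> "(t * \<theta>) *\<^sub>R n"] nn by (simp add: w_def)
    also have "\<bar>t * \<theta>\<bar> \<le> 1 * \<Theta>" unfolding abs_mult using t' \<theta>b by (intro mult_mono) auto
    finally have w: "norm w \<le> C" by (simp add: C_def)
    have v: "norm v \<le> t * C" using w t' by (simp add: v_def)
    also have "\<dots> < \<rho>" using t' C by (simp add: pos_less_divide_eq)
    finally have v\<rho>: "norm v < \<rho>" .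
    have nDs: "n \<bullet> s = 0" using normal_s by (simp add: n_def)
    have vs: "v \<bullet> s = 0" by (simp add: v_eq inner_add_left \<tau>(1) nDs)
    have "x + v \<in> ball x (min \<delta>0 (r - dist p x))" using v\<rho> by (simp add: \<rho>_def dist_norm)
    then have "D (x + v) \<bullet> s \<ge> 0"
      by (rule corner_slope_nonneg) (use vs \<theta>(2) in \<open>simp_all add: v_eq add.assoc\<close>)
    moreover have "\<bar>D (x + v) \<bullet> s - D x \<bullet> s - H x s \<bullet> v - (T x v s \<bullet> v) / 2\<bar> \<le> \<eta> * (norm v)\<^sup>2"
      using v\<rho> by (intro d) (simp add: \<rho>_def)
    ultimately have "0 \<le> H x s \<bullet> v + (T x v s \<bullet> v) / 2 + \<eta> * (norm v)\<^sup>2" using s(2) by linarith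
    moreover have "H x s \<bullet> v = t * a + t\<^sup>2 * (\<theta> * b)"
      by (simp add: v_eq inner_add_right a_def b_def mult.assoc)
    moreover have "T x v s \<bullet> v \<le> t\<^sup>2 * (c + t * M)"
    proof -
      have "T x v s \<bullet> v = t\<^sup>2 * (T x w s \<bullet> w)"
        by (simp add: v_def T_scale power2_eq_square)
      moreover have "T x w s \<bullet> w = c + t * (\<theta> * (T x n s \<bullet> \<tau> + T x \<tau> s \<bullet> n) + t * (\<theta>\<^sup>2 * (T x n s \<bullet> n)))"
        by (simp add: w_def T_add T_scale inner_add_left inner_add_right c_def power2_eq_square algebra_simps)
      moreover have "\<theta> * (T x n s \<bullet> \<tau> + T x \<tau> s \<bullet> n) + t * (\<theta>\<^sup>2 * (T x n s \<bullet> n)) \<le> M"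
      proof -
        have "\<bar>\<theta> * (T x n s \<bullet> \<tau> + T x \<tau> s \<bullet> n)\<bar> \<le> \<Theta> * m1"
          unfolding abs_mult m1_def using \<theta>b \<Theta> by (intro mult_mono abs_triangle_ineq) auto
        moreover have "\<bar>t * (\<theta>\<^sup>2 * (T x n s \<bullet> n))\<bar> \<le> 1 * (\<Theta>\<^sup>2 * m2)"
          unfolding abs_mult m2_def using abs_le_square_iff[of \<theta> \<Theta>] \<theta>b \<Theta> t' by (intro mult_mono) auto
        ultimately show ?thesis by (simp add: M_def)
      qed
      ultimately show ?thesis using t' by (simp add: mult_left_mono)
    qed
    moreover have "\<eta> * (norm v)\<^sup>2 \<le> t\<^sup>2 * (\<epsilon> / 4)"
    proof -
      have "(norm v)\<^sup>2 \<le> (t * C)\<^sup>2" using v by (intro power_mono) auto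
      then have "\<eta> * (norm v)\<^sup>2 \<le> \<eta> * (t * C)\<^sup>2" using \<eta> by simp
      also have "\<dots> = t\<^sup>2 * (\<eta> * C\<^sup>2)" by (simp add: power_mult_distrib)
      finally show ?thesis using \<eta>(2) by simp
    qed
    ultimately have "0 \<le> t * a + t\<^sup>2 * (\<theta> * b) + t\<^sup>2 * (c + t * M) / 2 + t\<^sup>2 * (\<epsilon> / 4)" by linarith
    also have "\<dots> = t * a + t\<^sup>2 * (\<theta> * b + c / 2 + t * M / 2 + \<epsilon> / 4)" by (simp add: field_simps)
    also have "\<dots> \<le> t * a + t\<^sup>2 * (\<kappa> * b / 2 + c / 2 + \<epsilon>)"
    proof -
      have "(\<theta> - \<kappa> / 2) * b \<le> \<bar>\<theta> - \<kappa> / 2\<bar> * \<bar>b\<bar>" by (simp flip: abs_mult)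
      also have "\<dots> \<le> \<delta> * \<bar>b\<bar>" using \<theta>(1) by (intro mult_right_mono) auto
      finally have "\<theta> * b \<le> \<kappa> * b / 2 + \<epsilon> / 4" using \<delta>b by (simp add: algebra_simps)
      moreover have "t * M / 2 \<le> \<epsilon> / 4"
      proof -
        have "t * (M + 1) < \<epsilon> / 2" using t'(5) M by (simp add: field_simps)
        moreover have "t * M \<le> t * (M + 1)" using t' by simp
        ultimately show ?thesis by linarith
      qed
      ultimately have "\<theta> * b + c / 2 + t * M / 2 + \<epsilon> / 4 \<le> \<kappa> * b / 2 + c / 2 + \<epsilon>" using \<epsilon> by linarith
      then show ?thesis by (intro add_left_mono mult_left_mono) auto
    qed
    finally show "0 \<le> t * (H x s \<bullet> \<tau>) + t\<^sup>2 * (\<kappa> * (H x s \<bullet> unit_normal x) / 2 + (T x \<tau> s \<bullet> \<tau>) / 2 + \<epsilon>)"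
      by (simp only: a_def b_def c_def n_def)
  qed
qed

text \<open>
  The expansion holds for \<open>\<tau>\<close> and for \<open>- \<tau>\<close>, so the term of first order vanishes, and the term of
  second order is nonnegative.
\<close>

lemma corner_tangential:
  assumes \<tau>: "\<tau> \<bullet> s = 0" "D x \<bullet> \<tau> = 0"
  shows "H x s \<bullet> \<tau> = 0"
    and "T x \<tau> s \<bullet> \<tau> - (H x \<tau> \<bullet> \<tau>) * (H x s \<bullet> unit_normal x) / norm (D x) \<ge> 0"
proof -
  define \<kappa> where "\<kappa> = - (H x \<tau> \<bullet> \<tau>) / norm (D x)"
  define K where "K = \<kappa> * (H x s \<bullet> unit_normal x) / 2 + (T x \<tau> s \<bullet> \<tau>) / 2"
  have \<tau>': "(- \<tau>) \<bullet> s = 0" "D x \<bullet> (- \<tau>) = 0" using \<tau> by auto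
  have Hm: "H x (- \<tau>) = - H x \<tau>" using linear_neg[OF linear_H] .
  have Tm: "T x (- \<tau>) s = - T x \<tau> s" using linear_neg[OF linear_T] .
  have "H x s \<bullet> \<tau> \<ge> 0"
    using corner_tangential_expansion[OF \<tau> zero_less_one] leading_coefficient_nonneg by metis
  moreover have "H x s \<bullet> (- \<tau>) \<ge> 0"
    using corner_tangential_expansion[OF \<tau>' zero_less_one] leading_coefficient_nonneg by metis
  ultimately show z: "H x s \<bullet> \<tau> = 0" by simp
  have "0 \<le> K + \<epsilon>" if \<epsilon>: "\<epsilon> > 0" for \<epsilon>
  proof -
    obtain t0 where t0: "t0 > 0" "\<And>t. 0 < t \<Longrightarrow> t < t0 \<Longrightarrow> 0 \<le> t * (H x s \<bullet> \<tau>) + t\<^sup>2 * (K + \<epsilon>)"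
      using corner_tangential_expansion[OF \<tau> \<epsilon>] unfolding K_def \<kappa>_def by blast
    have "0 \<le> (t0 / 2)\<^sup>2 * (K + \<epsilon>)" using t0(2)[of "t0 / 2"] t0(1) z by simp
    then show ?thesis using t0(1) by (simp add: zero_le_mult_iff)
  qed
  then have "K \<ge> 0" by (metis add.commute field_le_epsilon)
  then show "T x \<tau> s \<bullet> \<tau> - (H x \<tau> \<bullet> \<tau>) * (H x s \<bullet> unit_normal x) / norm (D x) \<ge> 0"
    by (simp add: K_def \<kappa>_def)
qed

text \<open>
  Let \<open>x - t s + \<xi> n\<close> be a boundary point. Its mirror image \<open>x + t s + \<xi> n\<close> lies in the closure of
  \<open>\<Omega>\<close>, so the difference of the values of \<open>G\<close> is nonnegative. This difference is odd in \<open>t\<close>; its term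
  of first order is small since \<open>\<xi>\<close> is of order \<open>t\<^sup>2\<close>, and the coefficient of \<open>t\<^sup>3\<close> is the asserted
  expression.
\<close>

lemma corner_normal_section:
  shows "T x s s \<bullet> s - 3 * (H x s \<bullet> s) * (H x s \<bullet> unit_normal x) / norm (D x) \<ge> 0"
proof -
  define n where "n = unit_normal x"
  have nn: "norm n = 1" using norm_normal by (simp add: n_def)
  have nDs: "n \<bullet> s = 0" using normal_s by (simp add: n_def)
  define \<kappa> where "\<kappa> = - (H x (- s) \<bullet> (- s)) / norm (D x)"
  have \<kappa>': "\<kappa> = - (H x s \<bullet> s) / norm (D x)"
    using linear_neg[OF linear_H, of x s] by (simp add: \<kappa>_def)
  define b where "b = H x s \<bullet> n"
  define c where "c = T x s s \<bullet> s"
  define m where "m = \<bar>T x n s \<bullet> n\<bar>"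
  define \<Theta> where "\<Theta> = \<bar>\<kappa>\<bar> / 2 + 1"
  define C where "C = 1 + \<Theta>"
  have \<Theta>: "\<Theta> \<ge> 1" by (simp add: \<Theta>_def)
  have C: "C \<ge> 1" using \<Theta> by (simp add: C_def)
  have m: "m \<ge> 0" by (simp add: m_def)
  have main: "0 \<le> \<kappa> * b + c / 3 + \<epsilon>" if \<epsilon>: "\<epsilon> > 0" for \<epsilon>
  proof -
    define \<delta> where "\<delta> = min 1 (\<epsilon> / (8 * (\<bar>b\<bar> + 1)))"
    have \<delta>: "\<delta> > 0" using \<epsilon> by (simp add: \<delta>_def)
    have "\<delta> \<le> \<epsilon> / (8 * (\<bar>b\<bar> + 1))" by (simp add: \<delta>_def)
    then have "\<delta> * (\<bar>b\<bar> + 1) \<le> \<epsilon> / 8" by (simp add: field_simps)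
    moreover have "\<delta> * \<bar>b\<bar> \<le> \<delta> * (\<bar>b\<bar> + 1)" using \<delta> by (intro mult_left_mono) auto
    ultimately have \<delta>b: "\<delta> * \<bar>b\<bar> \<le> \<epsilon> / 8" by linarith
    define \<eta> where "\<eta> = \<epsilon> / (8 * C\<^sup>2)"
    have \<eta>: "\<eta> > 0" "\<eta> * C\<^sup>2 = \<epsilon> / 8" using \<epsilon> C by (auto simp: \<eta>_def)
    obtain d where d: "d > 0" "\<And>v. norm v < d \<Longrightarrow> \<bar>D (x + v) \<bullet> s - D x \<bullet> s - H x s \<bullet> v - (T x v s \<bullet> v) / 2\<bar> \<le> \<eta> * (norm v)\<^sup>2"
      using D_inner_taylor[OF \<eta>(1), of x s] by blast
    have ms: "D x \<bullet> (- s) = 0" using s(2) by simp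
    obtain t1 where t1: "t1 > 0" "\<And>t. 0 < t \<Longrightarrow> t < t1 \<Longrightarrow> \<exists>\<theta>. \<bar>\<theta> - \<kappa> / 2\<bar> \<le> \<delta> \<and> G (x + t *\<^sub>R (- s) + (t\<^sup>2 * \<theta>) *\<^sub>R n) = 0"
      using zero_on_parabola[OF x ms \<delta>] unfolding \<kappa>_def n_def by blast
    define \<rho> where "\<rho> = min d (min \<delta>0 (r - dist p x))"
    have \<rho>: "\<rho> > 0" using d \<delta>0 x(1) by (simp add: \<rho>_def)
    define t0 where "t0 = min (min t1 1) (min (\<rho> / C) (\<epsilon> / (4 * (\<Theta>\<^sup>2 * m + 1))))"
    have "\<Theta>\<^sup>2 * m + 1 > 0" using m by (simp add: add_nonneg_pos)
    then have "t0 > 0" unfolding t0_def using t1 \<rho> C \<epsilon> by simp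
    define t where "t = t0 / 2"
    have "0 < t" "t < t0" using \<open>t0 > 0\<close> by (auto simp: t_def)
    then have t: "0 < t" "t < t1" "t < 1" "t < \<rho> / C" "t < \<epsilon> / (4 * (\<Theta>\<^sup>2 * m + 1))"
      by (auto simp: t0_def)
    obtain \<theta> where \<theta>: "\<bar>\<theta> - \<kappa> / 2\<bar> \<le> \<delta>" "G (x + t *\<^sub>R (- s) + (t\<^sup>2 * \<theta>) *\<^sub>R n) = 0"
      using t1(2)[OF t(1,2)] by blast
    have "\<delta> \<le> 1" by (simp add: \<delta>_def)
    then have \<theta>b: "\<bar>\<theta>\<bar> \<le> \<Theta>" using \<theta>(1) unfolding \<Theta>_def by linarith
    define \<xi> where "\<xi> = t\<^sup>2 * \<theta>"
    have \<xi>b: "\<bar>\<xi>\<bar> \<le> t\<^sup>2 * \<Theta>" unfolding \<xi>_def abs_mult using \<theta>b by (intro mult_mono) auto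
    have "t\<^sup>2 * \<Theta> \<le> t * \<Theta>" using t \<Theta> by (simp add: power2_eq_square)
    then have \<xi>b': "\<bar>\<xi>\<bar> \<le> t * \<Theta>" using \<xi>b by linarith
    define v where "v \<sigma> = \<sigma> *\<^sub>R s + \<xi> *\<^sub>R n" for \<sigma>
    have v: "norm (v \<sigma>) \<le> t * C" if "\<bar>\<sigma>\<bar> \<le> t" for \<sigma>
      using norm_triangle_ineq[of "\<sigma> *\<^sub>R s" "\<xi> *\<^sub>R n"] that \<xi>b' nn s(1) by (simp add: v_def C_def algebra_simps)
    have "t * C < \<rho>" using t C by (simp add: pos_less_divide_eq)
    then have v\<rho>: "norm (v \<sigma>) < \<rho>" if "\<bar>\<sigma>\<bar> \<le> t" for \<sigma> using v[OF that] by linarith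
    have G0: "G (x + v (- t)) = 0" using \<theta>(2) by (simp add: v_def \<xi>_def algebra_simps)
    \<comment> \<open>The point \<open>x + v t\<close> is the mirror image of a boundary point, hence in the closure.\<close>
    have Gt: "G (x + v t) \<ge> 0"
    proof (rule ccontr)
      assume neg: "\<not> G (x + v t) \<ge> 0"
      define k where "k = e - (2 * (e \<bullet> s)) *\<^sub>R s"
      have ks: "k \<bullet> s = - (e \<bullet> s)" by (simp add: k_def inner_diff_left ss1)
      have "((\<lambda>h. G (x + v t + h *\<^sub>R k)) \<longlongrightarrow> G (x + v t + 0 *\<^sub>R k)) (at 0)"
        by (rule isCont_tendsto_compose[OF isCont_G]) (auto intro!: tendsto_eq_intros)
      then have "\<forall>\<^sub>F h in at 0. G (x + v t + h *\<^sub>R k) < 0" by (rule order_tendstoD) (use neg in simp)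
      moreover have "\<forall>\<^sub>F h in at (0::real). norm (v t + h *\<^sub>R k) < \<rho>"
      proof -
        have "((\<lambda>h. norm (v t + h *\<^sub>R k)) \<longlongrightarrow> norm (v t + 0 *\<^sub>R k)) (at 0)"
          by (auto intro!: tendsto_eq_intros)
        then show ?thesis by (rule order_tendstoD) (use v\<rho>[of t] t(1) in simp)
      qed
      moreover have "\<forall>\<^sub>F h in at (0::real). norm (v (- t) + h *\<^sub>R e) < \<rho>"
      proof -
        have "((\<lambda>h. norm (v (- t) + h *\<^sub>R e)) \<longlongrightarrow> norm (v (- t) + 0 *\<^sub>R e)) (at 0)"
          by (auto intro!: tendsto_eq_intros)
        then show ?thesis by (rule order_tendstoD) (use v\<rho>[of "- t"] t(1) in simp)
      qed
      moreover have "\<forall>\<^sub>F h in at (0::real). (v t + h *\<^sub>R k) \<bullet> s > 0"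
      proof -
        have "((\<lambda>h. (v t + h *\<^sub>R k) \<bullet> s) \<longlongrightarrow> (v t + 0 *\<^sub>R k) \<bullet> s) (at 0)"
          by (auto intro!: tendsto_eq_intros)
        moreover have "(v t + 0 *\<^sub>R k) \<bullet> s = t" by (simp add: v_def inner_add_left ss1 nDs)
        ultimately show ?thesis using t(1) order_tendstoD(1) by metis
      qed
      ultimately have "\<forall>\<^sub>F h in at (0::real). G (x + v t + h *\<^sub>R k) < 0 \<and> norm (v t + h *\<^sub>R k) < \<rho>
          \<and> norm (v (- t) + h *\<^sub>R e) < \<rho> \<and> (v t + h *\<^sub>R k) \<bullet> s > 0"
        by eventually_elim simp
      then obtain h0 where h0: "h0 > 0" "\<And>h. h \<noteq> 0 \<Longrightarrow> dist h 0 < h0 \<Longrightarrow> G (x + v t + h *\<^sub>R k) < 0 \<and> norm (v t + h *\<^sub>R k) < \<rho>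
          \<and> norm (v (- t) + h *\<^sub>R e) < \<rho> \<and> (v t + h *\<^sub>R k) \<bullet> s > 0"
        unfolding eventually_at by blast
      define h where "h = h0 / 2"
      have h: "h > 0" "G (x + v t + h *\<^sub>R k) < 0" "norm (v t + h *\<^sub>R k) < \<rho>"
        "norm (v (- t) + h *\<^sub>R e) < \<rho>" "(v t + h *\<^sub>R k) \<bullet> s > 0"
        using h0(1) h0(2)[of h] by (auto simp: h_def)
      define z where "z = x + v t + h *\<^sub>R k"
      have zx: "z - x = v t + h *\<^sub>R k" by (simp add: z_def)
      have inb: "x + w \<in> ball x \<delta>0" "x + w \<in> ball p r" if "norm w < \<rho>" for w
        using that dist_triangle[of p "x + w" x] by (auto simp: \<rho>_def dist_norm)
      have zb: "z \<in> ball x \<delta>0" "z \<in> ball p r" using inb[OF h(3)] by (auto simp: z_def add.assoc)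
      have zs: "(z - x) \<bullet> s = t - h * (e \<bullet> s)"
        unfolding zx by (simp add: v_def inner_add_left ss1 nDs ks)
      have two: "(a * 2) *\<^sub>R w = a *\<^sub>R w + a *\<^sub>R w" "(a * (b * 2)) *\<^sub>R w = (a * b) *\<^sub>R w + (a * b) *\<^sub>R w"
        for a b :: real and w :: 'a
        by (simp_all only: mult_2_right distrib_left scaleR_left_distrib)
      have "z - (2 * ((z - x) \<bullet> s)) *\<^sub>R s = x + (v (- t) + h *\<^sub>R e)"
        unfolding zs by (simp add: z_def v_def k_def two algebra_simps)
      moreover have "x + (v (- t) + h *\<^sub>R e) \<in> \<Omega>"
      proof -
        have "G (x + (v (- t) + h *\<^sub>R e)) = h"
          unfolding add.assoc[symmetric] shift G0 by simp
        then show ?thesis using \<Omega>_iff[OF inb(2)[OF h(4)]] h(1) by simp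
      qed
      ultimately have "z \<in> \<Omega>" using incl[OF zb(1)] h(5) zx by simp
      then show False using \<Omega>_iff[OF zb(2)] h(2) by (simp add: z_def)
    qed
    define \<Phi> where "\<Phi> \<sigma> = G (x + v \<sigma>) - G (x + v (- \<sigma>)) - 2 * \<sigma> * \<xi> * b - \<sigma>^3 * (c / 3)" for \<sigma>
    define \<psi> where "\<psi> \<sigma> = D (x + v \<sigma>) \<bullet> s + D (x + v (- \<sigma>)) \<bullet> s - 2 * \<xi> * b - \<sigma>\<^sup>2 * c" for \<sigma>
    have dG': "((\<lambda>\<sigma>. G (x + v \<sigma>)) has_real_derivative D (x + v \<sigma>) \<bullet> s) (at \<sigma>)" for \<sigma>
      using has_real_derivative_along_line[of G _ "x + \<xi> *\<^sub>R n" \<sigma> s] dG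
      by (simp add: v_def algebra_simps)
    have "((\<lambda>\<sigma>. G (x + v (- \<sigma>))) has_real_derivative - (D (x + v (- \<sigma>)) \<bullet> s)) (at \<sigma>)" for \<sigma>
      using DERIV_chain2[OF dG'[of "- \<sigma>"] DERIV_minus[OF DERIV_ident]] by simp
    note dG'' = DERIV_diff[OF dG' this]
    have "(\<Phi> has_real_derivative \<psi> \<sigma>) (at \<sigma>)" for \<sigma>
    proof -
      have "((\<lambda>\<sigma>. (G (x + v \<sigma>) - G (x + v (- \<sigma>))) - 2 * \<sigma> * \<xi> * b - \<sigma>^3 * (c / 3)) has_real_derivative
          (D (x + v \<sigma>) \<bullet> s - - (D (x + v (- \<sigma>)) \<bullet> s)) - 2 * \<xi> * b - \<sigma>\<^sup>2 * c) (at \<sigma>)"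
        by (rule DERIV_diff, rule DERIV_diff, rule dG'') (auto intro!: derivative_eq_intros)
      then show ?thesis by (simp add: \<Phi>_def[abs_def] \<psi>_def)
    qed
    then obtain \<sigma> where \<sigma>: "0 < \<sigma>" "\<sigma> < t" "\<Phi> t - \<Phi> 0 = (t - 0) * \<psi> \<sigma>"
      using MVT2[OF t(1), of \<Phi> \<psi>] by blast
    have Tv: "T x (v \<sigma>) s \<bullet> v \<sigma> + T x (v (- \<sigma>)) s \<bullet> v (- \<sigma>) = 2 * (\<sigma>\<^sup>2 * c + \<xi>\<^sup>2 * (T x n s \<bullet> n))"
      by (simp add: v_def T_add T_diff T_scale inner_add_left inner_add_right inner_diff_left inner_diff_right c_def power2_eq_square algebra_simps)
    have Hv: "H x s \<bullet> v \<sigma> + H x s \<bullet> v (- \<sigma>) = 2 * \<xi> * b"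
      by (simp add: v_def inner_add_right inner_diff_right b_def)
    have R: "\<bar>D (x + v \<sigma>') \<bullet> s - H x s \<bullet> v \<sigma>' - (T x (v \<sigma>') s \<bullet> v \<sigma>') / 2\<bar> \<le> t\<^sup>2 * (\<epsilon> / 8)" if "\<bar>\<sigma>'\<bar> \<le> t" for \<sigma>'
    proof -
      have "norm (v \<sigma>') < d" using v\<rho>[OF that] by (simp add: \<rho>_def)
      from d(2)[OF this] have "\<bar>D (x + v \<sigma>') \<bullet> s - H x s \<bullet> v \<sigma>' - (T x (v \<sigma>') s \<bullet> v \<sigma>') / 2\<bar> \<le> \<eta> * (norm (v \<sigma>'))\<^sup>2"
        using s(2) by simp
      also have "\<dots> \<le> \<eta> * (t * C)\<^sup>2" using v[OF that] \<eta> by (intro mult_left_mono power_mono) auto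
      also have "\<dots> = t\<^sup>2 * (\<eta> * C\<^sup>2)" by (simp add: power_mult_distrib)
      finally show ?thesis using \<eta>(2) by simp
    qed
    have "\<psi> \<sigma> \<le> \<xi>\<^sup>2 * (T x n s \<bullet> n) + t\<^sup>2 * (\<epsilon> / 4)"
    proof -
      have "\<bar>\<sigma>\<bar> \<le> t" "\<bar>- \<sigma>\<bar> \<le> t" using \<sigma> by auto
      from R[OF this(1)] R[OF this(2)] show ?thesis
        using Tv Hv unfolding \<psi>_def abs_le_iff by (simp add: algebra_simps)
    qed
    also have "\<xi>\<^sup>2 * (T x n s \<bullet> n) \<le> t\<^sup>2 * (\<epsilon> / 4)"
    proof -
      have "\<xi>\<^sup>2 \<le> (t\<^sup>2 * \<Theta>)\<^sup>2" using \<xi>b \<Theta> abs_le_square_iff[of \<xi> "t\<^sup>2 * \<Theta>"] by simp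
      then have "\<xi>\<^sup>2 * (T x n s \<bullet> n) \<le> (t\<^sup>2 * \<Theta>)\<^sup>2 * m"
        unfolding m_def by (meson abs_ge_self mult_mono abs_ge_zero zero_le_power2 order_trans mult_left_mono mult_right_mono)
      also have "\<dots> = t\<^sup>2 * (t\<^sup>2 * (\<Theta>\<^sup>2 * m))" by (simp add: power_mult_distrib power2_eq_square)
      also have "\<dots> \<le> t\<^sup>2 * (\<epsilon> / 4)"
      proof (rule mult_left_mono)
        have "t * (\<Theta>\<^sup>2 * m + 1) < \<epsilon> / 4"
          using t(5) \<open>\<Theta>\<^sup>2 * m + 1 > 0\<close> by (simp add: field_simps)
        moreover have "t * (t * (\<Theta>\<^sup>2 * m)) \<le> t * (1 * (\<Theta>\<^sup>2 * m + 1))"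
          using t m by (intro mult_left_mono mult_mono) auto
        moreover have "t\<^sup>2 * (\<Theta>\<^sup>2 * m) = t * (t * (\<Theta>\<^sup>2 * m))" by (simp add: power2_eq_square)
        ultimately show "t\<^sup>2 * (\<Theta>\<^sup>2 * m) \<le> \<epsilon> / 4" by linarith
      qed simp
      finally show ?thesis .
    qed
    finally have "\<psi> \<sigma> \<le> t\<^sup>2 * (\<epsilon> / 2)" by (simp add: mult.commute)
    then have "t * \<psi> \<sigma> \<le> t * (t\<^sup>2 * (\<epsilon> / 2))" using t(1) by simp
    moreover have "\<Phi> 0 = 0" by (simp add: \<Phi>_def)
    ultimately have "\<Phi> t \<le> t^3 * (\<epsilon> / 2)" using \<sigma>(3) by (simp add: power2_eq_square power3_eq_cube)
    then have "0 \<le> 2 * t * \<xi> * b + t^3 * (c / 3) + t^3 * (\<epsilon> / 2)"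
      using Gt G0 by (simp add: \<Phi>_def)
    also have "\<dots> = t^3 * (2 * \<theta> * b + c / 3 + \<epsilon> / 2)"
      by (simp add: \<xi>_def power2_eq_square power3_eq_cube algebra_simps)
    finally have "0 \<le> 2 * \<theta> * b + c / 3 + \<epsilon> / 2" using t(1) by (simp add: zero_le_mult_iff)
    moreover have "2 * \<theta> * b \<le> \<kappa> * b + \<epsilon> / 4"
    proof -
      have "(\<theta> - \<kappa> / 2) * b \<le> \<bar>\<theta> - \<kappa> / 2\<bar> * \<bar>b\<bar>" by (simp flip: abs_mult)
      also have "\<dots> \<le> \<delta> * \<bar>b\<bar>" using \<theta>(1) by (intro mult_right_mono) auto
      finally show ?thesis using \<delta>b by (simp add: algebra_simps)
    qed
    ultimately show ?thesis using \<epsilon> by linarith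
  qed
  then have "\<kappa> * b + c / 3 \<ge> 0" by (metis add.commute field_le_epsilon)
  then show ?thesis by (simp add: \<kappa>' b_def c_def n_def mult_ac)
qed

text \<open>
  The Hessian has no entries that couple \<open>s\<close> with the directions orthogonal to \<open>s\<close> and the normal.
\<close>

lemma H_s: "H x s = (H x s \<bullet> s) *\<^sub>R s + (H x s \<bullet> unit_normal x) *\<^sub>R unit_normal x"
proof -
  define n where "n = unit_normal x"
  have "norm n = 1" using norm_normal by (simp only: n_def)
  then have nn: "n \<bullet> n = 1" by (simp only: norm_eq_1)
  have ns: "n \<bullet> s = 0" "s \<bullet> n = 0" using normal_s by (simp_all add: n_def inner_commute)
  have Dn: "D x = norm (D x) *\<^sub>R n" using D_nonzero by (simp add: n_def)
  define v where "v = H x s - (H x s \<bullet> s) *\<^sub>R s - (H x s \<bullet> n) *\<^sub>R n"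
  have v: "s \<bullet> v = 0" "n \<bullet> v = 0"
    by (simp_all add: v_def inner_diff_right ss1 nn ns inner_commute[of s "H x s"] inner_commute[of n "H x s"])
  have "D x \<bullet> v = 0" by (subst Dn) (simp add: v)
  then have "H x s \<bullet> v = 0" using corner_tangential(1) v(1) by (simp add: inner_commute)
  moreover have "v \<bullet> v = H x s \<bullet> v - (H x s \<bullet> s) * (s \<bullet> v) - (H x s \<bullet> n) * (n \<bullet> v)"
    by (subst (1) v_def) (simp only: inner_diff_left inner_scaleR_left)
  ultimately have "v \<bullet> v = 0" using v by simp
  then have "v = 0" by simp
  then have "H x s = (H x s \<bullet> s) *\<^sub>R s + (H x s \<bullet> n) *\<^sub>R n"
    unfolding v_def by (simp add: algebra_simps)
  then show ?thesis unfolding n_def .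
qed

lemma trace_corner:
  assumes lin: "linear L" and B: "is_orthonormal_basis B {v \<in> {v. unit_normal x \<bullet> v = 0}. s \<bullet> v = 0}"
  shows "trace_form L = L (unit_normal x) \<bullet> unit_normal x + L s \<bullet> s + (\<Sum>b\<in>B. L b \<bullet> b)"
proof -
  have s': "s \<in> {v. unit_normal x \<bullet> v = 0}" using normal_s by simp
  note ins = orthonormal_basis_insert[OF subspace_hyperplane s(1) s' B]
  show ?thesis using trace_form_hyperplane[OF lin norm_normal ins(1)] ins(2,3) by simp
qed

text \<open>
  With the splitting of \<open>H x s\<close>, the derivative of the curvature in the direction \<open>s\<close> becomes the sum of
  the expressions shown to be nonnegative in \<open>corner_tangential\<close>, over an orthonormal basis of the
  remaining directions, and in \<open>corner_normal_section\<close>, divided by \<open>|D x|\<close>.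
\<close>

lemma corner_curvature_derivative:
  "\<exists>d\<ge>0. ((\<lambda>t. level_curv (D (curve x s t)) (H (curve x s t))) has_real_derivative d) (at 0)"
proof -
  define c where "c = curve x s"
  have c0: "c 0 = x" using curve_0[OF x(2)] by (simp add: c_def)
  have dc: "(c has_derivative (\<lambda>h. h *\<^sub>R s)) (at 0)"
    using curve_derivative[OF s(2)] by (simp add: c_def has_vector_derivative_def)
  have real_along: "((\<lambda>t. g (c t)) has_real_derivative g' s) (at 0)"
    if g: "(g has_derivative g') (at x)" for g :: "'a \<Rightarrow> real" and g'
  proof -
    have "(g has_derivative g') (at (c 0))" using g by (simp add: c0)
    from diff_chain_at[OF dc this] have "((\<lambda>t. g (c t)) has_derivative (\<lambda>h. g' (h *\<^sub>R s))) (at 0)" by (simp add: o_def)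
    moreover have "(\<lambda>h. g' (h *\<^sub>R s)) = (*) (g' s)"
      using linear_cmul[OF has_derivative_linear[OF g]] by (auto simp: mult.commute)
    ultimately show ?thesis by (simp add: has_field_derivative_def)
  qed
  define n where "n = unit_normal x"
  define \<gamma> where "\<gamma> = norm (D x)"
  define \<alpha> where "\<alpha> = H x s \<bullet> s"
  define b where "b = H x s \<bullet> n"
  define hnn where "hnn = H x n \<bullet> n"
  define tnn where "tnn = T x s n \<bullet> n"
  have \<gamma>: "\<gamma> > 0" using D_nonzero by (simp add: \<gamma>_def)
  have Dx: "D x = \<gamma> *\<^sub>R n" using D_nonzero by (simp add: n_def \<gamma>_def)
  have "norm n = 1" using norm_normal by (simp only: n_def)
  then have nn: "n \<bullet> n = 1" by (simp only: norm_eq_1)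
  have ns: "n \<bullet> s = 0" using normal_s by (simp add: n_def)
  have Hs: "H x s = \<alpha> *\<^sub>R s + b *\<^sub>R n" using H_s by (simp add: \<alpha>_def b_def n_def)
  have linT: "linear (T x s)"
  proof -
    have T3: "T x s k \<bullet> l = T x k l \<bullet> s" for k l using symmetric_T'[of x s k l] symmetric_T[of x s l k] by simp
    show ?thesis
    proof (rule linearI)
      show "T x s (k + l) = T x s k + T x s l" for k l
        by (rule vector_eq_rdot[THEN iffD1]) (simp add: T3 T_add inner_add_left)
      show "T x s (a *\<^sub>R k) = a *\<^sub>R T x s k" for a k
        by (rule vector_eq_rdot[THEN iffD1]) (simp add: T3 T_scale)
    qed
  qed
  have expand: "(\<Sum>i\<in>Basis. (v \<bullet> i) * (L i \<bullet> w)) = L v \<bullet> w" if lin: "linear L" for L :: "'a \<Rightarrow> 'a" and v w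
  proof -
    have "L v = L (\<Sum>i\<in>Basis. (v \<bullet> i) *\<^sub>R i)" by (simp add: euclidean_representation)
    then show ?thesis by (simp add: linear_sum[OF lin] linear_cmul[OF lin] inner_sum_left)
  qed
  define a where "a t = trace_form (H (c t))" for t
  \<comment> \<open>The three ingredients of the curvature along the boundary curve: trace, squared gradient, normal entry.\<close>
  define m where "m t = D (c t) \<bullet> D (c t)" for t
  define q where "q t = H (c t) (D (c t)) \<bullet> D (c t)" for t
  have da: "(a has_real_derivative trace_form (T x s)) (at 0)"
    unfolding a_def trace_form_def
    by (rule real_along) (intro has_derivative_sum has_derivative_inner_left dH)
  have dm: "(m has_real_derivative (D x \<bullet> H x s + H x s \<bullet> D x)) (at 0)"
    unfolding m_def by (rule real_along) (intro has_derivative_inner dD)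
  have dq: "(q has_real_derivative (T x s (D x) \<bullet> D x + 2 * (H x (D x) \<bullet> H x s))) (at 0)"
  proof -
    have "((\<lambda>y. \<Sum>i\<in>Basis. (D y \<bullet> i) * (H y i \<bullet> D y)) has_derivative
       (\<lambda>v. \<Sum>i\<in>Basis. (D x \<bullet> i) * (H x i \<bullet> H x v + T x v i \<bullet> D x) + (H x v \<bullet> i) * (H x i \<bullet> D x))) (at x)"
      by (intro has_derivative_sum has_derivative_mult has_derivative_inner_left has_derivative_inner dD dH)
    from real_along[OF this]
    have "((\<lambda>t. H (c t) (D (c t)) \<bullet> D (c t)) has_real_derivative
        (H x (D x) \<bullet> H x s + T x s (D x) \<bullet> D x + H x (H x s) \<bullet> D x)) (at 0)"
      by (simp add: distrib_left sum.distrib expand linear_H linT)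
    moreover have "H x (H x s) \<bullet> D x = H x (D x) \<bullet> H x s" by (rule symmetric_H)
    ultimately show ?thesis unfolding q_def by (simp add: algebra_simps)
  qed
  have m0: "m 0 = \<gamma>\<^sup>2" by (simp add: m_def c0 \<gamma>_def power2_norm_eq_inner)
  have q0: "q 0 = \<gamma>\<^sup>2 * hnn"
    by (simp add: q_def c0 Dx linear_cmul[OF linear_H] hnn_def power2_eq_square)
  have dm': "D x \<bullet> H x s + H x s \<bullet> D x = 2 * \<gamma> * b"
    unfolding Hs Dx by (simp add: inner_add_left inner_add_right nn ns inner_commute[of s n])
  have dq': "T x s (D x) \<bullet> D x + 2 * (H x (D x) \<bullet> H x s) = \<gamma>\<^sup>2 * tnn + 2 * \<gamma> * (\<alpha> * b + b * hnn)"
  proof -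
    have "H x n \<bullet> s = b" by (simp add: b_def symmetric_H[of x n s])
    then show ?thesis
      unfolding Hs Dx by (simp add: linear_cmul[OF linear_H] linear_cmul[OF linT] inner_add_right
        tnn_def hnn_def power2_eq_square algebra_simps)
  qed
  define a' where "a' = trace_form (T x s)"
  define d where "d = ((a' - (tnn + 2 * \<alpha> * b / \<gamma>)) - (a 0 - hnn) * b / \<gamma>) / \<gamma>"
  have "((\<lambda>t. (a t - q t / m t) / sqrt (m t)) has_real_derivative d) (at 0)"
  proof -
    have d1: "((\<lambda>t. q t / m t) has_real_derivative (tnn + 2 * \<alpha> * b / \<gamma>)) (at 0)"
    proof (rule DERIV_cong[OF DERIV_divide[OF dq dm]])
      show "m 0 \<noteq> 0" using m0 \<gamma> by simp
      show "((T x s (D x) \<bullet> D x + 2 * (H x (D x) \<bullet> H x s)) * m 0 - q 0 * (D x \<bullet> H x s + H x s \<bullet> D x)) / (m 0 * m 0) =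
          tnn + 2 * \<alpha> * b / \<gamma>"
        unfolding dq' dm' m0 q0 using \<gamma> by (simp add: field_simps power2_eq_square)
    qed
    have d2: "((\<lambda>t. sqrt (m t)) has_real_derivative b) (at 0)"
    proof (rule DERIV_cong[OF DERIV_chain2[OF DERIV_real_sqrt dm]])
      show "0 < m 0" using m0 \<gamma> by simp
      show "inverse (sqrt (m 0)) / 2 * (D x \<bullet> H x s + H x s \<bullet> D x) = b"
        unfolding dm' m0 using \<gamma> by (simp add: field_simps)
    qed
    show ?thesis
    proof (rule DERIV_cong[OF DERIV_divide[OF DERIV_diff[OF da d1] d2]])
      show "sqrt (m 0) \<noteq> 0" using m0 \<gamma> by simp
      show "((trace_form (T x s) - (tnn + 2 * \<alpha> * b / \<gamma>)) * sqrt (m 0) - (a 0 - q 0 / m 0) * b) / (sqrt (m 0) * sqrt (m 0)) = d"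
        unfolding m0 q0 d_def a'_def[symmetric] using \<gamma> by (simp add: field_simps power2_eq_square)
    qed
  qed
  moreover have "(a t - q t / m t) / sqrt (m t) = level_curv (D (curve x s t)) (H (curve x s t))" for t
    by (simp add: level_curv_def a_def q_def m_def c_def norm_eq_sqrt_inner)
  moreover have "d \<ge> 0"
  proof -
    obtain B where B: "is_orthonormal_basis B {v \<in> {v. n \<bullet> v = 0}. s \<bullet> v = 0}"
    proof -
      have sub: "subspace ({v. n \<bullet> v = 0} \<inter> {v. s \<bullet> v = 0})" by (intro subspace_inter subspace_hyperplane)
      have eq: "{v. n \<bullet> v = 0} \<inter> {v. s \<bullet> v = 0} = {v \<in> {v. n \<bullet> v = 0}. s \<bullet> v = 0}" by auto
      show ?thesis
      proof (rule orthonormal_basis_subspace[OF sub])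
        fix B assume "pairwise orthogonal B" "\<And>b. b \<in> B \<Longrightarrow> norm b = 1" "span B = {v. n \<bullet> v = 0} \<inter> {v. s \<bullet> v = 0}"
        then show ?thesis using that[of B] unfolding is_orthonormal_basis_def eq by blast
      qed
    qed
    have Bt: "b' \<bullet> s = 0" "D x \<bullet> b' = 0" if "b' \<in> B" for b'
      using B span_base[OF that] by (auto simp: is_orthonormal_basis_def inner_commute Dx)
    have tr: "trace_form L = L n \<bullet> n + L s \<bullet> s + (\<Sum>b\<in>B. L b \<bullet> b)" if "linear L" for L
      using trace_corner[OF that, of B] B by (simp only: n_def)
    have "\<gamma> * d = (T x s s \<bullet> s - 3 * \<alpha> * b / \<gamma>) + (\<Sum>\<tau>\<in>B. T x s \<tau> \<bullet> \<tau> - (H x \<tau> \<bullet> \<tau>) * b / \<gamma>)"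
    proof -
      have sums: "(\<Sum>\<tau>\<in>B. T x s \<tau> \<bullet> \<tau> - (H x \<tau> \<bullet> \<tau>) * b / \<gamma>)
          = (\<Sum>\<tau>\<in>B. T x s \<tau> \<bullet> \<tau>) - (\<Sum>\<tau>\<in>B. H x \<tau> \<bullet> \<tau>) * b / \<gamma>"
        by (simp only: sum_subtractf sum_distrib_right sum_divide_distrib)
      have "\<gamma> * d = (a' - (tnn + 2 * \<alpha> * b / \<gamma>)) - (a 0 - hnn) * b / \<gamma>" using \<gamma> by (simp add: d_def)
      also have "a' = tnn + T x s s \<bullet> s + (\<Sum>\<tau>\<in>B. T x s \<tau> \<bullet> \<tau>)"
        unfolding a'_def tr[OF linT] tnn_def ..
      also have "a 0 = hnn + \<alpha> + (\<Sum>\<tau>\<in>B. H x \<tau> \<bullet> \<tau>)"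
        unfolding a_def c0 tr[OF linear_H] hnn_def \<alpha>_def ..
      finally show ?thesis
        unfolding sums using \<gamma> by (simp add: field_simps)
    qed
    moreover have "T x s s \<bullet> s - 3 * \<alpha> * b / \<gamma> \<ge> 0"
      using corner_normal_section unfolding \<alpha>_def b_def n_def \<gamma>_def .
    moreover have "T x s \<tau> \<bullet> \<tau> - (H x \<tau> \<bullet> \<tau>) * b / \<gamma> \<ge> 0" if "\<tau> \<in> B" for \<tau>
    proof -
      have "T x s \<tau> \<bullet> \<tau> = T x \<tau> s \<bullet> \<tau>" using symmetric_T[of x s \<tau> \<tau>] symmetric_T'[of x \<tau> \<tau> s] by simp
      then show ?thesis using corner_tangential(2)[OF Bt[OF that]] unfolding b_def n_def \<gamma>_def by simp
    qed
    ultimately have "\<gamma> * d \<ge> 0" by (simp add: sum_nonneg)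
    then show ?thesis using \<gamma> by (simp add: zero_le_mult_iff)
  qed
  ultimately show ?thesis by auto
qed

end

end

section \<open>The overdetermined problem\<close>

text \<open>
  The hypotheses of the theorem in the form used from here on: \<open>P\<close> and \<open>X\<close> are the gradient and the
  Hessian of \<open>u\<close>, extended continuously to the closure.
\<close>

locale overdetermined =
  fixes \<Omega> :: "'a::euclidean_space set" and u :: "'a \<Rightarrow> real" and P :: "'a \<Rightarrow> 'a" and X :: "'a \<Rightarrow> 'a \<Rightarrow> 'a"
    and a C \<Gamma> :: real
  assumes dim: "DIM('a) \<ge> 2"
    and op: "open \<Omega>" and conn: "connected \<Omega>" and ne: "\<Omega> \<noteq> {}" and bdd: "bounded \<Omega>"
    and charts: "\<And>p. p \<in> frontier \<Omega> \<Longrightarrow> \<exists>r k G D H T. boundary_chart \<Omega> p r k G D H T"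
    and \<Gamma>: "\<Gamma> \<ge> 0"
    and gh: "grad_hess (closure \<Omega>) u P X"
    and cX: "\<And>k. continuous_on (closure \<Omega>) (\<lambda>x. X x k)"
    and eqn: "\<And>x. x \<in> \<Omega> \<Longrightarrow> ell (P x) (X x) = - (1 + P x \<bullet> P x)"
    and dirichlet: "\<And>x. x \<in> frontier \<Omega> \<Longrightarrow> u x = a"
    and neumann: "\<And>x. x \<in> frontier \<Omega> \<Longrightarrow> has_normal_derivative \<Omega> u (\<Gamma> * mean_curvature \<Omega> x + C) x"
begin

lemma cl: "x \<in> \<Omega> \<Longrightarrow> x \<in> closure \<Omega>" "x \<in> frontier \<Omega> \<Longrightarrow> x \<in> closure \<Omega>"
  using closure_subset by (auto simp: frontier_def)

lemma frontier_eq: "frontier \<Omega> = closure \<Omega> - \<Omega>"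
  using op by (simp add: frontier_def interior_open)

lemma compact_cl: "compact (closure \<Omega>)"
  using bdd by simp

lemma cont_u: "continuous_on (closure \<Omega>) u" and cont_P: "continuous_on (closure \<Omega>) P"
  using grad_hess_continuous_on[OF gh] by auto

lemma gh_\<Omega>: "grad_hess \<Omega> u P X"
  using gh closure_subset by (rule grad_hess_subset)

text \<open>
  At an interior minimum the left-hand side of the equation would be nonnegative, and its right-hand
  side is negative.
\<close>

lemma u_greater: assumes "x \<in> \<Omega>" shows "u x > a"
proof -
  have no_min: False if x: "x \<in> \<Omega>" and min: "\<And>y. y \<in> \<Omega> \<Longrightarrow> u x \<le> u y" for x
  proof -
    have "ell (P x) (X x) \<ge> 0"
      using second_derivative_test(2)[OF op x gh_\<Omega> min] grad_hessD(3)[OF gh_\<Omega> x] by (intro ell_nonneg) auto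
    then show False using eqn[OF x] by (smt (verit) inner_ge_zero)
  qed
  have "closure \<Omega> \<noteq> {}" using ne closure_subset by auto
  then obtain x0 where x0: "x0 \<in> closure \<Omega>" "\<And>y. y \<in> closure \<Omega> \<Longrightarrow> u x0 \<le> u y"
    using continuous_attains_inf[OF compact_cl _ cont_u] by blast
  have "x0 \<notin> \<Omega>" using no_min[of x0] x0 cl by blast
  then have "u x0 = a" using x0 dirichlet frontier_eq by blast
  then have ge: "u y \<ge> a" if "y \<in> closure \<Omega>" for y using x0 that by auto
  have "u x \<noteq> a" using no_min[OF assms] ge cl by metis
  then show ?thesis using ge[OF cl(1)[OF assms]] by simp
qed

lemma gradient_bound: "\<exists>M\<ge>0. \<forall>x\<in>closure \<Omega>. norm (P x) \<le> M"
proof -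
  have "bounded (P ` closure \<Omega>)" using compact_continuous_image[OF cont_P compact_cl] compact_imp_bounded by blast
  then obtain M where "\<forall>x\<in>closure \<Omega>. norm (P x) \<le> M" unfolding bounded_iff by auto
  then show ?thesis by (intro exI[of _ "max M 0"]) auto
qed

lemma linear_X: "x \<in> closure \<Omega> \<Longrightarrow> linear (X x)"
  using grad_hessD(3)[OF gh] .

lemma hessian_bound: "\<exists>M\<ge>0. \<forall>x\<in>closure \<Omega>. \<forall>v. norm (X x v) \<le> M * norm v"
proof -
  have "\<forall>b. \<exists>M. \<forall>x\<in>closure \<Omega>. norm (X x b) \<le> M"
  proof
    fix b
    have "bounded ((\<lambda>x. X x b) ` closure \<Omega>)" using compact_continuous_image[OF cX compact_cl] compact_imp_bounded by blast
    then show "\<exists>M. \<forall>x\<in>closure \<Omega>. norm (X x b) \<le> M" unfolding bounded_iff by auto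
  qed
  then obtain m where m: "\<And>b x. x \<in> closure \<Omega> \<Longrightarrow> norm (X x b) \<le> m b" by metis
  define M where "M = (\<Sum>b\<in>Basis. \<bar>m b\<bar>)"
  show ?thesis
  proof (intro exI[of _ M] conjI ballI allI)
    show "M \<ge> 0" by (simp add: M_def sum_nonneg)
    fix x v assume x: "x \<in> closure \<Omega>"
    have "X x v = X x (\<Sum>b\<in>Basis. (v \<bullet> b) *\<^sub>R b)" by (simp add: euclidean_representation)
    also have "\<dots> = (\<Sum>b\<in>Basis. (v \<bullet> b) *\<^sub>R X x b)"
      by (simp add: linear_sum[OF linear_X[OF x]] linear_cmul[OF linear_X[OF x]])
    also have "norm \<dots> \<le> (\<Sum>b\<in>Basis. \<bar>m b\<bar> * norm v)"
    proof (rule sum_norm_le)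
      fix b :: 'a assume "b \<in> Basis"
      then have "\<bar>v \<bullet> b\<bar> * norm (X x b) \<le> norm v * \<bar>m b\<bar>"
        using Basis_le_norm[of b v] m[OF x, of b] by (intro mult_mono) auto
      then show "norm ((v \<bullet> b) *\<^sub>R X x b) \<le> \<bar>m b\<bar> * norm v" by (simp add: mult.commute)
    qed
    also have "\<dots> = M * norm v" by (simp add: M_def sum_distrib_right)
    finally show "norm (X x v) \<le> M * norm v" .
  qed
qed

lemma X_symmetric:
  assumes x: "x \<in> closure \<Omega>"
  shows "X x v \<bullet> w = X x w \<bullet> v"
proof -
  have c: "continuous_on (closure \<Omega>) (\<lambda>x. X x v \<bullet> w - X x w \<bullet> v)" by (intro continuous_intros cX)
  have "(\<lambda>x. X x v \<bullet> w - X x w \<bullet> v) x = 0"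
  proof (rule continuous_constant_on_closure[OF c _ x])
    show "X y v \<bullet> w - X y w \<bullet> v = 0" if "y \<in> \<Omega>" for y
      using second_derivative_symmetric[OF op that grad_hess_openD(1)[OF gh_\<Omega> _ op] grad_hess_openD(2)[OF gh_\<Omega> that op], of v w]
      by simp
  qed
  then show ?thesis by simp
qed

lemma gradient_along_curve:
  assumes c: "(c has_vector_derivative v) (at 0 within S)" and "c 0 = x" and x: "x \<in> closure \<Omega>"
    and "\<delta> > 0" and inS: "\<And>t. t \<in> S \<Longrightarrow> \<bar>t\<bar> < \<delta> \<Longrightarrow> c t \<in> closure \<Omega>"
  shows "((\<lambda>t. u (c t)) has_real_derivative (P x \<bullet> v)) (at 0 within S)"
    and "((\<lambda>t. P (c t)) has_vector_derivative (X x v)) (at 0 within S)"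
proof -
  have S: "at 0 within S = at 0 within (S \<inter> {-\<delta><..<\<delta>})"
    by (rule at_within_nhd[of _ "{-\<delta><..<\<delta>}"]) (use assms(4) in auto)
  have c': "(c has_derivative (\<lambda>t. t *\<^sub>R v)) (at 0 within (S \<inter> {-\<delta><..<\<delta>}))"
    using c unfolding S[symmetric] has_vector_derivative_def .
  have sub: "c ` (S \<inter> {-\<delta><..<\<delta>}) \<subseteq> closure \<Omega>" using inS by auto
  have "(u has_derivative (\<lambda>v. P x \<bullet> v)) (at (c 0) within c ` (S \<inter> {-\<delta><..<\<delta>}))"
    using grad_hessD(1)[OF gh x] has_derivative_subset[OF _ sub] assms(2) by simp
  from diff_chain_within[OF c' this]
  show "((\<lambda>t. u (c t)) has_real_derivative (P x \<bullet> v)) (at 0 within S)"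
    unfolding S by (simp add: has_field_derivative_def o_def mult_commute_abs)
  have "(P has_derivative X x) (at (c 0) within c ` (S \<inter> {-\<delta><..<\<delta>}))"
    using grad_hessD(2)[OF gh x] has_derivative_subset[OF _ sub] assms(2) by simp
  from diff_chain_within[OF c' this]
  show "((\<lambda>t. P (c t)) has_vector_derivative (X x v)) (at 0 within S)"
    unfolding S by (simp add: has_vector_derivative_def o_def linear_cmul[OF linear_X[OF x]])
qed

text \<open>
  The tangential part of the gradient vanishes because \<open>u\<close> is constant on the boundary.
\<close>

lemma boundary_gradient:
  assumes chart: "boundary_chart \<Omega> p r k G D H T" and x: "x \<in> frontier \<Omega>" "x \<in> ball p r"
  defines "n \<equiv> D x /\<^sub>R norm (D x)"
  shows "P x = (- (\<Gamma> * mean_curvature \<Omega> x + C)) *\<^sub>R n" "P x \<bullet> n = - (\<Gamma> * mean_curvature \<Omega> x + C)"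
proof -
  interpret boundary_chart \<Omega> p r k G D H T by fact
  have G0: "G x = 0" using frontier_iff x by simp
  have "norm n = 1" using D_nonzero[of x] by (simp add: n_def)
  then have nn: "n \<bullet> n = 1" by (simp only: norm_eq_1)
  have on: "outer_normal \<Omega> x = - n" using outer_normal_eq[OF x] by (simp add: n_def)
  have xcl: "x \<in> closure \<Omega>" using x cl by blast
  have "D x \<bullet> n > 0" using D_nonzero[of x] by (simp add: n_def)
  then obtain \<delta> where \<delta>: "\<delta> > 0" "\<And>t. 0 < t \<Longrightarrow> t < \<delta> \<Longrightarrow> x + t *\<^sub>R n \<in> \<Omega>"
    using sign_along_line[OF x(2) G0, of n] by blast
  have "((\<lambda>t. x + t *\<^sub>R (- n)) has_vector_derivative - n) (at_left 0)"
    by (auto intro!: derivative_eq_intros)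
  moreover have "x + t *\<^sub>R (- n) \<in> closure \<Omega>" if "t \<in> {..<0}" "\<bar>t\<bar> < \<delta>" for t
    using \<delta>(2)[of "- t"] that cl by auto
  ultimately have 1: "((\<lambda>t. u (x + t *\<^sub>R (- n))) has_real_derivative (P x \<bullet> (- n))) (at_left 0)"
    using gradient_along_curve(1)[of "\<lambda>t. x + t *\<^sub>R (- n)" "- n" "{..<0}" x \<delta>] xcl \<delta>(1) by simp
  have 2: "((\<lambda>t. u (x + t *\<^sub>R (- n))) has_real_derivative (\<Gamma> * mean_curvature \<Omega> x + C)) (at_left 0)"
    using neumann[OF x(1)] by (simp add: has_normal_derivative_def on)
  have "P x \<bullet> (- n) = \<Gamma> * mean_curvature \<Omega> x + C"
    using 1 2 unfolding has_field_derivative_iff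
    by (rule tendsto_unique[OF trivial_limit_at_left_real])
  then show Pn: "P x \<bullet> n = - (\<Gamma> * mean_curvature \<Omega> x + C)" by simp
  have tang: "P x \<bullet> v = 0" if v: "D x \<bullet> v = 0" for v
  proof -
    obtain \<delta> where \<delta>: "\<delta> > 0" "\<And>t. \<bar>t\<bar> < \<delta> \<Longrightarrow> curve x v t \<in> ball p r"
      using eventually_curve_in_ball[OF x(2) G0 v] by blast
    have fr: "curve x v t \<in> frontier \<Omega>" if "\<bar>t\<bar> < \<delta>" for t
      using frontier_iff[OF \<delta>(2)[OF that]] G_curve by simp
    have "((\<lambda>t. u (curve x v t)) has_real_derivative (P x \<bullet> v)) (at 0)"
      by (rule gradient_along_curve(1)[OF curve_derivative[OF v] curve_0[OF G0] xcl \<delta>(1)])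
         (use fr cl in blast)
    moreover have "((\<lambda>t. u (curve x v t)) has_real_derivative 0) (at 0)"
    proof (rule has_field_derivative_transform_within_open)
      show "((\<lambda>t. a) has_real_derivative 0) (at (0::real))" by simp
      show "open {-\<delta><..<\<delta>}" "0 \<in> {-\<delta><..<\<delta>}" using \<delta>(1) by auto
      show "a = u (curve x v t)" if "t \<in> {-\<delta><..<\<delta>}" for t
        using dirichlet[OF fr[of t]] that by auto
    qed
    ultimately show ?thesis by (rule DERIV_unique)
  qed
  define v where "v = P x - (P x \<bullet> n) *\<^sub>R n"
  have nv: "n \<bullet> v = 0" by (simp add: v_def inner_diff_right nn inner_commute)
  then have "D x \<bullet> v = 0" using D_nonzero[of x] by (simp add: n_def)
  then have "P x \<bullet> v = 0" by (rule tang)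
  moreover have "v \<bullet> v = P x \<bullet> v - (P x \<bullet> n) * (n \<bullet> v)"
    by (subst (1) v_def) (simp only: inner_diff_left inner_scaleR_left)
  ultimately have "v \<bullet> v = 0" using nv by simp
  then have "v = 0" by simp
  then have "P x = (P x \<bullet> n) *\<^sub>R n" unfolding v_def by simp
  then show "P x = (- (\<Gamma> * mean_curvature \<Omega> x + C)) *\<^sub>R n" unfolding Pn .
qed

end

section \<open>Comparison with the reflected solution\<close>

lemma ell_refl:
  assumes "norm e = 1" "linear L"
  shows "ell (refl0 e p) (\<lambda>v. refl0 e (L (refl0 e v))) = ell p L"
  using trace_form_conj[OF assms(2) orthogonal_refl0[OF assms(1)]] assms(1) by (simp add: ell_def)

text \<open>
  The difference of the two equations is distributed evenly: half of it moves the Hessians at fixed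
  coefficients, the other half moves the coefficients at fixed Hessians. The latter is linear in \<open>p - q\<close>
  since the Hessians are bounded.
\<close>

lemma ell_difference_bound:
  fixes p q :: "'a::euclidean_space"
  assumes lX: "linear X" and lY: "linear Y" and B: "B \<ge> 0" "\<And>v. norm (X v) \<le> B * norm v" "\<And>v. norm (Y v) \<le> B * norm v"
    and M: "norm p \<le> M" "norm q \<le> M"
    and ep: "ell p X = - (1 + p \<bullet> p)" and eq: "ell q Y = - (1 + q \<bullet> q)"
  shows "ell p (\<lambda>v. X v - Y v) + ell q (\<lambda>v. X v - Y v) \<le> (4 * M * (1 + B * (real DIM('a) + 1))) * norm (p - q)"
proof -
  define Z where "Z v = X v + Y v" for v
  have lZ: "linear Z" unfolding Z_def using linear_compose_add[OF lX lY] .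
  have M0: "M \<ge> 0" using M(1) norm_ge_zero order_trans by blast
  have Zb: "norm (Z v) \<le> 2 * B * norm v" for v
    using B(2)[of v] B(3)[of v] norm_triangle_ineq[of "X v" "Y v"] by (simp add: Z_def)
  have "\<bar>trace_form Z\<bar> \<le> (\<Sum>b\<in>(Basis :: 'a set). \<bar>Z b \<bullet> b\<bar>)" unfolding trace_form_def by (rule sum_abs)
  also have "\<dots> \<le> (\<Sum>b\<in>(Basis :: 'a set). 2 * B)"
  proof (rule sum_mono)
    fix b :: 'a assume "b \<in> Basis"
    then show "\<bar>Z b \<bullet> b\<bar> \<le> 2 * B" using Cauchy_Schwarz_ineq2[of "Z b" b] Zb[of b] by simp
  qed
  finally have tr: "\<bar>trace_form Z\<bar> \<le> 2 * B * real DIM('a)" by (simp add: mult.commute)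
  define d where "d = norm (p - q)"
  have pq: "\<bar>p \<bullet> p - q \<bullet> q\<bar> \<le> 2 * M * d"
  proof -
    have "p \<bullet> p - q \<bullet> q = (p - q) \<bullet> (p + q)" by (simp add: inner_diff_left inner_add_right inner_commute[of q p])
    also have "\<bar>\<dots>\<bar> \<le> norm (p - q) * norm (p + q)" by (rule Cauchy_Schwarz_ineq2)
    also have "\<dots> \<le> d * (2 * M)" unfolding d_def
      using M norm_triangle_ineq[of p q] by (intro mult_left_mono) auto
    finally show ?thesis by (simp add: mult_ac)
  qed
  have Zpq: "\<bar>Z p \<bullet> p - Z q \<bullet> q\<bar> \<le> 4 * B * M * d"
  proof -
    have "Z p \<bullet> p - Z q \<bullet> q = Z (p - q) \<bullet> p + Z q \<bullet> (p - q)"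
      by (simp add: linear_diff[OF lZ] inner_diff_left inner_diff_right)
    also have "\<bar>\<dots>\<bar> \<le> norm (Z (p - q)) * norm p + norm (Z q) * norm (p - q)"
      using Cauchy_Schwarz_ineq2[of "Z (p - q)" p] Cauchy_Schwarz_ineq2[of "Z q" "p - q"] by linarith
    also have "\<dots> \<le> (2 * B * d) * M + (2 * B * M) * d"
    proof (rule add_mono)
      show "norm (Z (p - q)) * norm p \<le> 2 * B * d * M"
        unfolding d_def using Zb[of "p - q"] M B(1) by (intro mult_mono) auto
      have "norm (Z q) \<le> 2 * B * M" using Zb[of q] M(2) B(1) mult_left_mono[of "norm q" M "2 * B"] by linarith
      then show "norm (Z q) * norm (p - q) \<le> 2 * B * M * d" unfolding d_def by (intro mult_right_mono) auto
    qed
    finally show ?thesis by (simp add: mult_ac)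
  qed
  have trd: "\<bar>(p \<bullet> p - q \<bullet> q) * trace_form Z\<bar> \<le> 2 * M * d * (2 * B * real DIM('a))"
    unfolding abs_mult using pq tr M0 by (intro mult_mono) (auto simp: d_def)
  \<comment> \<open>Subtract the two equations and distribute the difference symmetrically.\<close>
  have "ell p (\<lambda>v. X v - Y v) + ell q (\<lambda>v. X v - Y v)
      = 2 * (ell p X - ell q Y) - ((p \<bullet> p - q \<bullet> q) * trace_form Z - (Z p \<bullet> p - Z q \<bullet> q))"
  proof -
    have "trace_form Z = trace_form X + trace_form Y" by (simp add: Z_def[abs_def] trace_form_add)
    then show ?thesis
      unfolding ell_diff by (simp add: ell_def Z_def inner_add_left algebra_simps)
  qed
  also have "\<dots> = - 2 * (p \<bullet> p - q \<bullet> q) - (p \<bullet> p - q \<bullet> q) * trace_form Z + (Z p \<bullet> p - Z q \<bullet> q)"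
    unfolding ep eq by simp
  also have "\<dots> \<le> 2 * (2 * M * d) + 2 * M * d * (2 * B * real DIM('a)) + 4 * B * M * d"
  proof -
    have "- 2 * x \<le> 2 * y" if "\<bar>x\<bar> \<le> y" for x y :: real using that by linarith
    from add_mono[OF add_mono[OF this[OF pq] abs_le_D2[OF trd]] abs_le_D1[OF Zpq]]
    show ?thesis by (simp only: diff_conv_add_uminus)
  qed
  also have "\<dots> = (4 * M * (1 + B * (real DIM('a) + 1))) * norm (p - q)"
    unfolding d_def by (simp add: algebra_simps)
  finally show ?thesis .
qed

text \<open>
  A position of the plane \<open>x \<bullet> e = l\<close> for which the part of \<open>\<Omega>\<close> beyond the plane is reflected into \<open>\<Omega>\<close>.
\<close>

locale reflected_cap = overdetermined \<Omega> u P X a C \<Gamma>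
  for \<Omega> :: "'a::euclidean_space set" and u P X a C \<Gamma> +
  fixes e :: 'a and l :: real
  assumes unit_e: "norm e = 1"
    and cap: "\<And>x. x \<in> \<Omega> \<Longrightarrow> x \<bullet> e > l \<Longrightarrow> refl e l x \<in> \<Omega>"
begin

abbreviation R :: "'a \<Rightarrow> 'a" where "R \<equiv> refl e l"
abbreviation R0 :: "'a \<Rightarrow> 'a" where "R0 \<equiv> refl0 e"

text \<open>
  The reflected cap.
\<close>

definition \<Omega>' :: "'a set" where "\<Omega>' = {z. z \<bullet> e < l \<and> R z \<in> \<Omega>}"
definition w :: "'a \<Rightarrow> real" where "w z = u z - u (R z)"
definition Dw :: "'a \<Rightarrow> 'a" where "Dw z = P z - R0 (P (R z))"
definition Lw :: "'a \<Rightarrow> 'a \<Rightarrow> 'a" where "Lw z v = X z v - R0 (X (R z) (R0 v))"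
definition q :: "'a \<Rightarrow> 'a" where "q z = R0 (P (R z))"

lemmas [simp] = refl_invol[OF unit_e] refl0_invol[OF unit_e] norm_refl0[OF unit_e] dist_refl[OF unit_e] refl0_inner[OF unit_e]

lemma R_inner: "R x \<bullet> e = 2 * l - x \<bullet> e"
  by (rule refl_inner[OF unit_e])

lemma \<Omega>'_subset: "\<Omega>' \<subseteq> \<Omega>"
proof
  fix z assume z: "z \<in> \<Omega>'"
  then have "R z \<in> \<Omega>" "R z \<bullet> e > l" by (auto simp: \<Omega>'_def R_inner)
  then have "R (R z) \<in> \<Omega>" by (rule cap)
  then show "z \<in> \<Omega>" by simp
qed

lemma R_closure: "x \<in> closure (R -` S) \<longleftrightarrow> R x \<in> closure S"
proof -
  have "(\<exists>y\<in>R -` S. dist y x < \<epsilon>) \<longleftrightarrow> (\<exists>y\<in>S. dist y (R x) < \<epsilon>)" for \<epsilon>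
  proof
    show "\<exists>y\<in>S. dist y (R x) < \<epsilon>" if "\<exists>y\<in>R -` S. dist y x < \<epsilon>"
      using that by (metis dist_refl[OF unit_e] vimageD)
    show "\<exists>y\<in>R -` S. dist y x < \<epsilon>" if "\<exists>y\<in>S. dist y (R x) < \<epsilon>"
      using that by (metis dist_refl[OF unit_e] refl_invol[OF unit_e] vimageI)
  qed
  then show ?thesis by (simp add: closure_approachable)
qed

lemma open_vimage_R: "open S \<Longrightarrow> open (R -` S)"
  using continuous_on_refl[of UNIV e l] by (simp add: continuous_on_open_vimage)

lemma open_\<Omega>': "open \<Omega>'"
proof -
  have "\<Omega>' = {z. z \<bullet> e < l} \<inter> R -` \<Omega>" by (auto simp: \<Omega>'_def)
  then show ?thesis using open_vimage_R[OF op]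
    by (auto intro!: open_Int open_Collect_less continuous_intros)
qed

lemma closure_\<Omega>': "z \<in> closure \<Omega>' \<Longrightarrow> z \<in> closure \<Omega> \<and> R z \<in> closure \<Omega> \<and> z \<bullet> e \<le> l"
proof -
  assume z: "z \<in> closure \<Omega>'"
  have "closure \<Omega>' \<subseteq> closure \<Omega>" by (rule closure_mono[OF \<Omega>'_subset])
  moreover have "closure \<Omega>' \<subseteq> closure (R -` \<Omega>)" by (rule closure_mono) (auto simp: \<Omega>'_def)
  moreover have "closure \<Omega>' \<subseteq> {z. z \<bullet> e \<le> l}"
    by (rule closure_minimal) (auto simp: \<Omega>'_def intro!: closed_Collect_le continuous_intros)
  ultimately show ?thesis using z R_closure by blast
qed

lemma grad_hess_w: "grad_hess (closure \<Omega> \<inter> R -` closure \<Omega>) w Dw Lw"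
  unfolding grad_hess_def
proof (intro ballI conjI)
  fix x assume x: "x \<in> closure \<Omega> \<inter> R -` closure \<Omega>"
  let ?S = "closure \<Omega> \<inter> R -` closure \<Omega>"
  have sub: "?S \<subseteq> closure \<Omega>" "R ` ?S \<subseteq> closure \<Omega>" by auto
  have x1: "x \<in> closure \<Omega>" "R x \<in> closure \<Omega>" using x by auto
  have u1: "(u has_derivative (\<lambda>v. P x \<bullet> v)) (at x within ?S)" "(P has_derivative X x) (at x within ?S)"
    using has_derivative_subset[OF grad_hessD(1)[OF gh x1(1)] sub(1)] has_derivative_subset[OF grad_hessD(2)[OF gh x1(1)] sub(1)] by auto
  have "(u has_derivative (\<lambda>v. P (R x) \<bullet> v)) (at (R x) within R ` ?S)" "(P has_derivative X (R x)) (at (R x) within R ` ?S)"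
    using has_derivative_subset[OF grad_hessD(1)[OF gh x1(2)] sub(2)] has_derivative_subset[OF grad_hessD(2)[OF gh x1(2)] sub(2)] by auto
  from this[THEN diff_chain_within[OF has_derivative_refl]]
  have u2: "((\<lambda>x. u (R x)) has_derivative (\<lambda>v. P (R x) \<bullet> R0 v)) (at x within ?S)"
      "((\<lambda>x. P (R x)) has_derivative (\<lambda>v. X (R x) (R0 v))) (at x within ?S)"
    by (simp_all add: o_def)
  have "((\<lambda>z. u z - u (R z)) has_derivative (\<lambda>v. P x \<bullet> v - P (R x) \<bullet> R0 v)) (at x within ?S)"
    by (intro has_derivative_diff u1 u2)
  then show "(w has_derivative (\<lambda>v. Dw x \<bullet> v)) (at x within ?S)"
    by (simp add: w_def[abs_def] Dw_def inner_diff_left refl0_adjoint)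
  show "(Dw has_derivative Lw x) (at x within ?S)"
    unfolding Dw_def[abs_def] Lw_def[abs_def]
    by (intro has_derivative_diff u1 bounded_linear.has_derivative[OF bounded_linear_refl0] u2)
qed

lemma cont_w: "S \<subseteq> closure \<Omega> \<inter> R -` closure \<Omega> \<Longrightarrow> continuous_on S w"
  and cont_Dw: "S \<subseteq> closure \<Omega> \<inter> R -` closure \<Omega> \<Longrightarrow> continuous_on S Dw"
  using grad_hess_continuous_on[OF grad_hess_w] continuous_on_subset by blast+

definition W :: "'a set" where "W = \<Omega> \<inter> R -` \<Omega>"

lemma W_sub: "W \<subseteq> closure \<Omega> \<inter> R -` closure \<Omega>" and open_W: "open W" and \<Omega>'_W: "\<Omega>' \<subseteq> W"
  using cl open_vimage_R[OF op] op \<Omega>'_subset by (auto simp: W_def \<Omega>'_def)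

lemma supersolution_w: "\<exists>K\<ge>0. \<exists>B. supersolution W P q K w Dw Lw \<and> (\<forall>x\<in>W. P x \<bullet> P x \<le> B \<and> q x \<bullet> q x \<le> B)"
proof -
  obtain M where M: "M \<ge> 0" "\<And>x. x \<in> closure \<Omega> \<Longrightarrow> norm (P x) \<le> M" using gradient_bound by blast
  obtain B where B: "B \<ge> 0" "\<And>x v. x \<in> closure \<Omega> \<Longrightarrow> norm (X x v) \<le> B * norm v" using hessian_bound by blast
  define K where "K = 4 * M * (1 + B * (real DIM('a) + 1))"
  have "ell (P x) (Lw x) + ell (q x) (Lw x) \<le> K * norm (Dw x)" if x: "x \<in> W" for x
  proof -
    have x1: "x \<in> \<Omega>" "R x \<in> \<Omega>" using x by (auto simp: W_def)
    note lR = linear_X[OF cl(1)[OF x1(2)]]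
    have lY: "linear (\<lambda>v. R0 (X (R x) (R0 v)))"
      using linear_compose[OF linear_compose[OF linear_refl0 lR] linear_refl0] by (simp add: o_def)
    have ell_q: "ell (q x) (\<lambda>v. R0 (X (R x) (R0 v))) = - (1 + q x \<bullet> q x)"
      using ell_refl[OF unit_e lR, of "P (R x)"] eqn[OF x1(2)] by (simp add: q_def)
    have "norm (R0 (X (R x) (R0 v))) \<le> B * norm v" for v
      using B(2)[OF cl(1)[OF x1(2)], of "R0 v"] by simp
    then show ?thesis
      unfolding Lw_def[abs_def] Dw_def K_def q_def[symmetric]
      using B(2)[OF cl(1)[OF x1(1)]] M(2)[OF cl(1)[OF x1(1)]] M(2)[OF cl(1)[OF x1(2)]]
      by (intro ell_difference_bound[OF linear_X[OF cl(1)[OF x1(1)]] lY B(1) _ _ _ _ eqn[OF x1(1)] ell_q])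
         (auto simp: q_def)
  qed
  moreover have "K \<ge> 0" using M B by (simp add: K_def)
  moreover have "P x \<bullet> P x \<le> M\<^sup>2 \<and> q x \<bullet> q x \<le> M\<^sup>2" if "x \<in> W" for x
    using M(2)[of x] M(2)[of "R x"] that cl by (auto simp: W_def q_def power_mono simp flip: power2_norm_eq_inner)
  ultimately show ?thesis
    unfolding supersolution_def using grad_hess_subset[OF grad_hess_w W_sub] by blast
qed

lemma frontier_\<Omega>':
  assumes z: "z \<in> closure \<Omega>'" "z \<notin> \<Omega>'"
  shows "z \<bullet> e = l \<or> z \<bullet> e < l \<and> R z \<in> frontier \<Omega>"
  using closure_\<Omega>'[OF z(1)] z(2) by (auto simp: \<Omega>'_def frontier_eq)

lemma w_plane: "z \<bullet> e = l \<Longrightarrow> w z = 0"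
  by (simp add: w_def refl_on_plane)

lemma u_ge: "x \<in> closure \<Omega> \<Longrightarrow> u x \<ge> a"
  using u_greater dirichlet frontier_eq by (metis DiffI less_eq_real_def order_refl)

text \<open>
  On the plane \<open>w\<close> vanishes, and at the mirror image of a boundary point it equals \<open>u - a\<close>.
\<close>

lemma w_nonneg: assumes "z \<in> closure \<Omega>'" shows "w z \<ge> 0"
proof -
  obtain K B where K: "K \<ge> 0" "supersolution W P q K w Dw Lw" using supersolution_w by blast
  have bd: "w z \<ge> 0" if z: "z \<in> closure \<Omega>'" "z \<notin> \<Omega>'" for z
    using frontier_\<Omega>'[OF z] w_plane[of z] u_ge[of z] dirichlet[of "R z"] closure_\<Omega>'[OF z(1)] by (auto simp: w_def)
  show ?thesis
  proof (cases "z \<in> \<Omega>'")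
    case True
    have "bounded \<Omega>'" using bdd \<Omega>'_subset bounded_subset by blast
    moreover have "continuous_on (closure \<Omega>') w" using closure_\<Omega>' by (intro cont_w) auto
    ultimately show ?thesis
      using weak_maximum_principle[OF open_\<Omega>' _ supersolution_subset[OF K(2) \<Omega>'_W] K(1) _ _ True] bd open_\<Omega>'
      by (auto simp: frontier_def interior_open)
  qed (use bd assms in blast)
qed

text \<open>
  The zero set \<open>Z\<close> of \<open>w\<close> is open by the strong maximum principle. A point of its boundary strictly on the
  near side of the plane is either in \<open>\<Omega>'\<close>, hence in \<open>Z\<close>, or the mirror image of a boundary point of
  \<open>\<Omega>\<close>; in the latter case \<open>u = a\<close> there, so it is not in \<open>\<Omega>\<close>. Therefore \<open>Z\<close>, its mirror image and the points
  of the plane between them form a relatively open and closed part of \<open>\<Omega>\<close>.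
\<close>

lemma symmetric_of_zero:
  assumes z0: "z0 \<in> \<Omega>'" "w z0 = 0"
  shows "x \<in> \<Omega> \<longleftrightarrow> R x \<in> \<Omega>" and "x \<in> closure \<Omega> \<Longrightarrow> u (R x) = u x"
proof -
  obtain K B where K: "K \<ge> 0" "supersolution W P q K w Dw Lw" "\<And>x. x \<in> W \<Longrightarrow> P x \<bullet> P x \<le> B \<and> q x \<bullet> q x \<le> B"
    using supersolution_w by blast
  define Z where "Z = {z \<in> \<Omega>'. w z = 0}"
  have opZ: "open Z" unfolding Z_def
    using strong_maximum_principle[OF open_\<Omega>' supersolution_subset[OF K(2) \<Omega>'_W] K(1), of B] K(3) \<Omega>'_W w_nonneg closure_subset
    by blast
  have clZ: "z \<in> Z" if "z \<in> closure Z" "z \<in> \<Omega>" "z \<bullet> e < l" for z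
  proof -
    have zc: "z \<in> closure \<Omega>'" using that(1) closure_mono[of Z \<Omega>'] by (auto simp: Z_def)
    have "continuous_on (closure Z) w"
      by (rule cont_w) (use closure_\<Omega>' closure_mono[of Z \<Omega>'] in \<open>auto simp: Z_def\<close>)
    then have w0: "w z = 0"
      by (rule continuous_constant_on_closure[OF _ _ that(1)]) (simp add: Z_def)
    have "z \<in> \<Omega>'"
    proof (rule ccontr)
      assume "z \<notin> \<Omega>'"
      then have "R z \<in> frontier \<Omega>" using frontier_\<Omega>'[OF zc] that by auto
      then have "u z = a" using w0 dirichlet by (simp add: w_def)
      then show False using u_greater[OF that(2)] by simp
    qed
    then show ?thesis using w0 by (simp add: Z_def)
  qed
  define Y where "Y = R -` Z"
  have opY: "open Y" unfolding Y_def by (rule open_vimage_R[OF opZ])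
  have YZ: "Z \<subseteq> \<Omega>" "Y \<subseteq> \<Omega>" using \<Omega>'_subset by (auto simp: Z_def Y_def \<Omega>'_def)
  have clY: "y \<in> Y" if "y \<in> closure Y" "y \<in> \<Omega>" "y \<bullet> e > l" for y
  proof -
    have "R y \<in> closure Z" using that(1) R_closure by (simp add: Y_def)
    moreover have "R y \<in> \<Omega>" using cap that by blast
    ultimately have "R y \<in> Z" using clZ[of "R y"] that(3) R_inner by simp
    then show ?thesis by (simp add: Y_def)
  qed
  define F where "F = \<Omega> \<inter> closure (Z \<union> Y)"
  have side: "Z \<subseteq> {z. z \<bullet> e < l}" "Y \<subseteq> {z. z \<bullet> e > l}" by (auto simp: Z_def Y_def \<Omega>'_def R_inner)
  have clside: "closure Z \<subseteq> {z. z \<bullet> e \<le> l}" "closure Y \<subseteq> {z. z \<bullet> e \<ge> l}"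
  proof -
    show "closure Z \<subseteq> {z. z \<bullet> e \<le> l}"
      by (rule closure_minimal) (use side in \<open>auto intro!: closed_Collect_le continuous_intros\<close>)
    show "closure Y \<subseteq> {z. z \<bullet> e \<ge> l}"
      by (rule closure_minimal) (use side in \<open>auto intro!: closed_Collect_le continuous_intros\<close>)
  qed
  have Fcase: "x \<in> Z \<or> x \<in> Y \<or> (x \<bullet> e = l \<and> x \<in> closure Z)" if x: "x \<in> F" for x
  proof (cases "x \<in> closure Z")
    case True
    then have "x \<bullet> e \<le> l" using clside by blast
    then show ?thesis using clZ[OF True] True x by (cases "x \<bullet> e = l") (auto simp: F_def)
  next
    case False
    then have xY: "x \<in> closure Y" "x \<in> \<Omega>" using x by (auto simp: F_def)
    have "x \<bullet> e \<noteq> l"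
    proof
      assume "x \<bullet> e = l"
      then have "R x = x" by (rule refl_on_plane)
      then show False using False xY R_closure[of x Z] by (simp add: Y_def)
    qed
    moreover have "x \<bullet> e \<ge> l" using xY clside by blast
    ultimately show ?thesis using clY[OF xY] by simp
  qed
  \<comment> \<open>A small ball centred on the plane is cut into two half balls, which are mirror images.\<close>
  have "open F"
    unfolding open_contains_ball
  proof
    fix x assume x: "x \<in> F"
    have xO: "x \<in> \<Omega>" using x by (simp add: F_def)
    have ZY: "Z \<union> Y \<subseteq> F" using YZ closure_subset by (auto simp: F_def)
    consider "x \<in> Z \<union> Y" | "x \<bullet> e = l" "x \<in> closure Z" using Fcase[OF x] by blast
    then show "\<exists>\<epsilon>>0. ball x \<epsilon> \<subseteq> F"
    proof cases
      case 1
      then have "\<exists>\<epsilon>>0. ball x \<epsilon> \<subseteq> Z \<union> Y" using open_Un[OF opZ opY] by (simp add: open_contains_ball)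
      then show ?thesis using ZY by blast
    next
      case 2
      obtain \<epsilon> where \<epsilon>: "\<epsilon> > 0" "ball x \<epsilon> \<subseteq> \<Omega>" using op xO openE by blast
      define A where "A = ball x \<epsilon> \<inter> {z. z \<bullet> e < l}"
      have "convex A" unfolding A_def
        using convex_halfspace_lt[of e l] by (intro convex_Int convex_ball) (simp add: inner_commute)
      then have cA: "connected A" by (rule convex_connected)
      obtain z1 where z1: "z1 \<in> Z" "dist z1 x < \<epsilon>" using 2(2) \<epsilon>(1) unfolding closure_approachable by blast
      have z1A: "z1 \<in> A \<inter> Z" using z1 side by (auto simp: A_def dist_commute)
      have AZ: "A \<subseteq> Z"
      proof -
        have 1: "openin (top_of_set A) (A \<inter> Z)" using opZ by (simp add: openin_open_Int)
        have "A \<inter> closure Z = A \<inter> Z"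
          using clZ \<epsilon>(2) closure_subset[of Z] by (auto simp: A_def)
        moreover have "closedin (top_of_set A) (A \<inter> closure Z)" by (simp add: closedin_closed_Int)
        ultimately have 2: "closedin (top_of_set A) (A \<inter> Z)" by simp
        then have "A \<inter> Z = {} \<or> A \<inter> Z = A" using cA 1 unfolding connected_clopen by blast
        then show ?thesis using z1A by blast
      qed
      have AY: "y \<in> Y" if "y \<in> ball x \<epsilon>" "y \<bullet> e > l" for y
      proof -
        have "dist (R x) (R y) < \<epsilon>" using that(1) by simp
        then have "R y \<in> A" using that(2) refl_on_plane[OF 2(1)] by (simp add: A_def R_inner)
        then show ?thesis using AZ by (auto simp: Y_def)
      qed
      have "ball x \<epsilon> \<subseteq> closure (Z \<union> Y)"
      proof
        fix y assume y: "y \<in> ball x \<epsilon>"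
        show "y \<in> closure (Z \<union> Y)"
        proof (cases "y \<bullet> e = l")
          case False
          then consider "y \<bullet> e < l" | "y \<bullet> e > l" by linarith
          then have "y \<in> Z \<union> Y"
          proof cases
            case 1
            then have "y \<in> A" using y unfolding A_def by blast
            then show ?thesis using AZ by blast
          qed (use AY[OF y] in blast)
          then show ?thesis by (rule subsetD[OF closure_subset])
        next
          case True
          obtain \<eta> where \<eta>: "\<eta> > 0" "ball y \<eta> \<subseteq> ball x \<epsilon>" using y open_ball openE by blast
          have "\<exists>z\<in>Z \<union> Y. dist z y < \<delta>" if "\<delta> > 0" for \<delta>
          proof -
            define t where "t = min \<eta> \<delta> / 2"
            have t: "0 < t" "t < \<eta>" "t < \<delta>" using \<eta> that by (auto simp: t_def)
            have "y + t *\<^sub>R e \<in> ball y \<eta>" using t unit_e by (simp add: dist_norm)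
            then have "y + t *\<^sub>R e \<in> ball x \<epsilon>" using \<eta> by blast
            moreover have "(y + t *\<^sub>R e) \<bullet> e > l" using True t unit_e by (simp add: inner_add_left norm_eq_1)
            ultimately have "y + t *\<^sub>R e \<in> Y" by (rule AY)
            moreover have "dist (y + t *\<^sub>R e) y < \<delta>" using t unit_e by (simp add: dist_norm)
            ultimately show ?thesis by blast
          qed
          then show ?thesis unfolding closure_approachable by blast
        qed
      qed
      then have "ball x \<epsilon> \<subseteq> F" using \<epsilon> by (auto simp: F_def)
      then show ?thesis using \<epsilon>(1) by blast
    qed
  qed
  then have "openin (top_of_set \<Omega>) F" by (metis F_def inf_le1 open_openin_trans op)
  moreover have "closedin (top_of_set \<Omega>) F" unfolding F_def by (rule closedin_closed_Int) (rule closed_closure)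
  ultimately have "F = {} \<or> F = \<Omega>" using conn unfolding connected_clopen by blast
  moreover have "z0 \<in> F"
  proof -
    have "z0 \<in> Z" using z0 by (simp add: Z_def)
    then show ?thesis using YZ closure_subset[of "Z \<union> Y"] by (auto simp: F_def)
  qed
  ultimately have F\<Omega>: "F = \<Omega>" by blast
  have sym: "R x \<in> \<Omega> \<and> u (R x) = u x" if x: "x \<in> \<Omega>" for x
  proof -
    consider "x \<in> Z" | "x \<in> Y" | "x \<bullet> e = l" using Fcase[of x] x F\<Omega> by blast
    then show ?thesis
    proof cases
      case 1
      then show ?thesis by (auto simp: Z_def \<Omega>'_def w_def)
    next
      case 2
      then show ?thesis using YZ(1) by (auto simp: Y_def Z_def w_def)
    next
      case 3
      then show ?thesis using x by (simp add: refl_on_plane)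
    qed
  qed
  show iff: "x \<in> \<Omega> \<longleftrightarrow> R x \<in> \<Omega>" for x using sym[of x] sym[of "R x"] by auto
  have Rcl: "R x \<in> closure \<Omega>" if "x \<in> closure \<Omega>" for x
  proof -
    have "R -` \<Omega> = \<Omega>" using iff by auto
    then show ?thesis using R_closure[of x \<Omega>] that by simp
  qed
  show "u (R x) = u x" if x: "x \<in> closure \<Omega>"
  proof -
    have "continuous_on (closure \<Omega>) w" by (rule cont_w) (use Rcl in auto)
    then have "w x = 0"
      by (rule continuous_constant_on_closure[OF _ _ x]) (use sym in \<open>simp add: w_def\<close>)
    then show ?thesis by (simp add: w_def)
  qed
qed

end

section \<open>The two contact cases\<close>

lemma uniform_on_compact:
  fixes K :: "'a::metric_space set"
  assumes K: "compact K" and loc: "\<And>x. x \<in> K \<Longrightarrow> \<exists>\<epsilon>>0::real. \<exists>\<delta>>0. \<forall>z\<in>ball x \<delta>. z \<in> K \<longrightarrow> Q \<epsilon> z"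
    and mono: "\<And>\<epsilon> \<epsilon>' z. 0 < \<epsilon> \<Longrightarrow> \<epsilon> \<le> \<epsilon>' \<Longrightarrow> z \<in> K \<Longrightarrow> Q \<epsilon>' z \<Longrightarrow> Q \<epsilon> z"
  shows "\<exists>\<epsilon>>0. \<forall>z\<in>K. Q \<epsilon> z"
proof -
  obtain ep dl where ed: "\<And>x. x \<in> K \<Longrightarrow> ep x > (0::real)" "\<And>x. x \<in> K \<Longrightarrow> dl x > 0"
      "\<And>x z. x \<in> K \<Longrightarrow> z \<in> ball x (dl x) \<Longrightarrow> z \<in> K \<Longrightarrow> Q (ep x) z"
    using loc by metis
  have "K \<subseteq> (\<Union>x\<in>K. ball x (dl x))" using ed(2) by force
  then obtain F where F: "F \<subseteq> K" "finite F" "K \<subseteq> (\<Union>x\<in>F. ball x (dl x))"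
    using compactE_image[OF K, of K "\<lambda>x. ball x (dl x)"] by auto
  define \<epsilon> where "\<epsilon> = Min (insert 1 (ep ` F))"
  have fin: "finite (insert 1 (ep ` F))" using F by simp
  have "\<epsilon> > 0" unfolding \<epsilon>_def using fin F ed(1) by (subst Min_gr_iff) auto
  moreover have "Q \<epsilon> z" if z: "z \<in> K" for z
  proof -
    obtain x where x: "x \<in> F" "z \<in> ball x (dl x)" using F(3) z by blast
    have "\<epsilon> \<le> ep x" unfolding \<epsilon>_def using fin x by (intro Min_le) auto
    then show ?thesis using mono[OF \<open>\<epsilon> > 0\<close> _ z ed(3)[OF _ x(2) z]] x F(1) by blast
  qed
  ultimately show ?thesis by blast
qed

context reflected_cap
begin

lemma w_pos: "(\<And>z. z \<in> \<Omega>' \<Longrightarrow> w z \<noteq> 0) \<Longrightarrow> z \<in> \<Omega>' \<Longrightarrow> w z > 0"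
  using w_nonneg[of z] closure_subset[of \<Omega>'] by force

lemma inner_close: "z \<in> ball y \<delta> \<Longrightarrow> \<bar>z \<bullet> e - y \<bullet> e\<bar> < \<delta>"
  using Cauchy_Schwarz_ineq2[of "z - y" e] unit_e by (simp add: inner_diff_left dist_norm norm_minus_commute)

text \<open>
  At the contact point both normals agree and \<open>\<Omega>\<close> has the larger mean curvature, so the derivative of
  \<open>w\<close> along the inner normal is nonpositive. If \<open>w\<close> had no zero, the Hopf lemma in an interior ball of the
  reflected cap would make it positive.
\<close>

lemma zero_of_tangency:
  assumes x: "x \<in> frontier \<Omega>" "x \<bullet> e > l" and y: "R x \<in> frontier \<Omega>"
  shows "\<exists>z\<in>\<Omega>'. w z = 0"
proof (rule ccontr)
  assume "\<not> (\<exists>z\<in>\<Omega>'. w z = 0)"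
  then have pos: "w z > 0" if "z \<in> \<Omega>'" for z using w_pos that by blast
  define y where "y = R x"
  have Ry: "R y = x" by (simp add: y_def)
  obtain r1 k1 G1 D1 H1 T1 where c1: "boundary_chart \<Omega> y r1 k1 G1 D1 H1 T1" using charts[OF y] unfolding y_def by blast
  obtain r2 k2 G2 D2 H2 T2 where c2: "boundary_chart \<Omega> x r2 k2 G2 D2 H2 T2" using charts[OF x(1)] by blast
  interpret c1: boundary_chart \<Omega> y r1 k1 G1 D1 H1 T1 by fact
  interpret c2: boundary_chart \<Omega> x r2 k2 G2 D2 H2 T2 by fact
  note c3 = boundary_chart_refl[OF c2 unit_e, of l, folded y_def]
  interpret c3: boundary_chart "R -` \<Omega>" y r2 "R0 k2" "\<lambda>x. G2 (R x)" "\<lambda>x. R0 (D2 (R x))"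
    "\<lambda>x v. R0 (H2 (R x) (R0 v))" "\<lambda>x w v. R0 (T2 (R x) (R0 w) (R0 v))" by (rule c3)
  have yb: "y \<in> ball y r1" "y \<in> ball y r2" "x \<in> ball x r2" using c1.r_pos c2.r_pos by auto
  have yfr: "y \<in> frontier \<Omega>" using y by (simp add: y_def)
  have G0: "G1 y = 0" "G2 (R y) = 0" using c1.frontier_iff[OF yb(1)] c2.frontier_iff[OF yb(3)] yfr x(1) Ry by auto
  define \<delta> where "\<delta> = l - y \<bullet> e"
  have \<delta>: "\<delta> > 0" using x(2) by (simp add: \<delta>_def y_def R_inner)
  have left: "z \<bullet> e < l" if "z \<in> ball y \<delta>" for z using inner_close[OF that] by (simp add: \<delta>_def)
  have in': "z \<in> \<Omega>'" if "z \<in> ball y \<delta>" "z \<in> R -` \<Omega>" for z using left[OF that(1)] that(2) by (simp add: \<Omega>'_def)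
  have incl: "z \<in> \<Omega>" if "z \<in> ball y \<delta>" "z \<in> R -` \<Omega>" for z using in'[OF that] \<Omega>'_subset by blast
  note tc = tangency_comparison[OF c1 c3 G0 \<delta> incl]
  define n where "n = D1 y /\<^sub>R norm (D1 y)"
  have n2: "n = R0 (D2 x) /\<^sub>R norm (R0 (D2 x))" using tc(1) by (simp add: n_def Ry)
  have R0n: "R0 n = D2 x /\<^sub>R norm (D2 x)"
    unfolding n2 by (simp add: linear_cmul[OF linear_refl0])
  have nn: "norm n = 1" using c1.D_nonzero[of y] by (simp add: n_def)
  have curv: "mean_curvature \<Omega> x \<le> mean_curvature \<Omega> y"
  proof -
    have "level_curv (D2 x) (H2 x) \<le> level_curv (D1 y) (H1 y)"
      using tc(2) level_curv_refl[OF unit_e c2.linear_H, of "D2 x" x] by (simp add: Ry)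
    then show ?thesis
      using dim unfolding c1.mean_curvature_eq[OF yfr yb(1)] c2.mean_curvature_eq[OF x(1) yb(3)]
      by (simp add: divide_right_mono)
  qed
  obtain \<rho>0 where \<rho>0: "\<rho>0 > 0" "\<And>\<rho>. 0 < \<rho> \<Longrightarrow> \<rho> \<le> \<rho>0 \<Longrightarrow> cball (y + \<rho> *\<^sub>R n) \<rho> - {y} \<subseteq> R -` \<Omega>"
    using c3.interior_ball[OF yb(2) G0(2)] unfolding n2 Ry by blast
  define \<rho> where "\<rho> = min \<rho>0 (\<delta> / 4)"
  have \<rho>: "\<rho> > 0" "\<rho> \<le> \<rho>0" "4 * \<rho> \<le> \<delta>" using \<rho>0 \<delta> by (auto simp: \<rho>_def)
  define c where "c = y + \<rho> *\<^sub>R n"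
  have yc: "norm (y - c) = \<rho>" using \<rho> nn by (simp add: c_def)
  have cb: "cball c \<rho> \<subseteq> ball y \<delta>"
  proof
    fix z assume "z \<in> cball c \<rho>"
    then have "dist y z \<le> 2 * \<rho>" using dist_triangle[of y z c] yc by (simp add: dist_norm)
    then show "z \<in> ball y \<delta>" using \<rho> by simp
  qed
  have sub: "cball c \<rho> - {y} \<subseteq> \<Omega>'" using \<rho>0(2)[OF \<rho>(1,2)] cb in' unfolding c_def[symmetric] by blast
  have "y \<notin> ball c \<rho>" using yc by (simp add: dist_norm norm_minus_commute)
  then have bsub: "ball c \<rho> \<subseteq> \<Omega>'" using sub ball_subset_cball by blast
  have csub: "cball c \<rho> \<subseteq> closure \<Omega> \<inter> R -` closure \<Omega>"
    using sub \<Omega>'_W W_sub cl(2)[OF yfr] cl(2)[OF x(1)] Ry by blast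
  obtain K B where K: "K \<ge> 0" "supersolution W P q K w Dw Lw" "\<And>x. x \<in> W \<Longrightarrow> P x \<bullet> P x \<le> B \<and> q x \<bullet> q x \<le> B"
    using supersolution_w by blast
  have bW: "ball c \<rho> \<subseteq> W" using bsub \<Omega>'_W by blast
  obtain \<kappa> where \<kappa>: "\<kappa> > 0" "\<And>t. 0 \<le> t \<Longrightarrow> t \<le> 1/2 \<Longrightarrow> \<kappa> * t \<le> w (y + t *\<^sub>R (c - y))"
    using hopf_lemma[OF supersolution_subset[OF K(2) bW] K(1) \<rho>(1) _ _ cont_w[OF csub] _ yc, of B] K(3) bW bsub pos
    by blast
  have cy: "c - y = \<rho> *\<^sub>R n" by (simp add: c_def)
  have incb: "y + t *\<^sub>R (c - y) \<in> cball c \<rho>" if "0 \<le> t" "t < 1" for t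
  proof -
    have "c - (y + t *\<^sub>R (c - y)) = (1 - t) *\<^sub>R (c - y)" by (simp add: algebra_simps)
    then have "dist c (y + t *\<^sub>R (c - y)) = (1 - t) * \<rho>"
      using that yc by (simp add: dist_norm norm_minus_commute)
    then show ?thesis using that \<rho> by (simp add: mult_left_le_one_le)
  qed
  have "((\<lambda>t. y + t *\<^sub>R (c - y)) has_vector_derivative (c - y)) (at 0 within {0..})"
    by (auto intro!: derivative_eq_intros)
  then have d1: "((\<lambda>t. u (y + t *\<^sub>R (c - y))) has_real_derivative (P y \<bullet> (c - y))) (at 0 within {0..})"
    by (rule gradient_along_curve(1)[where \<delta> = 1]) (use cl(2)[OF yfr] incb csub in auto)
  have Rline: "R (y + t *\<^sub>R (c - y)) = x + t *\<^sub>R R0 (c - y)" for t by (simp add: refl_line Ry)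
  have "((\<lambda>t. x + t *\<^sub>R R0 (c - y)) has_vector_derivative R0 (c - y)) (at 0 within {0..})"
    by (auto intro!: derivative_eq_intros)
  then have d2: "((\<lambda>t. u (x + t *\<^sub>R R0 (c - y))) has_real_derivative (P x \<bullet> R0 (c - y))) (at 0 within {0..})"
  proof (rule gradient_along_curve(1)[where \<delta> = 1])
    fix t :: real assume "t \<in> {0..}" "\<bar>t\<bar> < 1"
    then have "y + t *\<^sub>R (c - y) \<in> cball c \<rho>" by (intro incb) auto
    then show "x + t *\<^sub>R R0 (c - y) \<in> closure \<Omega>" using csub unfolding Rline[symmetric] by blast
  qed (use cl(2)[OF x(1)] in auto)
  have dw: "((\<lambda>t. w (y + t *\<^sub>R (c - y))) has_real_derivative (P y \<bullet> (c - y) - P x \<bullet> R0 (c - y))) (at 0 within {0..})"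
    unfolding w_def Rline by (rule DERIV_diff[OF d1 d2])
  have w0: "w (y + 0 *\<^sub>R (c - y)) = 0" using dirichlet[OF yfr] dirichlet[OF x(1)] by (simp add: w_def Ry)
  have "\<kappa> \<le> P y \<bullet> (c - y) - P x \<bullet> R0 (c - y)"
    by (rule derivative_ge_of_linear_growth[OF dw w0, of "1/2"]) (use \<kappa>(2) in auto)
  also have "\<dots> = \<rho> * (P y \<bullet> n - P x \<bullet> R0 n)"
    unfolding cy by (simp add: linear_cmul[OF linear_refl0] right_diff_distrib)
  also have "P y \<bullet> n = - (\<Gamma> * mean_curvature \<Omega> y + C)"
    unfolding n_def by (rule boundary_gradient(2)[OF c1 yfr yb(1)])
  also have "P x \<bullet> R0 n = - (\<Gamma> * mean_curvature \<Omega> x + C)"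
    unfolding R0n by (rule boundary_gradient(2)[OF c2 x(1) yb(3)])
  also have "\<rho> * (- (\<Gamma> * mean_curvature \<Omega> y + C) - - (\<Gamma> * mean_curvature \<Omega> x + C)) \<le> 0"
    using \<rho>(1) mult_left_mono[OF curv \<Gamma>] by (intro mult_nonneg_nonpos) auto
  finally show False using \<kappa>(1) by simp
qed

text \<open>
  The Hopf lemma in a ball of the reflected cap that touches the plane from behind.
\<close>

lemma hopf_on_plane:
  assumes pos: "\<And>z. z \<in> \<Omega>' \<Longrightarrow> w z > 0" and x: "x \<in> W" "x \<bullet> e = l"
  shows "Dw x \<bullet> (- e) > 0"
proof -
  obtain K B where K: "K \<ge> 0" "supersolution W P q K w Dw Lw" "\<And>x. x \<in> W \<Longrightarrow> P x \<bullet> P x \<le> B \<and> q x \<bullet> q x \<le> B"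
    using supersolution_w by blast
  obtain \<delta> where \<delta>: "\<delta> > 0" "ball x \<delta> \<subseteq> W" using open_W x(1) openE by blast
  define \<rho> where "\<rho> = \<delta> / 3"
  have \<rho>: "\<rho> > 0" using \<delta> by (simp add: \<rho>_def)
  define c where "c = x - \<rho> *\<^sub>R e"
  have xc: "norm (x - c) = \<rho>" using \<rho> unit_e by (simp add: c_def)
  have cW: "cball c \<rho> \<subseteq> W"
  proof
    fix z assume "z \<in> cball c \<rho>"
    then have "dist x z \<le> 2 * \<rho>" using dist_triangle[of x z c] xc by (simp add: dist_norm)
    then have "z \<in> ball x \<delta>" using \<rho> by (simp add: \<rho>_def)
    then show "z \<in> W" using \<delta> by blast
  qed
  have b': "z \<in> \<Omega>'" if z: "z \<in> ball c \<rho>" for z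
  proof -
    have "c \<bullet> e = l - \<rho>" using unit_e x(2) by (simp add: c_def inner_diff_left norm_eq_1)
    then have "z \<bullet> e < l" using inner_close[OF z] by simp
    moreover have "z \<in> W" using cW z ball_subset_cball by blast
    ultimately show ?thesis by (simp add: \<Omega>'_def W_def)
  qed
  have bW: "ball c \<rho> \<subseteq> W" using cW ball_subset_cball by blast
  have cw: "continuous_on (cball c \<rho>) w" by (rule cont_w) (use cW W_sub in blast)
  obtain \<kappa> where \<kappa>: "\<kappa> > 0" "\<And>t. 0 \<le> t \<Longrightarrow> t \<le> 1/2 \<Longrightarrow> \<kappa> * t \<le> w (x + t *\<^sub>R (c - x))"
    using hopf_lemma[OF supersolution_subset[OF K(2) bW] K(1) \<rho> _ _ cw _ xc, of B] K(3) bW b' pos by blast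
  have "(w has_derivative (\<lambda>v. Dw x \<bullet> v)) (at x)"
    using grad_hess_openD(1)[OF grad_hess_subset[OF grad_hess_w W_sub] x(1) open_W] .
  then have "((\<lambda>t. w (x + t *\<^sub>R (c - x))) has_real_derivative (Dw x \<bullet> (c - x))) (at 0)"
    using has_real_derivative_along_line[of w _ x 0 "c - x"] by simp
  then have dw: "((\<lambda>t. w (x + t *\<^sub>R (c - x))) has_real_derivative (Dw x \<bullet> (c - x))) (at 0 within {0..})"
    by (rule has_field_derivative_at_within)
  have w0: "w (x + 0 *\<^sub>R (c - x)) = 0" using w_plane x(2) by simp
  have "\<kappa> \<le> Dw x \<bullet> (c - x)"
    by (rule derivative_ge_of_linear_growth[OF dw w0, of "1/2"]) (use \<kappa>(2) in auto)
  also have "\<dots> = \<rho> * (Dw x \<bullet> (- e))" by (simp add: c_def)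
  finally have "0 < \<rho> * (Dw x \<bullet> (- e))" using \<kappa>(1) by linarith
  then show ?thesis using \<rho> by (rule zero_less_mult_pos)
qed

text \<open>
  This provides the lower bound for \<open>w\<close> on the outer part of the boundary in the corner lemma, which
  reaches the plane, where \<open>w\<close> vanishes.
\<close>

lemma local_linear_growth:
  assumes pos: "\<And>z. z \<in> \<Omega>' \<Longrightarrow> w z > 0" and x: "x \<in> W" "x \<bullet> e \<le> l"
  shows "\<exists>\<epsilon>>0. \<exists>\<delta>>0. \<forall>z\<in>ball x \<delta>. z \<bullet> e \<le> l \<longrightarrow> \<epsilon> * (l - z \<bullet> e) \<le> w z"
proof (cases "x \<bullet> e = l")
  case False
  then have "x \<in> \<Omega>'" using x by (auto simp: \<Omega>'_def W_def)
  then have wx: "w x > 0" by (rule pos)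
  have "continuous_on W w" using cont_w W_sub by blast
  then have "isCont w x" using open_W x(1) by (simp add: continuous_on_eq_continuous_at)
  then have "\<forall>\<^sub>F z in at x. w z > w x / 2"
    unfolding isCont_def by (rule order_tendstoD) (use wx in simp)
  then obtain \<delta> where \<delta>: "\<delta> > 0" "\<And>z. z \<noteq> x \<Longrightarrow> dist z x < \<delta> \<Longrightarrow> w z > w x / 2"
    unfolding eventually_at by blast
  define m where "m = l - x \<bullet> e + \<delta>"
  have m: "m > 0" using x \<delta> by (simp add: m_def)
  show ?thesis
  proof (rule exI[of _ "w x / (2 * m)"], rule conjI, use wx m in simp, intro exI[of _ \<delta>] conjI ballI impI \<delta>(1))
    fix z assume z: "z \<in> ball x \<delta>" "z \<bullet> e \<le> l"
    have "l - z \<bullet> e \<le> m" using inner_close[OF z(1)] by (simp add: m_def)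
    then have "w x / (2 * m) * (l - z \<bullet> e) \<le> w x / (2 * m) * m" using wx m by (intro mult_left_mono) auto
    also have "\<dots> = w x / 2" using m by simp
    also have "\<dots> \<le> w z" using \<delta>(2)[of z] z(1) wx by (cases "z = x") (auto simp: dist_commute less_imp_le)
    finally show "w x / (2 * m) * (l - z \<bullet> e) \<le> w z" .
  qed
next
  case True
  define \<eta> where "\<eta> = (Dw x \<bullet> (- e)) / 2"
  have \<eta>: "\<eta> > 0" using hopf_on_plane[OF pos x(1) True] by (simp add: \<eta>_def)
  have "continuous_on W Dw" using cont_Dw W_sub by blast
  then have "isCont Dw x" using open_W x(1) by (simp add: continuous_on_eq_continuous_at)
  then have "((\<lambda>z. Dw z \<bullet> (- e)) \<longlongrightarrow> Dw x \<bullet> (- e)) (at x)" unfolding isCont_def by (intro tendsto_intros)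
  then have "\<forall>\<^sub>F z in at x. Dw z \<bullet> (- e) > \<eta>"
    by (rule order_tendstoD) (use \<eta> in \<open>simp add: \<eta>_def\<close>)
  then obtain d1 where d1: "d1 > 0" "\<And>z. z \<noteq> x \<Longrightarrow> dist z x < d1 \<Longrightarrow> Dw z \<bullet> (- e) > \<eta>"
    unfolding eventually_at by blast
  have Dwx: "Dw x \<bullet> (- e) > \<eta>" using \<eta> by (simp add: \<eta>_def)
  obtain d2 where d2: "d2 > 0" "ball x d2 \<subseteq> W" using open_W x(1) openE by blast
  define \<delta> where "\<delta> = min d1 d2"
  have \<delta>: "\<delta> > 0" using d1 d2 by (simp add: \<delta>_def)
  show ?thesis
  proof (rule exI[of _ \<eta>], rule conjI[OF \<eta>], intro exI[of _ \<delta>] conjI ballI impI \<delta>)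
    fix z assume z: "z \<in> ball x \<delta>" "z \<bullet> e \<le> l"
    define \<sigma> where "\<sigma> = l - z \<bullet> e"
    define f where "f = z + \<sigma> *\<^sub>R e"
    have ee: "e \<bullet> e = 1" using unit_e by (simp add: norm_eq_1)
    have fe: "f \<bullet> e = l" by (simp add: f_def \<sigma>_def inner_add_left ee)
    show "\<eta> * (l - z \<bullet> e) \<le> w z"
    proof (cases "\<sigma> = 0")
      case True
      then show ?thesis using w_plane[of z] by (simp add: \<sigma>_def)
    next
      case False
      then have \<sigma>: "\<sigma> > 0" using z(2) by (simp add: \<sigma>_def)
      \<comment> \<open>The foot \<open>f\<close> of \<open>z\<close> on the plane is no further from \<open>x\<close> than \<open>z\<close> is.\<close>
      have "(norm (f - x))\<^sup>2 \<le> (norm (z - x))\<^sup>2"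
      proof -
        have "(z - x) \<bullet> e = - \<sigma>" using \<open>x \<bullet> e = l\<close> by (simp add: \<sigma>_def inner_diff_left)
        moreover have "f - x = (z - x) + \<sigma> *\<^sub>R e" by (simp add: f_def)
        ultimately have "(f - x) \<bullet> (f - x) = (z - x) \<bullet> (z - x) - \<sigma>\<^sup>2"
          by (simp only: inner_add_left inner_add_right inner_scaleR_left inner_scaleR_right ee inner_commute[of e "z - x"])
             (simp add: power2_eq_square)
        then show ?thesis unfolding power2_norm_eq_inner by simp
      qed
      then have "norm (f - x) \<le> norm (z - x)" by (rule power2_le_imp_le) simp
      then have fb: "f \<in> ball x \<delta>" using z(1) by (simp add: dist_norm norm_minus_commute)
      have seg: "f + t *\<^sub>R (- e) \<in> ball x \<delta>" if "0 \<le> t" "t \<le> \<sigma>" for t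
      proof -
        have "z = f - \<sigma> *\<^sub>R e" by (simp add: f_def)
        then have "(t / \<sigma>) *\<^sub>R z = (t / \<sigma>) *\<^sub>R f - t *\<^sub>R e"
          using \<sigma> by (simp add: scaleR_right_diff_distrib)
        then have "f + t *\<^sub>R (- e) = (1 - t / \<sigma>) *\<^sub>R f + (t / \<sigma>) *\<^sub>R z"
          by (simp add: scaleR_left_diff_distrib)
        moreover have "0 \<le> t / \<sigma>" "t / \<sigma> \<le> 1" using that \<sigma> by auto
        ultimately show ?thesis using convexD[OF convex_ball fb z(1), of "1 - t / \<sigma>" "t / \<sigma>"] by simp
      qed
      have der: "((\<lambda>t. w (f + t *\<^sub>R (- e))) has_real_derivative (Dw (f + t *\<^sub>R (- e)) \<bullet> (- e))) (at t)"
        if "0 \<le> t" "t \<le> \<sigma>" for t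
      proof -
        have "f + t *\<^sub>R (- e) \<in> W" using seg[OF that] d2 by (auto simp: \<delta>_def)
        from grad_hess_openD(1)[OF grad_hess_subset[OF grad_hess_w W_sub] this open_W]
        show ?thesis by (rule has_real_derivative_along_line)
      qed
      obtain t where t: "0 < t" "t < \<sigma>" "w (f + \<sigma> *\<^sub>R (- e)) - w (f + 0 *\<^sub>R (- e)) = (\<sigma> - 0) * (Dw (f + t *\<^sub>R (- e)) \<bullet> (- e))"
        using MVT2[OF \<sigma> der] by blast
      have "f + t *\<^sub>R (- e) \<in> ball x \<delta>" using seg t by simp
      then have "Dw (f + t *\<^sub>R (- e)) \<bullet> (- e) > \<eta>"
        using d1(2)[of "f + t *\<^sub>R (- e)"] Dwx by (cases "f + t *\<^sub>R (- e) = x") (auto simp: \<delta>_def dist_commute)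
      then have "\<sigma> * \<eta> \<le> \<sigma> * (Dw (f + t *\<^sub>R (- e)) \<bullet> (- e))" using \<sigma> by (intro mult_left_mono) auto
      also have "\<dots> = w z" using t(3) w_plane[OF fe] by (simp add: f_def)
      finally show ?thesis by (simp add: \<sigma>_def mult.commute)
    qed
  qed
qed

text \<open>
  If \<open>w\<close> had no zero, it would grow at least like \<open>t\<^sup>2\<close> along the diagonal between the inner normal \<open>n\<close> and
  \<open>s = - e\<close>. Along this diagonal the first derivative of \<open>w\<close> vanishes at \<open>Q\<close> and the second one is a positive
  multiple of \<open>X Q s \<bullet> n\<close>. Differentiating \<open>P = - (\<Gamma> H + C) N\<close> along the boundary in the direction \<open>s\<close> shows
  that \<open>X Q s \<bullet> n\<close> is \<open>- \<Gamma>\<close> times the derivative of the mean curvature, hence nonpositive.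
\<close>

lemma zero_of_corner:
  assumes chart: "boundary_chart \<Omega> Q r k G D H T" and Q: "Q \<in> frontier \<Omega>" "Q \<bullet> e = l" and De: "D Q \<bullet> e = 0"
  shows "\<exists>z\<in>\<Omega>'. w z = 0"
proof (rule ccontr)
  assume "\<not> (\<exists>z\<in>\<Omega>'. w z = 0)"
  then have pos: "w z > 0" if "z \<in> \<Omega>'" for z using w_pos that by blast
  interpret boundary_chart \<Omega> Q r k G D H T by fact
  have Qb: "Q \<in> ball Q r" using r_pos by simp
  have G0: "G Q = 0" using frontier_iff[OF Qb] Q(1) by simp
  have Qcl: "Q \<in> closure \<Omega>" using Q cl by blast
  define s where "s = - e"
  have s: "norm s = 1" "D Q \<bullet> s = 0" using unit_e De by (auto simp: s_def)
  have ee: "e \<bullet> e = 1" "s \<bullet> s = 1" using unit_e by (simp_all add: norm_eq_1 s_def)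
  define n where "n = unit_normal Q"
  have nn: "norm n = 1" using D_nonzero[of Q] by (simp add: n_def)
  then have n1: "n \<bullet> n = 1" by (simp only: norm_eq_1)
  have ns: "n \<bullet> s = 0" "n \<bullet> e = 0" using s De by (simp_all add: n_def)

  \<comment> \<open>The boundary condition turns the third-order information on the boundary into second-order
      information on \<open>u\<close>.\<close>
  have Xsn: "X Q s \<bullet> n \<le> 0"
  proof -
    have incl: "z \<in> \<Omega>" if "z \<in> ball Q 1" "(z - Q) \<bullet> s > 0" "z - (2 * ((z - Q) \<bullet> s)) *\<^sub>R s \<in> \<Omega>" for z
    proof -
      have zs: "(z - Q) \<bullet> s = - (z \<bullet> e - l)" using Q(2) by (simp add: s_def inner_diff_left)
      have "z - (2 * ((z - Q) \<bullet> s)) *\<^sub>R s = R z" unfolding zs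
        by (simp add: s_def refl_def scaleR_left_diff_distrib)
      then have "z \<in> \<Omega>'" using that(2,3) zs by (simp add: \<Omega>'_def)
      then show ?thesis using \<Omega>'_subset by blast
    qed
    obtain d where d: "d \<ge> 0" "((\<lambda>t. level_curv (D (curve Q s t)) (H (curve Q s t))) has_real_derivative d) (at 0)"
      using corner_curvature_derivative[OF Qb G0 s zero_less_one incl] by blast
    define c where "c = curve Q s"
    have c0: "c 0 = Q" using curve_0[OF G0] by (simp add: c_def)
    have dc: "(c has_vector_derivative s) (at 0)" using curve_derivative[OF s(2)] by (simp add: c_def)
    obtain \<delta> where \<delta>: "\<delta> > 0" "\<And>t. \<bar>t\<bar> < \<delta> \<Longrightarrow> c t \<in> ball Q r"
      using eventually_curve_in_ball[OF Qb G0 s(2)] unfolding c_def by blast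
    have cfr: "c t \<in> frontier \<Omega>" if "\<bar>t\<bar> < \<delta>" for t
      using frontier_iff[OF \<delta>(2)[OF that]] G_curve by (simp add: c_def)
    define N where "N t = unit_normal (c t) \<bullet> n" for t
    define f where "f t = \<Gamma> * (level_curv (D (c t)) (H (c t)) / (real DIM('a) - 1)) + C" for t
    have Pn: "P (c t) \<bullet> n = - f t * N t" if "\<bar>t\<bar> < \<delta>" for t
      using boundary_gradient(1)[OF chart cfr[OF that] \<delta>(2)[OF that]] mean_curvature_eq[OF cfr[OF that] \<delta>(2)[OF that]]
      by (simp add: f_def N_def)
    have df: "(f has_real_derivative \<Gamma> * (d / (real DIM('a) - 1))) (at 0)"
      using DERIV_add[OF DERIV_cmult[OF DERIV_cdivide[OF d(2)], of \<Gamma> "real DIM('a) - 1"] DERIV_const[of C]]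
      by (simp add: f_def[abs_def] c_def)
    have "(\<lambda>x. inverse (norm (D x))) differentiable (at Q)"
      using differentiable_chain_at[of D Q norm] differentiable_norm_at[OF D_nonzero[of Q]] dD[of Q] D_nonzero[of Q]
      by (intro differentiable_inverse) (auto simp: o_def differentiable_def)
    moreover have "D differentiable (at Q)" using dD differentiable_def by blast
    ultimately have "(\<lambda>x. unit_normal x \<bullet> n) differentiable (at Q)"
      by (intro differentiable_inner differentiable_scaleR differentiable_const)
    moreover have "c differentiable (at 0)"
      using dc unfolding has_vector_derivative_def differentiable_def by blast
    ultimately have "N differentiable (at 0)"
      using differentiable_chain_at[of c 0 "\<lambda>x. unit_normal x \<bullet> n"] c0 by (simp add: N_def[abs_def] o_def)
    then obtain N' where dN: "(N has_real_derivative N') (at 0)" using real_differentiable_def by blast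
    have N0: "N 0 = 1" using n1 by (simp add: N_def c0 n_def[symmetric])
    \<comment> \<open>The angle between the normals is extremal at \<open>t = 0\<close>, so only the curvature is differentiated.\<close>
    have "N t \<le> N 0" for t
    proof -
      have "N t \<le> norm (unit_normal (c t)) * norm n" unfolding N_def by (rule norm_cauchy_schwarz)
      also have "\<dots> = 1" using nn D_nonzero[of "c t"] by simp
      finally show ?thesis using N0 by simp
    qed
    then have N'0: "N' = 0" using DERIV_local_max[OF dN zero_less_one] by blast
    have "((\<lambda>t. - f t * N t) has_real_derivative (- (\<Gamma> * (d / (real DIM('a) - 1))) * N 0 + N' * (- f 0))) (at 0)"
      by (rule DERIV_mult[OF DERIV_minus[OF df] dN])
    then have 1: "((\<lambda>t. P (c t) \<bullet> n) has_real_derivative (- (\<Gamma> * (d / (real DIM('a) - 1))) * N 0 + N' * (- f 0))) (at 0)"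
      by (rule has_field_derivative_transform_within_open[of _ _ _ "{-\<delta><..<\<delta>}"]) (use Pn \<delta>(1) in auto)
    have "((\<lambda>t. P (c t)) has_vector_derivative X Q s) (at 0)"
      by (rule gradient_along_curve(2)[OF dc c0 Qcl \<delta>(1)]) (use cfr cl in blast)
    then have "((\<lambda>t. P (c t) \<bullet> n) has_derivative (\<lambda>h. (h *\<^sub>R X Q s) \<bullet> n)) (at 0)"
      unfolding has_vector_derivative_def by (rule has_derivative_inner_left)
    then have 2: "((\<lambda>t. P (c t) \<bullet> n) has_real_derivative X Q s \<bullet> n) (at 0)"
      by (simp add: has_field_derivative_def mult_commute_abs)
    have "X Q s \<bullet> n = - (\<Gamma> * (d / (real DIM('a) - 1)))" using DERIV_unique[OF 2 1] N0 N'0 by simp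
    moreover have "\<Gamma> * (d / (real DIM('a) - 1)) \<ge> 0" using \<Gamma> d(1) dim by simp
    ultimately show ?thesis by simp
  qed

  obtain \<rho> where \<rho>: "\<rho> > 0" "cball (Q + \<rho> *\<^sub>R n) \<rho> - {Q} \<subseteq> \<Omega>"
    using interior_ball[OF Qb G0] unfolding n_def by blast
  define c where "c = Q + \<rho> *\<^sub>R n"
  have Qc: "norm (Q - c) = \<rho>" "s \<bullet> (Q - c) = 0" using \<rho> nn ns by (simp_all add: c_def inner_commute)
  have ce: "c \<bullet> e = l" using Q ns by (simp add: c_def inner_add_left)
  have Rc: "R c = c" "R Q = Q" using refl_on_plane[OF ce] refl_on_plane[OF Q(2)] by auto
  have cballW: "x \<in> W" if x: "x \<in> cball c \<rho>" "x \<noteq> Q" for x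
  proof -
    have "R x \<in> cball c \<rho>" using x(1) dist_refl[OF unit_e, of l c x] Rc by simp
    moreover have "R x \<noteq> Q" using x(2) Rc refl_invol[OF unit_e, of l x] by metis
    moreover have "cball c \<rho> - {Q} \<subseteq> \<Omega>" using \<rho>(2) by (simp only: c_def)
    ultimately have "x \<in> \<Omega>" "R x \<in> \<Omega>" using x by blast+
    then show ?thesis by (simp add: W_def)
  qed
  have cballS: "cball c \<rho> \<subseteq> closure \<Omega> \<inter> R -` closure \<Omega>"
  proof
    fix x assume x: "x \<in> cball c \<rho>"
    show "x \<in> closure \<Omega> \<inter> R -` closure \<Omega>"
    proof (cases "x = Q")
      case True
      then show ?thesis using Qcl Rc by simp
    next
      case False
      then show ?thesis using cballW[OF x] W_sub by blast
    qed
  qed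
  have \<sigma>: "s \<bullet> (x - c) = l - x \<bullet> e" for x
    using ce by (simp add: s_def inner_diff_right inner_commute)
  define S where "S = {x. 0 < s \<bullet> (x - c) \<and> norm (x - c) < \<rho> \<and> norm (x - Q) < \<rho> / 2}"
  define Rg where "Rg = {x. 0 \<le> s \<bullet> (x - c) \<and> norm (x - c) \<le> \<rho> \<and> norm (x - Q) \<le> \<rho> / 2}"
  have half: "x \<in> \<Omega>'" if "x \<in> cball c \<rho>" "s \<bullet> (x - c) > 0" for x
    using cballW[OF that(1)] that(2) Q(2) unfolding \<sigma> by (auto simp: \<Omega>'_def W_def)
  have S\<Omega>': "S \<subseteq> \<Omega>'" using half by (auto simp: S_def dist_norm norm_minus_commute)
  have Rg: "Rg \<subseteq> cball c \<rho>" by (auto simp: Rg_def dist_norm norm_minus_commute)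
  obtain K B where K: "K \<ge> 0" "supersolution W P q K w Dw Lw" "\<And>x. x \<in> W \<Longrightarrow> P x \<bullet> P x \<le> B \<and> q x \<bullet> q x \<le> B"
    using supersolution_w by blast
  have SW: "S \<subseteq> W" using S\<Omega>' \<Omega>'_W by blast
  have bd: "P x \<bullet> P x \<le> B" "q x \<bullet> q x \<le> B" if "x \<in> S" for x using K(3) SW that by blast+
  have cw: "continuous_on Rg w" by (rule cont_w) (use Rg cballS in blast)
  have nonneg: "w x \<ge> 0" if x: "x \<in> Rg" for x
  proof (cases "s \<bullet> (x - c) > 0")
    case True
    then show ?thesis using pos[OF half] x Rg less_imp_le by blast
  next
    case False
    then have "x \<bullet> e = l" using x unfolding Rg_def \<sigma> by auto
    then show ?thesis using w_plane by simp
  qed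
  obtain M where M: "M \<ge> 0" "\<And>x. x \<in> closure \<Omega> \<Longrightarrow> norm (P x) \<le> M" using gradient_bound by blast
  obtain Bh where Bh: "Bh \<ge> 0" "\<And>x v. x \<in> closure \<Omega> \<Longrightarrow> norm (X x v) \<le> Bh * norm v" using hessian_bound by blast
  define Cm where "Cm = 4 * Bh * M * \<rho> + 2 * M\<^sup>2"
  have Cm: "Cm \<ge> 0" using Bh M \<rho> by (simp add: Cm_def)
  have mixed: "\<bar>(P x \<bullet> s) * (P x \<bullet> (x - c)) + (q x \<bullet> s) * (q x \<bullet> (x - c))\<bar> \<le> Cm * (s \<bullet> (x - c))"
    if x: "x \<in> S" for x
  proof -
    define h where "h = s \<bullet> (x - c)"
    have h: "h > 0" using x by (simp add: S_def h_def)
    have xr: "norm (x - c) \<le> \<rho>" using x by (simp add: S_def)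
    have xc: "x \<in> ball c \<rho>" "R x \<in> ball c \<rho>"
      using x dist_refl[OF unit_e, of l c x] Rc by (auto simp: S_def dist_norm norm_minus_commute)
    have bcl: "ball c \<rho> \<subseteq> closure \<Omega>" using cballS ball_subset_cball by blast
    define p' where "p' = P (R x)"
    have pM: "norm (P x) \<le> M" "norm p' \<le> M" using M(2) bcl xc by (auto simp: p'_def)
    have "norm (P x - p') \<le> Bh * norm (x - R x)"
      unfolding p'_def
    proof (rule differentiable_bound[of "ball c \<rho>" P X])
      fix y assume y: "y \<in> ball c \<rho>"
      show "(P has_derivative X y) (at y within ball c \<rho>)"
        using grad_hessD(2)[OF grad_hess_subset[OF gh bcl] y] .
      show "onorm (X y) \<le> Bh" using Bh(2)[of y] bcl y by (intro onorm_bound Bh(1)) auto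
    qed (use xc in auto)
    also have "norm (x - R x) = 2 * h"
      using h unit_e by (simp add: refl_def h_def \<sigma>)
    finally have dp: "norm (P x - p') \<le> 2 * Bh * h" by simp
    have qs: "q x \<bullet> s = - (p' \<bullet> s)"
      unfolding q_def p'_def refl0_adjoint by (simp add: refl0_def s_def ee inner_commute algebra_simps)
    have qy: "q x \<bullet> (x - c) = p' \<bullet> (x - c) - 2 * h * (p' \<bullet> s)"
    proof -
      have "(x - c) \<bullet> e = - h" by (simp add: h_def s_def inner_commute)
      then have "R0 (x - c) = (x - c) - (2 * h) *\<^sub>R s" by (simp add: refl0_def s_def)
      then show ?thesis unfolding q_def p'_def refl0_adjoint by (simp add: inner_diff_right)
    qed
    have "(P x \<bullet> s) * (P x \<bullet> (x - c)) + (q x \<bullet> s) * (q x \<bullet> (x - c))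
        = ((P x - p') \<bullet> s) * (P x \<bullet> (x - c)) + (p' \<bullet> s) * ((P x - p') \<bullet> (x - c)) + 2 * h * (p' \<bullet> s)\<^sup>2"
      unfolding qs qy inner_diff_left by (simp add: power2_eq_square algebra_simps)
    also have "\<bar>\<dots>\<bar> \<le> (2 * Bh * h) * (M * \<rho>) + M * ((2 * Bh * h) * \<rho>) + 2 * h * M\<^sup>2"
    proof -
      have cs: "\<bar>v \<bullet> w\<bar> \<le> A * A'" if "norm v \<le> A" "norm w \<le> A'" "0 \<le> A" for v w :: 'a and A A'
        using Cauchy_Schwarz_ineq2[of v w] mult_mono[OF that(1,2) that(3) norm_ge_zero] by linarith
      have hB: "0 \<le> 2 * Bh * h" using Bh h by simp
      have t1: "\<bar>((P x - p') \<bullet> s) * (P x \<bullet> (x - c))\<bar> \<le> (2 * Bh * h) * (M * \<rho>)"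
        unfolding abs_mult
        by (rule mult_mono) (use cs[OF dp, of s 1] cs[OF pM(1) xr M(1)] s(1) hB M \<rho> in auto)
      have t2: "\<bar>(p' \<bullet> s) * ((P x - p') \<bullet> (x - c))\<bar> \<le> M * ((2 * Bh * h) * \<rho>)"
        unfolding abs_mult
        by (rule mult_mono) (use cs[OF pM(2), of s 1] cs[OF dp xr hB] s(1) M in auto)
      have "\<bar>p' \<bullet> s\<bar> \<le> \<bar>M\<bar>" using cs[OF pM(2), of s 1] s(1) M by simp
      then have "(p' \<bullet> s)\<^sup>2 \<le> M\<^sup>2" by (simp add: abs_le_square_iff)
      then have t3: "\<bar>2 * h * (p' \<bullet> s)\<^sup>2\<bar> \<le> 2 * h * M\<^sup>2" using h by simp
      show ?thesis using t1 t2 t3 by linarith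
    qed
    also have "\<dots> = Cm * h" by (simp add: Cm_def algebra_simps)
    finally show ?thesis by (simp add: h_def)
  qed
  have "\<exists>\<epsilon>>0. \<forall>x\<in>{x \<in> Rg. norm (x - Q) = \<rho> / 2}. \<epsilon> * (s \<bullet> (x - c)) \<le> w x"
  proof (rule uniform_on_compact[where Q = "\<lambda>\<epsilon> x. \<epsilon> * (s \<bullet> (x - c)) \<le> w x"])
    have "{x \<in> Rg. norm (x - Q) = \<rho> / 2} = {x. 0 \<le> s \<bullet> (x - c)} \<inter> (cball c \<rho> \<inter> sphere Q (\<rho> / 2))"
      by (auto simp: Rg_def dist_norm norm_minus_commute)
    moreover have "closed {x. 0 \<le> s \<bullet> (x - c)}" by (intro closed_Collect_le continuous_intros)
    ultimately show "compact {x \<in> Rg. norm (x - Q) = \<rho> / 2}"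
      by (simp add: closed_Int_compact compact_Int)
    fix x assume x: "x \<in> {x \<in> Rg. norm (x - Q) = \<rho> / 2}"
    then have "x \<noteq> Q" using \<rho>(1) by auto
    then have xW: "x \<in> W" using cballW x Rg by blast
    have "x \<bullet> e \<le> l" using x by (simp add: Rg_def \<sigma>)
    from local_linear_growth[OF pos xW this]
    show "\<exists>\<epsilon>>0. \<exists>\<delta>>0. \<forall>z\<in>ball x \<delta>. z \<in> {x \<in> Rg. norm (x - Q) = \<rho> / 2} \<longrightarrow> \<epsilon> * (s \<bullet> (z - c)) \<le> w z"
      unfolding \<sigma> Rg_def by fastforce
  next
    fix \<epsilon> \<epsilon>' :: real and z assume "\<epsilon> \<le> \<epsilon>'" and z: "z \<in> {x \<in> Rg. norm (x - Q) = \<rho> / 2}" and le: "\<epsilon>' * (s \<bullet> (z - c)) \<le> w z"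
    then have "\<epsilon> * (s \<bullet> (z - c)) \<le> \<epsilon>' * (s \<bullet> (z - c))" by (intro mult_right_mono) (auto simp: Rg_def)
    then show "\<epsilon> * (s \<bullet> (z - c)) \<le> w z" using le by linarith
  qed
  then obtain \<epsilon> where \<epsilon>: "\<epsilon> > 0" "\<And>x. x \<in> Rg \<Longrightarrow> norm (x - Q) = \<rho> / 2 \<Longrightarrow> \<epsilon> * (s \<bullet> (x - c)) \<le> w x" by blast
  obtain \<kappa> where \<kappa>: "\<kappa> > 0" "\<And>t. 0 < t \<Longrightarrow> t \<le> 1/4 \<Longrightarrow> \<kappa> * t\<^sup>2 \<le> w (Q + t *\<^sub>R ((c - Q) + \<rho> *\<^sub>R s))"
    using corner_lemma[OF s(1) \<rho>(1) Qc supersolution_subset[OF K(2) SW, unfolded S_def] K(1) bd[unfolded S_def] Cm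
        mixed[unfolded S_def] cw[unfolded Rg_def] nonneg[unfolded Rg_def] \<epsilon>(1) \<epsilon>(2)[unfolded Rg_def]] by blast

  \<comment> \<open>Along the diagonal direction \<open>w\<close> vanishes to second order with a nonpositive coefficient.\<close>
  define \<eta>1 where "\<eta>1 = \<rho> *\<^sub>R n + \<rho> *\<^sub>R s"
  define \<eta>2 where "\<eta>2 = \<rho> *\<^sub>R n - \<rho> *\<^sub>R s"
  have R\<eta>: "R0 \<eta>1 = \<eta>2"
  proof -
    have "\<eta>1 \<bullet> e = - \<rho>" by (simp add: \<eta>1_def inner_add_left inner_diff_left ns s_def ee)
    moreover have "(\<rho> * 2) *\<^sub>R e = \<rho> *\<^sub>R e + \<rho> *\<^sub>R e" by (simp only: mult_2_right scaleR_left_distrib)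
    ultimately show ?thesis by (simp add: refl0_def \<eta>1_def \<eta>2_def s_def mult.commute)
  qed
  have line: "R (Q + t *\<^sub>R \<eta>1) = Q + t *\<^sub>R \<eta>2" for t by (simp add: refl_line Rc R\<eta>)
  have incb1: "Q + t *\<^sub>R \<eta>1 \<in> cball c \<rho>" if "0 \<le> t" "t \<le> 1" for t
  proof -
    have "Q + t *\<^sub>R \<eta>1 - c = \<rho> *\<^sub>R ((t - 1) *\<^sub>R n + t *\<^sub>R s)"
      by (simp add: \<eta>1_def c_def algebra_simps)
    then have "norm (Q + t *\<^sub>R \<eta>1 - c) = \<rho> * norm ((t - 1) *\<^sub>R n + t *\<^sub>R s)" using \<rho> by simp
    moreover have "(norm ((t - 1) *\<^sub>R n + t *\<^sub>R s))\<^sup>2 \<le> 1\<^sup>2"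
    proof -
      have "(norm ((t - 1) *\<^sub>R n + t *\<^sub>R s))\<^sup>2 = (t - 1) * (t - 1) + t * t"
        unfolding power2_norm_eq_inner by (simp add: inner_add_left inner_add_right n1 ee ns inner_commute[of s n])
      also have "\<dots> = 1 - 2 * (t * (1 - t))" by (simp add: algebra_simps)
      also have "\<dots> \<le> 1\<^sup>2" using that by simp
      finally show ?thesis .
    qed
    then have "norm ((t - 1) *\<^sub>R n + t *\<^sub>R s) \<le> 1" by (rule power2_le_imp_le) simp
    ultimately have "norm (Q + t *\<^sub>R \<eta>1 - c) \<le> \<rho>" using \<rho>(1) by (simp add: mult_left_le)
    then show ?thesis by (simp add: dist_norm norm_minus_commute)
  qed
  have incb2: "Q + t *\<^sub>R \<eta>2 \<in> cball c \<rho>" if "0 \<le> t" "t \<le> 1" for t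
    using incb1[OF that] line[of t] dist_refl[OF unit_e, of l c "Q + t *\<^sub>R \<eta>1"] Rc by simp
  have \<eta>n: "\<eta>1 \<bullet> n = \<rho>" "\<eta>2 \<bullet> n = \<rho>"
    by (simp_all add: \<eta>1_def \<eta>2_def inner_add_left inner_diff_left n1 ns inner_commute[of s n])
  have notQ: "Q + t *\<^sub>R \<eta> \<noteq> Q" if "0 < t" "\<eta> \<bullet> n = \<rho>" for t \<eta> using that \<rho>(1) by auto
  define \<phi> where "\<phi> t = w (Q + t *\<^sub>R \<eta>1)" for t
  define \<psi> where "\<psi> t = P (Q + t *\<^sub>R \<eta>1) \<bullet> \<eta>1 - P (Q + t *\<^sub>R \<eta>2) \<bullet> \<eta>2" for t
  define d where "d = X Q \<eta>1 \<bullet> \<eta>1 - X Q \<eta>2 \<bullet> \<eta>2"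
  have cont: "continuous_on {0..1/4} \<phi>"
    unfolding \<phi>_def
    by (rule continuous_on_compose2[OF cont_w[OF cballS]]) (auto intro!: continuous_intros incb1)
  have der: "(\<phi> has_real_derivative \<psi> t) (at t)" if t: "0 < t" "t < 1/4" for t
  proof -
    have in1: "Q + t *\<^sub>R \<eta>1 \<in> \<Omega>" using cballW[OF incb1 notQ] t \<eta>n by (simp add: W_def)
    have in2: "Q + t *\<^sub>R \<eta>2 \<in> \<Omega>" using cballW[OF incb2 notQ] t \<eta>n by (simp add: W_def)
    show ?thesis unfolding \<phi>_def \<psi>_def w_def line
      by (intro DERIV_diff has_real_derivative_along_line grad_hess_openD(1)[OF gh_\<Omega> _ op] in1 in2)
  qed
  have PQs: "P Q \<bullet> s = 0"
    using boundary_gradient(1)[OF chart Q(1) Qb] s(2) by simp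
  have "\<psi> 0 = P Q \<bullet> (\<eta>1 - \<eta>2)" by (simp add: \<psi>_def inner_diff_right)
  also have "\<eta>1 - \<eta>2 = (2 * \<rho>) *\<^sub>R s" by (simp add: \<eta>1_def \<eta>2_def scaleR_2 flip: scaleR_scaleR)
  finally have \<psi>0: "\<psi> 0 = 0" using PQs by simp
  have dPl: "((\<lambda>t. P (Q + t *\<^sub>R \<eta>) \<bullet> \<eta>) has_real_derivative X Q \<eta> \<bullet> \<eta>) (at 0 within {0..})"
    if in\<eta>: "\<And>t. 0 \<le> t \<Longrightarrow> t \<le> 1 \<Longrightarrow> Q + t *\<^sub>R \<eta> \<in> cball c \<rho>" for \<eta>
  proof -
    have "((\<lambda>t. Q + t *\<^sub>R \<eta>) has_vector_derivative \<eta>) (at 0 within {0..})"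
      by (auto intro!: derivative_eq_intros)
    then have "((\<lambda>t. P (Q + t *\<^sub>R \<eta>)) has_vector_derivative X Q \<eta>) (at 0 within {0..})"
      by (rule gradient_along_curve(2)[where \<delta> = 1]) (use Qcl in\<eta> cballS in auto)
    then have "((\<lambda>t. P (Q + t *\<^sub>R \<eta>) \<bullet> \<eta>) has_derivative (\<lambda>h. (h *\<^sub>R X Q \<eta>) \<bullet> \<eta>)) (at 0 within {0..})"
      unfolding has_vector_derivative_def by (rule has_derivative_inner_left)
    then show ?thesis by (simp add: has_field_derivative_def mult_commute_abs)
  qed
  have d\<psi>: "(\<psi> has_real_derivative d) (at 0 within {0..})"
    unfolding \<psi>_def d_def by (rule DERIV_diff[OF dPl[OF incb1] dPl[OF incb2]])
  have "d = 4 * \<rho>\<^sup>2 * (X Q s \<bullet> n)"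
  proof -
    have lin: "linear (X Q)" by (rule linear_X[OF Qcl])
    show ?thesis unfolding d_def \<eta>1_def \<eta>2_def
      by (simp add: linear_add[OF lin] linear_diff[OF lin] linear_cmul[OF lin] inner_add_left inner_add_right
          inner_diff_left inner_diff_right X_symmetric[OF Qcl, of n s] power2_eq_square algebra_simps)
  qed
  then have "d \<le> 0" using Xsn \<rho>(1) by (simp add: mult_nonneg_nonpos)
  then have "d < \<kappa>" using \<kappa>(1) by simp
  then obtain \<delta> where \<delta>: "\<delta> > 0" "\<And>t. 0 < t \<Longrightarrow> t < \<delta> \<Longrightarrow> \<phi> t < \<phi> 0 + \<kappa> * t\<^sup>2"
    using quadratic_upper_bound_at_right[OF cont _ der \<psi>0 d\<psi> _ \<kappa>(1)] by auto
  define t where "t = min \<delta> (1/4) / 2"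
  have t: "0 < t" "t < \<delta>" "t \<le> 1/4" using \<delta>(1) by (auto simp: t_def)
  have "\<phi> 0 = 0" using w_plane[OF Q(2)] by (simp add: \<phi>_def)
  moreover have "\<kappa> * t\<^sup>2 \<le> \<phi> t" using \<kappa>(2)[OF t(1,3)] by (simp add: \<phi>_def \<eta>1_def c_def)
  ultimately show False using \<delta>(2)[OF t(1,2)] by simp
qed

end

section \<open>Symmetry in every direction\<close>

context overdetermined
begin

lemma reflected_capI:
  assumes "norm e = 1" and "\<And>x. x \<in> \<Omega> \<Longrightarrow> x \<bullet> e > l \<Longrightarrow> refl e l x \<in> \<Omega>"
  shows "reflected_cap \<Omega> u P X a C \<Gamma> e l"
  using assms overdetermined_axioms by (intro reflected_cap.intro reflected_cap_axioms.intro)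

text \<open>
  The extreme plane reflects its cap into \<open>\<Omega>\<close>, because \<open>\<Omega>\<close> is open. Take pairs \<open>x\<close>, \<open>x - t e\<close> of a
  point in \<open>\<Omega>\<close> and a point outside whose midpoints approach the plane. If \<open>t\<close> stays away from \<open>0\<close>, the limit is a
  pair of mirror images on the boundary. Otherwise both points converge to one boundary point on the
  plane; there \<open>e\<close> cannot point into \<open>\<Omega>\<close> by the inclusion of the cap, and it cannot point out of
  \<open>\<Omega>\<close> since the step from \<open>x\<close> to \<open>x - t e\<close> leads out of \<open>\<Omega>\<close>.
\<close>

lemma symmetric_in_direction:
  assumes e: "norm e = 1"
  shows "\<exists>l. (\<forall>l'\<ge>l. \<forall>x\<in>\<Omega>. x \<bullet> e > l' \<longrightarrow> refl e l' x \<in> \<Omega>) \<and> (\<forall>x. x \<in> \<Omega> \<longleftrightarrow> refl e l x \<in> \<Omega>) \<and>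
    (\<forall>x\<in>closure \<Omega>. u (refl e l x) = u x)"
proof -
  have ee: "e \<bullet> e = 1" using e by (simp add: norm_eq_1)
  \<comment> \<open>\<open>M\<close> collects the heights of the planes that reflect some point of the domain out of it.\<close>
  define M where "M = {x \<bullet> e - t / 2 | x t. x \<in> \<Omega> \<and> t > 0 \<and> x - t *\<^sub>R e \<notin> \<Omega>}"
  obtain B where B: "\<And>x. x \<in> \<Omega> \<Longrightarrow> norm x \<le> B" using bdd bounded_iff by blast
  have xe: "\<bar>x \<bullet> e\<bar> \<le> B" if "x \<in> \<Omega>" for x
    using Cauchy_Schwarz_ineq2[of x e] e B[OF that] by simp
  have bddM: "bdd_above M"
  proof (rule bdd_aboveI[of _ B])
    fix m assume "m \<in> M"
    then obtain x t where "m = x \<bullet> e - t / 2" "x \<in> \<Omega>" "t > 0" unfolding M_def by blast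
    then show "m \<le> B" using xe[of x] by linarith
  qed
  obtain x0 where x0: "x0 \<in> \<Omega>" using ne by blast
  have "x0 - (2 * B + 1) *\<^sub>R e \<notin> \<Omega>"
  proof
    assume "x0 - (2 * B + 1) *\<^sub>R e \<in> \<Omega>"
    from xe[OF this] have "\<bar>x0 \<bullet> e - (2 * B + 1)\<bar> \<le> B" by (simp add: inner_diff_left ee)
    then show False using xe[OF x0] by linarith
  qed
  moreover have "2 * B + 1 > 0" using B[OF x0] norm_ge_zero[of x0] by linarith
  ultimately have neM: "M \<noteq> {}" unfolding M_def using x0 by blast
  define l where "l = Sup M"
  have refl_eq: "refl e l' x = x - (2 * (x \<bullet> e - l')) *\<^sub>R e" for x l' by (simp add: refl_def)
  have cap_all: "refl e l' x \<in> \<Omega>" if l': "l' \<ge> l" and x: "x \<in> \<Omega>" "x \<bullet> e > l'" for l' x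
  proof (rule ccontr)
    assume no: "refl e l' x \<notin> \<Omega>"
    define t where "t = 2 * (x \<bullet> e - l')"
    have t: "t > 0" "x - t *\<^sub>R e \<notin> \<Omega>" using x no by (auto simp: t_def refl_eq)
    obtain \<epsilon> where \<epsilon>: "\<epsilon> > 0" "ball x \<epsilon> \<subseteq> \<Omega>" using op x openE by blast
    have "x + (\<epsilon> / 2) *\<^sub>R e \<in> ball x \<epsilon>" using \<epsilon> e by (simp add: dist_norm)
    then have in': "x + (\<epsilon> / 2) *\<^sub>R e \<in> \<Omega>" using \<epsilon> by blast
    have eq: "(x + (\<epsilon> / 2) *\<^sub>R e) - (t + \<epsilon> / 2) *\<^sub>R e = x - t *\<^sub>R e" by (simp add: algebra_simps)
    have "(x + (\<epsilon> / 2) *\<^sub>R e) - (t + \<epsilon> / 2) *\<^sub>R e \<notin> \<Omega>" unfolding eq by (rule t(2))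
    moreover have "t + \<epsilon> / 2 > 0" using t \<epsilon> by simp
    ultimately have "(x + (\<epsilon> / 2) *\<^sub>R e) \<bullet> e - (t + \<epsilon> / 2) / 2 \<in> M" unfolding M_def using in' by blast
    moreover have "(x + (\<epsilon> / 2) *\<^sub>R e) \<bullet> e - (t + \<epsilon> / 2) / 2 = l' + \<epsilon> / 4"
      by (simp add: inner_add_left ee t_def field_simps)
    ultimately have "l' + \<epsilon> / 4 \<le> l" unfolding l_def using cSup_upper bddM by metis
    then show False using l' \<epsilon> by linarith
  qed
  interpret reflected_cap \<Omega> u P X a C \<Gamma> e l by (rule reflected_capI[OF e cap_all[OF order_refl]])
  have "\<exists>z\<in>\<Omega>'. w z = 0"
  proof -
    have "\<exists>x t. x \<in> \<Omega> \<and> t > 0 \<and> x - t *\<^sub>R e \<notin> \<Omega> \<and> x \<bullet> e - t / 2 > l - 1 / real (Suc k)" for k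
    proof -
      have "l - 1 / real (Suc k) < l" by simp
      then obtain m where "m \<in> M" "m > l - 1 / real (Suc k)" unfolding l_def using less_cSupE[OF _ neM] by metis
      then show ?thesis unfolding M_def by blast
    qed
    then obtain xs ts where xt: "\<And>k. xs k \<in> \<Omega>" "\<And>k. ts k > 0" "\<And>k. xs k - ts k *\<^sub>R e \<notin> \<Omega>"
      "\<And>k. xs k \<bullet> e - ts k / 2 > l - 1 / real (Suc k)" by metis
    have le: "xs k \<bullet> e - ts k / 2 \<le> l" for k
    proof -
      have "xs k \<bullet> e - ts k / 2 \<in> M" unfolding M_def using xt(1-3)[of k] by blast
      then show ?thesis unfolding l_def by (rule cSup_upper[OF _ bddM])
    qed
    have low: "(\<lambda>k. l - 1 / real (Suc k)) \<longlonglongrightarrow> l - 0"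
      by (intro tendsto_diff tendsto_const LIMSEQ_Suc[OF lim_1_over_n])
    have mid: "(\<lambda>k. xs k \<bullet> e - ts k / 2) \<longlonglongrightarrow> l"
    proof (rule tendsto_sandwich[of "\<lambda>k. l - 1 / real (Suc k)" _ _ "\<lambda>_. l"])
      show "\<forall>\<^sub>F k in sequentially. l - 1 / real (Suc k) \<le> xs k \<bullet> e - ts k / 2"
        by (rule always_eventually) (use xt(4) less_imp_le in blast)
      show "\<forall>\<^sub>F k in sequentially. xs k \<bullet> e - ts k / 2 \<le> l" by (rule always_eventually) (use le in blast)
    qed (use low in simp_all)
    \<comment> \<open>The pairs are bounded, so a subsequence converges to a point \<open>x\<close> and its mirror image.\<close>
    obtain x r where x: "x \<in> closure \<Omega>" "strict_mono r" "(xs \<circ> r) \<longlonglongrightarrow> x"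
      using compact_cl[unfolded compact_def] xt(1) cl by metis
    define X' where "X' = xs \<circ> r"
    define T' where "T' = ts \<circ> r"
    have X': "X' k \<in> \<Omega>" "T' k > 0" "X' k - T' k *\<^sub>R e \<notin> \<Omega>" for k using xt by (auto simp: X'_def T'_def)
    have Xlim: "X' \<longlonglongrightarrow> x" using x(3) by (simp add: X'_def)
    have "(\<lambda>k. X' k \<bullet> e - T' k / 2) \<longlonglongrightarrow> l"
      using LIMSEQ_subseq_LIMSEQ[OF mid x(2)] by (simp add: X'_def T'_def o_def)
    then have "(\<lambda>k. 2 * (X' k \<bullet> e - (X' k \<bullet> e - T' k / 2))) \<longlonglongrightarrow> 2 * (x \<bullet> e - l)"
      by (intro tendsto_intros Xlim)
    then have Tlim: "T' \<longlonglongrightarrow> 2 * (x \<bullet> e - l)" by simp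
    have "(\<lambda>k. X' k - T' k *\<^sub>R e) \<longlonglongrightarrow> x - (2 * (x \<bullet> e - l)) *\<^sub>R e"
      by (intro tendsto_intros Xlim Tlim)
    then have Ylim: "(\<lambda>k. X' k - T' k *\<^sub>R e) \<longlonglongrightarrow> R x" by (simp add: refl_eq)
    have RxO: "R x \<notin> \<Omega>"
    proof -
      have "closed (- \<Omega>)" using op by (simp add: closed_Compl)
      from closed_sequentially[OF this _ Ylim] X'(3) show ?thesis by auto
    qed
    have "2 * (x \<bullet> e - l) \<ge> 0" using LIMSEQ_le_const[OF Tlim] X'(2) less_imp_le by blast
    then have "x \<bullet> e \<ge> l" by simp
    then consider "x \<bullet> e > l" | "x \<bullet> e = l" by linarith
    then show ?thesis
    proof cases
      case 1
      then have "x \<notin> \<Omega>" using cap RxO by blast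
      then have xf: "x \<in> frontier \<Omega>" using x(1) frontier_eq by blast
      have "(\<lambda>k. X' k \<bullet> e) \<longlonglongrightarrow> x \<bullet> e" by (intro tendsto_intros Xlim)
      then have ev: "\<forall>\<^sub>F k in sequentially. X' k \<bullet> e > l" using 1 by (rule order_tendstoD)
      have "(\<lambda>k. X' k - (2 * (X' k \<bullet> e - l)) *\<^sub>R e) \<longlonglongrightarrow> x - (2 * (x \<bullet> e - l)) *\<^sub>R e"
        by (intro tendsto_intros Xlim)
      then have Rlim: "(\<lambda>k. R (X' k)) \<longlonglongrightarrow> R x" by (simp add: refl_eq)
      have "R x \<in> closure \<Omega>"
        by (rule Lim_in_closed_set[OF closed_closure _ _ Rlim])
           (use ev in \<open>auto elim!: eventually_mono intro: cl(1) cap X'(1)\<close>)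
      then have "R x \<in> frontier \<Omega>" using RxO frontier_eq by blast
      then show ?thesis using zero_of_tangency[OF xf 1] by blast
    next
      case 2
      then have Rx: "R x = x" by (rule refl_on_plane)
      then have xf: "x \<in> frontier \<Omega>" using x(1) RxO frontier_eq by simp
      then obtain r k G D H T where chart: "boundary_chart \<Omega> x r k G D H T" using charts by blast
      interpret ch: boundary_chart \<Omega> x r k G D H T by fact
      have xb: "x \<in> ball x r" using ch.r_pos by simp
      have G0: "G x = 0" using ch.frontier_iff[OF xb] xf by simp
      have "\<not> D x \<bullet> e > 0"
      proof
        assume "D x \<bullet> e > 0"
        then obtain \<delta> where \<delta>: "\<delta> > 0" "\<And>t. 0 < t \<Longrightarrow> t < \<delta> \<Longrightarrow> x + t *\<^sub>R e \<in> \<Omega> \<and> x - t *\<^sub>R e \<notin> closure \<Omega>"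
          using ch.sign_along_line[OF xb G0] by blast
        have h: "x + (\<delta> / 2) *\<^sub>R e \<in> \<Omega>" "x - (\<delta> / 2) *\<^sub>R e \<notin> closure \<Omega>" using \<delta>(2)[of "\<delta> / 2"] \<delta>(1) by auto
        have "(x + (\<delta> / 2) *\<^sub>R e) \<bullet> e > l" using 2 \<delta>(1) by (simp add: inner_add_left ee)
        from cap[OF h(1) this] have "R (x + (\<delta> / 2) *\<^sub>R e) \<in> \<Omega>" .
        moreover have "R0 e = - e" using scaleR_2[of e] by (simp add: refl0_def ee)
        then have "R (x + (\<delta> / 2) *\<^sub>R e) = x - (\<delta> / 2) *\<^sub>R e" by (simp add: refl_line Rx)
        ultimately show False using h(2) cl(1) by simp
      qed
      moreover have "\<not> D x \<bullet> e < 0"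
      proof
        assume neg: "D x \<bullet> e < 0"
        have "((\<lambda>y. D y \<bullet> e) \<longlongrightarrow> D x \<bullet> e) (at x)"
          using ch.isCont_D[of x] unfolding isCont_def by (intro tendsto_intros)
        then have "\<forall>\<^sub>F y in at x. D y \<bullet> e < 0" using neg by (rule order_tendstoD)
        then obtain \<delta> where \<delta>: "\<delta> > 0" "\<And>y. y \<noteq> x \<Longrightarrow> dist y x < \<delta> \<Longrightarrow> D y \<bullet> e < 0"
          unfolding eventually_at by blast
        have De: "D y \<bullet> e < 0" if "y \<in> ball x \<delta>" for y using \<delta>(2)[of y] neg that by (cases "y = x") (auto simp: dist_commute)
        define \<eta> where "\<eta> = min \<delta> r"
        have \<eta>: "\<eta> > 0" using \<delta> ch.r_pos by (simp add: \<eta>_def)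
        have "\<forall>\<^sub>F k in sequentially. X' k \<in> ball x \<eta>"
          using Xlim by (rule topological_tendstoD) (use \<eta> in auto)
        moreover have "\<forall>\<^sub>F k in sequentially. X' k - T' k *\<^sub>R e \<in> ball x \<eta>"
          using Ylim by (rule topological_tendstoD) (use \<eta> Rx in auto)
        ultimately have "\<forall>\<^sub>F k in sequentially. X' k \<in> ball x \<eta> \<and> X' k - T' k *\<^sub>R e \<in> ball x \<eta>"
          by (rule eventually_conj)
        then obtain k where k: "X' k \<in> ball x \<eta>" "X' k - T' k *\<^sub>R e \<in> ball x \<eta>"
          using eventually_happens sequentially_bot by blast
        define y where "y = X' k - T' k *\<^sub>R e"
        define t where "t = T' k"
        have t: "t > 0" using X'(2) by (simp add: t_def)
        have yt: "y + t *\<^sub>R e = X' k" by (simp add: y_def t_def)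
        have seg: "y + s *\<^sub>R e \<in> ball x \<eta>" if "0 \<le> s" "s \<le> t" for s
        proof -
          have "y + s *\<^sub>R e = (1 - s / t) *\<^sub>R y + (s / t) *\<^sub>R X' k"
            using t by (simp add: yt[symmetric] scaleR_add_right scaleR_left_diff_distrib)
          then show ?thesis
            using convexD[OF convex_ball k(2)[folded y_def] k(1), of "1 - s / t" "s / t"] that t by simp
        qed
        obtain s where s: "0 < s" "s < t" "G (y + t *\<^sub>R e) - G (y + 0 *\<^sub>R e) = (t - 0) * (D (y + s *\<^sub>R e) \<bullet> e)"
          using MVT2[OF t, of "\<lambda>s. G (y + s *\<^sub>R e)" "\<lambda>s. D (y + s *\<^sub>R e) \<bullet> e"]
            has_real_derivative_along_line[OF ch.dG] by blast
        have "D (y + s *\<^sub>R e) \<bullet> e < 0" using seg[of s] s De by (simp add: \<eta>_def)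
        then have "t * (D (y + s *\<^sub>R e) \<bullet> e) < 0" using t by (simp add: mult_pos_neg)
        then have "G (X' k) < G y" using s(3) yt by simp
        moreover have "G (X' k) > 0" using ch.\<Omega>_iff[of "X' k"] X'(1) k(1) by (simp add: \<eta>_def)
        ultimately have "y \<in> \<Omega>" using ch.\<Omega>_iff[of y] k(2) by (simp add: \<eta>_def y_def)
        then show False using X'(3) by (simp add: y_def)
      qed
      ultimately have "D x \<bullet> e = 0" by simp
      then show ?thesis using zero_of_corner[OF chart xf 2] by blast
    qed
  qed
  then obtain z where "z \<in> \<Omega>'" "w z = 0" by blast
  from symmetric_of_zero[OF this] show ?thesis using cap_all by blast
qed

definition height :: "'a \<Rightarrow> real" where
  "height e = (SOME l. (\<forall>l'\<ge>l. \<forall>x\<in>\<Omega>. x \<bullet> e > l' \<longrightarrow> refl e l' x \<in> \<Omega>) \<and> (\<forall>x. x \<in> \<Omega> \<longleftrightarrow> refl e l x \<in> \<Omega>) \<and>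
    (\<forall>x\<in>closure \<Omega>. u (refl e l x) = u x))"

lemma height:
  assumes "norm e = 1"
  shows "l' \<ge> height e \<Longrightarrow> x \<in> \<Omega> \<Longrightarrow> x \<bullet> e > l' \<Longrightarrow> refl e l' x \<in> \<Omega>"
    and "refl e (height e) x \<in> \<Omega> \<longleftrightarrow> x \<in> \<Omega>"
    and "x \<in> closure \<Omega> \<Longrightarrow> u (refl e (height e) x) = u x"
  using someI_ex[OF symmetric_in_direction[OF assms]] unfolding height_def[symmetric] by blast+

definition centre :: 'a where "centre = (\<Sum>b\<in>Basis. height b *\<^sub>R b)"

text \<open>
  The point reflection at the centre is the composition of the reflections in the coordinate
  directions.
\<close>

lemma point_symmetric: "x \<in> \<Omega> \<Longrightarrow> 2 *\<^sub>R centre - x \<in> \<Omega>"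
proof -
  assume x: "x \<in> \<Omega>"
  have "x - (\<Sum>b\<in>A. (2 * (x \<bullet> b - height b)) *\<^sub>R b) \<in> \<Omega>" if "finite A" "A \<subseteq> Basis" for A
    using that
  proof (induction A rule: finite_induct)
    case empty
    then show ?case using x by simp
  next
    case (insert b A)
    define x' where "x' = x - (\<Sum>b\<in>A. (2 * (x \<bullet> b - height b)) *\<^sub>R b)"
    have "x' \<in> \<Omega>" using insert by (simp add: x'_def)
    then have "refl b (height b) x' \<in> \<Omega>" using height(2)[of b x'] insert.prems by simp
    moreover have "(\<Sum>c\<in>A. (2 * (x \<bullet> c - height c)) * (c \<bullet> b)) = 0"
    proof (intro sum.neutral ballI)
      fix c assume "c \<in> A"
      then have "c \<bullet> b = 0" using insert by (intro inner_not_same_Basis) auto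
      then show "(2 * (x \<bullet> c - height c)) * (c \<bullet> b) = 0" by simp
    qed
    then have "x' \<bullet> b = x \<bullet> b" by (simp add: x'_def inner_diff_left inner_sum_left)
    ultimately show ?case using insert by (simp add: refl_def x'_def algebra_simps)
  qed
  then have "x - (\<Sum>b\<in>Basis. (2 * (x \<bullet> b - height b)) *\<^sub>R b) \<in> \<Omega>" by simp
  moreover have "(\<Sum>b\<in>Basis. (2 * (x \<bullet> b - height b)) *\<^sub>R b) = 2 *\<^sub>R (\<Sum>b\<in>Basis. (x \<bullet> b) *\<^sub>R b) - 2 *\<^sub>R centre"
    by (simp add: centre_def scaleR_sum_right right_diff_distrib scaleR_left_diff_distrib sum_subtractf)
  then have "x - (\<Sum>b\<in>Basis. (2 * (x \<bullet> b - height b)) *\<^sub>R b) = 2 *\<^sub>R centre - x"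
    unfolding euclidean_representation by (simp add: scaleR_2)
  ultimately show ?thesis by simp
qed

text \<open>Two parallel planes of symmetry would make the bounded domain invariant under a translation.\<close>

lemma height_eq:
  assumes e: "norm e = 1"
  shows "height e = centre \<bullet> e"
proof (rule ccontr)
  assume ne': "height e \<noteq> centre \<bullet> e"
  define d where "d = 2 * (height e - centre \<bullet> e)"
  define f where "f x = refl e (height e) (2 *\<^sub>R centre - x)" for x
  have f: "f x \<in> \<Omega>" if "x \<in> \<Omega>" for x
    unfolding f_def using height(2)[OF e] point_symmetric[OF that] by simp
  have fe: "f x \<bullet> e = x \<bullet> e + d" for x
    unfolding f_def refl_inner[OF e] d_def by (simp add: inner_diff_left)
  obtain x0 where x0: "x0 \<in> \<Omega>" using ne by blast
  have it: "(f ^^ k) x0 \<in> \<Omega> \<and> ((f ^^ k) x0) \<bullet> e = x0 \<bullet> e + real k * d" for k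
    by (induction k) (auto simp: x0 f fe algebra_simps)
  obtain B where B: "\<And>x. x \<in> \<Omega> \<Longrightarrow> norm x \<le> B" using bdd bounded_iff by blast
  have "real k * \<bar>d\<bar> \<le> 2 * B" for k
  proof -
    have "\<bar>((f ^^ k) x0) \<bullet> e\<bar> \<le> B" "\<bar>x0 \<bullet> e\<bar> \<le> B"
      using Cauchy_Schwarz_ineq2[of "(f ^^ k) x0" e] Cauchy_Schwarz_ineq2[of x0 e] e B it[of k] x0 by fastforce+
    then have "\<bar>real k * d\<bar> \<le> 2 * B" using it[of k] by linarith
    then show ?thesis by (simp add: abs_mult)
  qed
  moreover have "\<bar>d\<bar> > 0" using ne' by (simp add: d_def)
  ultimately show False using reals_Archimedean3[of "\<bar>d\<bar>"] by (meson not_le)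
qed

text \<open>
  Two points at the same distance from the centre are exchanged by the reflection in the direction of
  their difference.
\<close>

lemma radial:
  assumes "norm (x - centre) = norm (y - centre)"
  shows "x \<in> \<Omega> \<Longrightarrow> y \<in> \<Omega>" and "x \<in> closure \<Omega> \<Longrightarrow> u y = u x"
proof -
  have "(x \<in> \<Omega> \<longrightarrow> y \<in> \<Omega>) \<and> (x \<in> closure \<Omega> \<longrightarrow> u y = u x)"
  proof (cases "x = y")
    case False
    define h where "h = norm (x - y)"
    have h: "h > 0" using False by (simp add: h_def)
    define e where "e = (x - y) /\<^sub>R h"
    have e: "norm e = 1" using h by (simp add: e_def h_def)
    have "(x - centre) \<bullet> (x - centre) = (y - centre) \<bullet> (y - centre)"
      using assms by (simp flip: power2_norm_eq_inner)
    then have "2 * ((x - centre) \<bullet> (x - y)) = (x - y) \<bullet> (x - y)"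
      by (simp add: inner_diff_left inner_diff_right inner_commute)
    then have "2 * ((x - centre) \<bullet> (x - y)) = h\<^sup>2" by (simp add: h_def power2_norm_eq_inner)
    moreover have "x \<bullet> e - centre \<bullet> e = ((x - centre) \<bullet> (x - y)) / h"
      unfolding inner_diff_left[symmetric] e_def by (simp add: divide_inverse mult.commute)
    ultimately have "2 * (x \<bullet> e - height e) = h"
      using h by (simp add: height_eq[OF e] power2_eq_square)
    then have "refl e (height e) x = y" using h by (simp add: refl_def e_def)
    then show ?thesis using height(2,3)[OF e, of x] by auto
  qed simp
  then show "x \<in> \<Omega> \<Longrightarrow> y \<in> \<Omega>" "x \<in> closure \<Omega> \<Longrightarrow> u y = u x" by auto
qed

text \<open>
  The planes beyond the centre and the plane through it reflect \<open>x\<close> onto every point between the centre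
  and the antipode of \<open>x\<close>. Every distance from the centre up to that of \<open>x\<close> occurs among them, and \<open>\<Omega>\<close> is
  radial.
\<close>

lemma star_shaped:
  assumes x: "x \<in> \<Omega>" and y: "norm (y - centre) \<le> norm (x - centre)"
  shows "y \<in> \<Omega>"
proof (cases "x = centre")
  case True
  then show ?thesis using x y by simp
next
  case False
  define d where "d = norm (x - centre)"
  define d' where "d' = norm (y - centre)"
  have d: "d > 0" "0 \<le> d'" "d' \<le> d" using False y by (auto simp: d_def d'_def)
  define e where "e = (x - centre) /\<^sub>R d"
  have e: "norm e = 1" using d by (simp add: e_def d_def)
  have xe: "x = centre + d *\<^sub>R e" using d by (simp add: e_def)
  have "x \<bullet> e = centre \<bullet> e + d" using e by (subst xe) (simp add: inner_add_left norm_eq_1)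
  then have "2 * (x \<bullet> e - (centre \<bullet> e + (d - d') / 2)) = d + d'" by (simp add: field_simps)
  then have "refl e (centre \<bullet> e + (d - d') / 2) x = x - (d + d') *\<^sub>R e" by (simp only: refl_def)
  also have "\<dots> = centre - d' *\<^sub>R e" by (subst xe) (simp add: algebra_simps)
  finally have "centre - d' *\<^sub>R e \<in> \<Omega>"
    using height(1)[OF e, of "centre \<bullet> e + (d - d') / 2" x] x d \<open>x \<bullet> e = centre \<bullet> e + d\<close>
    by (simp add: height_eq[OF e])
  moreover have "norm ((centre - d' *\<^sub>R e) - centre) = norm (y - centre)" using e d by (simp add: d'_def)
  ultimately show ?thesis using radial(1) by blast
qed

lemma is_ball:
  "\<exists>x0 R. R > 0 \<and> \<Omega> = ball x0 R \<and> (\<exists>\<phi>::real \<Rightarrow> real. \<forall>x\<in>closure \<Omega>. u x = \<phi> (norm (x - x0)))"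
proof -
  obtain b :: 'a where b: "b \<in> Basis" using nonempty_Basis by blast
  have further: "\<exists>y\<in>\<Omega>. norm (x - centre) < norm (y - centre)" if x: "x \<in> \<Omega>" for x
  proof -
    obtain \<delta> where \<delta>: "\<delta> > 0" "ball x \<delta> \<subseteq> \<Omega>" using op x openE by blast
    define v where "v = (if x = centre then b else (x - centre) /\<^sub>R norm (x - centre))"
    have v: "norm v = 1" "x - centre = norm (x - centre) *\<^sub>R v" using b by (auto simp: v_def)
    define y where "y = x + (\<delta> / 2) *\<^sub>R v"
    have "y \<in> ball x \<delta>" using \<delta>(1) v(1) by (simp add: y_def dist_norm)
    moreover have "y - centre = (norm (x - centre) + \<delta> / 2) *\<^sub>R v"
      using v(2) by (simp add: y_def scaleR_add_left algebra_simps)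
    then have "norm (y - centre) = norm (x - centre) + \<delta> / 2" using v(1) \<delta>(1) by simp
    ultimately show ?thesis using \<delta> by (intro bexI[of _ y]) auto
  qed
  define N where "N = (\<lambda>x. norm (x - centre)) ` \<Omega>"
  have neN: "N \<noteq> {}" using ne by (simp add: N_def)
  obtain B where B: "\<And>x. x \<in> \<Omega> \<Longrightarrow> norm x \<le> B" using bdd bounded_iff by blast
  have bddN: "bdd_above N"
  proof (rule bdd_aboveI[of _ "B + norm centre"])
    fix m assume "m \<in> N"
    then obtain x where "x \<in> \<Omega>" "m = norm (x - centre)" by (auto simp: N_def)
    then show "m \<le> B + norm centre" using B[of x] norm_triangle_ineq4[of x centre] by linarith
  qed
  define \<rho> where "\<rho> = Sup N"
  have lt: "norm (x - centre) < \<rho>" if x: "x \<in> \<Omega>" for x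
  proof -
    obtain y where "y \<in> \<Omega>" "norm (x - centre) < norm (y - centre)" using further[OF x] by blast
    moreover have "norm (y - centre) \<le> \<rho>"
      unfolding \<rho>_def by (rule cSup_upper[OF _ bddN]) (use \<open>y \<in> \<Omega>\<close> in \<open>simp add: N_def\<close>)
    ultimately show ?thesis by linarith
  qed
  have "\<Omega> = ball centre \<rho>"
  proof (intro equalityI subsetI)
    fix x assume "x \<in> \<Omega>"
    then show "x \<in> ball centre \<rho>" using lt by (simp add: dist_norm norm_minus_commute)
  next
    fix x assume "x \<in> ball centre \<rho>"
    then have "norm (x - centre) < Sup N" by (simp add: \<rho>_def dist_norm norm_minus_commute)
    then obtain m where "m \<in> N" "norm (x - centre) < m" using less_cSupE[OF _ neN] by metis
    then obtain y where "y \<in> \<Omega>" "norm (x - centre) \<le> norm (y - centre)" by (auto simp: N_def)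
    then show "x \<in> \<Omega>" by (rule star_shaped)
  qed
  moreover have "\<rho> > 0"
  proof -
    obtain x where "x \<in> \<Omega>" using ne by blast
    then show ?thesis using lt[of x] norm_ge_zero[of "x - centre"] by linarith
  qed
  moreover have "u x = u (centre + norm (x - centre) *\<^sub>R b)" if "x \<in> closure \<Omega>" for x
    using radial(2)[of x "centre + norm (x - centre) *\<^sub>R b"] that b by simp
  ultimately show ?thesis by (intro exI[of _ centre] exI[of _ \<rho>] conjI exI[of _ "\<lambda>s. u (centre + s *\<^sub>R b)"]) auto
qed

end

theorem theorem1p1:
  fixes \<Omega> :: "(real ^ 'n) set" and u :: "real ^ 'n \<Rightarrow> real"
    and \<alpha> a C \<Gamma> :: real
  assumes dim: "CARD('n) \<ge> 2"
    and \<alpha>: "0 < \<alpha>" "\<alpha> < 1"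
    and domain: "open \<Omega>" "connected \<Omega>" "\<Omega> \<noteq> {}" "bounded \<Omega>"
    and boundary: "holder_boundary 4 \<alpha> \<Omega>"
    and \<Gamma>: "\<Gamma> \<ge> 0"
    and regularity: "u \<in> holder_space_closure 4 \<alpha> \<Omega>"
    and equation: "\<forall>x\<in>\<Omega>.
      - divergence (\<lambda>y. gradient u y /\<^sub>R sqrt (1 + (norm (gradient u y))\<^sup>2)) x
        = 1 / sqrt (1 + (norm (gradient u x))\<^sup>2)"
    and dirichlet: "\<forall>x\<in>frontier \<Omega>. u x = a"
    and neumann: "\<forall>x\<in>frontier \<Omega>.
      has_normal_derivative \<Omega> u (\<Gamma> * mean_curvature \<Omega> x + C) x"
  shows "\<exists>x\<^sub>0 R. R > 0 \<and> \<Omega> = ball x\<^sub>0 R \<and>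
    (\<exists>\<phi>::real \<Rightarrow> real. \<forall>x\<in>closure \<Omega>. u x = \<phi> (norm (x - x\<^sub>0)))"
proof -
  obtain P X where gh: "grad_hess (closure \<Omega>) u P X" and cX: "\<And>k. continuous_on (closure \<Omega>) (\<lambda>x. X x k)"
    using holder_space_grad_hess[OF domain(1) boundary regularity] by blast
  have gh': "grad_hess \<Omega> u P X" using gh closure_subset by (rule grad_hess_subset)
  interpret overdetermined \<Omega> u P X a C \<Gamma>
  proof
    show "2 \<le> DIM(real ^ 'n)" using dim by simp
    show "\<exists>r k G D H T. boundary_chart \<Omega> p r k G D H T" if "p \<in> frontier \<Omega>" for p
      by (rule holder_boundary_chart[OF domain(1) boundary that])
    show "ell (P x) (X x) = - (1 + P x \<bullet> P x)" if "x \<in> \<Omega>" for x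
      by (rule translator_equation_ell[OF domain(1) gh' that]) (use equation that in blast)
  qed (use domain \<Gamma> gh cX dirichlet neumann in auto)
  show ?thesis by (rule is_ball)
qed

end
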